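(* Let $T>0$ and let $(X,Y)$ be the $\mathbb{R}^d\times\mathbb{R}^n$-valued process on $[0,T]$ given by the signal-observation system $$X_t = X_0+\int_0^t b(s,X_s)\,ds+\int_0^t\sigma_0(s)\,dB_s+\int_0^t\sigma_1(s)\,dW_s,\qquad Y_t=\int_0^t h(X_s)\,ds+W_t,$$ where $b(t,\cdot):\mathbb{R}^d\to\mathbb{R}^d$ is linear for each $t$, the diffusion coefficients $\sigma_0:[0,T]\to\mathbb{R}^{d\times d}$ and $\sigma_1:[0,T]\to\mathbb{R}^{d\times n}$ do not depend on the state, and $\sigma_1$ is not zero Lebesgue-almost everywhere on $[0,T]$. Let $P_X$ be the law of $X$ on $\mathbf{X}=C([0,T],\mathbb{R}^d)$ and $P_{XY}$ the joint law of $(X,Y)$ on $\mathbf{X}\times\mathbf{Y}$, where $\mathbf{Y}=C([0,T],\mathbb{R}^n)$. Then there is no $\sigma$-finite measure $\lambda_Y$ on $(\mathbf{Y},\mathcal{Y})$ such that $P_{XY}\ll P_X\otimes\lambda_Y$.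
   Context: The path spaces $\mathbf{X}=C([0,T],\mathbb{R}^d)$ and $\mathbf{Y}=C([0,T],\mathbb{R}^n)$ carry the uniform norm and their Borel $\sigma$-algebras $\mathcal{X}$, $\mathcal{Y}$. $B$ and $W$ are independent standard Brownian motions of dimension $d$ and $n$ respectively, $X_0$ has law $\mu$ on $\mathbb{R}^d$ and is independent of $(B,W)$, and $b,\sigma_0,\sigma_1,h$ (with $h:\mathbb{R}^d\to\mathbb{R}^n$) are measurable. Standing assumption: the coefficients are regular enough that all integrals in the system are well defined, the system has a solution that is unique in law, the signal equation has a strong solution, and $\mathbb{E}\left[\int_0^T|h(X_s)|^2\,ds\right]<\infty$. $\ll$ denotes absolute continuity. *)

theory Defs
  imports "HOL-Probability.Probability"
begin

text \<open>
  The space of continuous paths on the interval from 0 to T with the uniform metric. As usual for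
  \<^const>\<open>cfunspace\<close>, a path is a function on the reals that equals \<^const>\<open>undefined\<close>
  outside the interval.
\<close>

definition path_metric :: "real \<Rightarrow> (real \<Rightarrow> 'a::euclidean_space) metric" where
  "path_metric T = cfunspace (top_of_set {0..T}) euclidean_metric"

definition path_space :: "real \<Rightarrow> (real \<Rightarrow> 'a::euclidean_space) measure" where
  "path_space T =
     sigma (mspace (path_metric T)) {U. openin (mtopology_of (path_metric T)) U}"

lemma space_path_space:
  "space (path_space T) = {w. w \<in> extensional {0..T} \<and> continuous_on {0..T} w}"
proof -
  have "Met_TC.mbounded (w ` {0..T})" if "continuous_on {0..T} w" for w :: "real \<Rightarrow> 'a"
    using compact_imp_bounded[OF compact_continuous_image[OF that compact_Icc]]
    by simp
  moreover have "U \<subseteq> mspace (path_metric T)"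
    if "openin (mtopology_of (path_metric T)) U" for U :: "(real \<Rightarrow> 'a) set"
    using openin_subset[OF that] by simp
  ultimately show ?thesis
    unfolding path_space_def
    by (subst space_measure_of) (auto simp: path_metric_def)
qed

text \<open>
  A continuous process on the interval from 0 to T is a random element of the path space:
  \<open>X \<omega> t\<close> is the position of the path \<open>X \<omega>\<close> at time \<open>t\<close>.
\<close>

abbreviation continuous_process ::
    "real \<Rightarrow> 'w measure \<Rightarrow> ('w \<Rightarrow> real \<Rightarrow> 'a::euclidean_space) \<Rightarrow> bool" where
  "continuous_process T M X \<equiv> X \<in> M \<rightarrow>\<^sub>M path_space T"

definition std_brownian_motion ::
    "real \<Rightarrow> 'w measure \<Rightarrow> ('w \<Rightarrow> real \<Rightarrow> real^'m) \<Rightarrow> bool" where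
  "std_brownian_motion T M W \<longleftrightarrow>
     continuous_process T M W \<and>
     (AE \<omega> in M. W \<omega> 0 = 0) \<and>
     (\<forall>s t. 0 \<le> s \<and> s < t \<and> t \<le> T \<longrightarrow>
        distributed M lborel (\<lambda>\<omega>. W \<omega> t - W \<omega> s)
          (\<lambda>x. ennreal (\<Prod>i\<in>UNIV. normal_density 0 (sqrt (t - s)) (x $ i)))) \<and>
     (\<forall>(n::nat) r. r 0 \<ge> 0 \<and> (\<forall>k<n. r k \<le> r (Suc k)) \<and> r n \<le> T \<longrightarrow>
        prob_space.indep_vars M (\<lambda>_. borel) (\<lambda>k \<omega>. W \<omega> (r (Suc k)) - W \<omega> (r k)) {..<n})"

text \<open>
  The step function with value \<open>c k\<close> on the interval from \<open>r k\<close> (exclusive) to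
  \<open>r (Suc k)\<close> (inclusive), for \<open>k < n\<close>, and its integral against a path \<open>w\<close> up to time
  \<open>t\<close>.
\<close>

definition step_fun ::
    "nat \<Rightarrow> (nat \<Rightarrow> real) \<Rightarrow> (nat \<Rightarrow> real^'m^'k) \<Rightarrow> real \<Rightarrow> real^'m^'k" where
  "step_fun n r c s = (\<Sum>k<n. indicator {r k<..r (Suc k)} s *\<^sub>R c k)"

definition step_integral ::
    "nat \<Rightarrow> (nat \<Rightarrow> real) \<Rightarrow> (nat \<Rightarrow> real^'m^'k) \<Rightarrow> (real \<Rightarrow> real^'m) \<Rightarrow> real \<Rightarrow> real^'k" where
  "step_integral n r c w t =
     (\<Sum>k<n. c k *v (w (min (r (Suc k)) t) - w (min (r k) t)))"

definition partition_of :: "real \<Rightarrow> nat \<Rightarrow> (nat \<Rightarrow> real) \<Rightarrow> bool" where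
  "partition_of T n r \<longleftrightarrow> r 0 = 0 \<and> r n = T \<and> (\<forall>k<n. r k \<le> r (Suc k))"

text \<open>
  \<open>I\<close> is a continuous version of the process of integrals of \<open>\<sigma>\<close> against \<open>W\<close>: the
  \<open>L\<^sup>2\<close>-limit of the integrals of step functions that tend to \<open>\<sigma>\<close> in \<open>L\<^sup>2\<close> on the
  interval from 0 to T. The norm of a matrix is its Frobenius norm. No such \<open>I\<close> exists unless
  \<open>\<sigma>\<close> is square integrable, so this relation also expresses that the integral is well defined.
\<close>

definition has_stochastic_integral ::
    "real \<Rightarrow> 'w measure \<Rightarrow> (real \<Rightarrow> real^'m^'k) \<Rightarrow> ('w \<Rightarrow> real \<Rightarrow> real^'m)
      \<Rightarrow> ('w \<Rightarrow> real \<Rightarrow> real^'k) \<Rightarrow> bool" where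
  "has_stochastic_integral T M \<sigma> W I \<longleftrightarrow>
     continuous_process T M I \<and>
     (\<exists>n r c.
        (\<forall>m::nat. partition_of T (n m) (r m)) \<and>
        (\<lambda>m. \<integral>\<^sup>+s\<in>{0..T}. ennreal ((norm (step_fun (n m) (r m) (c m) s - \<sigma> s))\<^sup>2) \<partial>lborel)
          \<longlonglongrightarrow> 0 \<and>
        (\<forall>t\<in>{0..T}.
          (\<lambda>m. \<integral>\<^sup>+\<omega>. ennreal ((norm (step_integral (n m) (r m) (c m) (W \<omega>) t - I \<omega> t))\<^sup>2) \<partial>M)
            \<longlonglongrightarrow> 0))"

text \<open>
  Independence of two random elements, stated by their generated \<open>\<sigma>\<close>-algebras because
  \<^const>\<open>prob_space.indep_var\<close> needs both to take values in the same type.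
\<close>

definition indep_elements ::
    "'w measure \<Rightarrow> 'a measure \<Rightarrow> ('w \<Rightarrow> 'a) \<Rightarrow> 'b measure \<Rightarrow> ('w \<Rightarrow> 'b) \<Rightarrow> bool" where
  "indep_elements M N U N' V \<longleftrightarrow>
     U \<in> M \<rightarrow>\<^sub>M N \<and> V \<in> M \<rightarrow>\<^sub>M N' \<and>
     prob_space.indep_set M (sets (vimage_algebra (space M) U N)) (sets (vimage_algebra (space M) V N'))"

definition system_inputs ::
    "real \<Rightarrow> (real^'d) measure \<Rightarrow> 'w measure \<Rightarrow> ('w \<Rightarrow> real^'d)
      \<Rightarrow> ('w \<Rightarrow> real \<Rightarrow> real^'d) \<Rightarrow> ('w \<Rightarrow> real \<Rightarrow> real^'n) \<Rightarrow> bool" where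
  "system_inputs T \<mu> M X0 B W \<longleftrightarrow>
     prob_space M \<and>
     std_brownian_motion T M B \<and> std_brownian_motion T M W \<and>
     indep_elements M (path_space T) B (path_space T) W \<and>
     X0 \<in> borel_measurable M \<and> distr M borel X0 = \<mu> \<and>
     indep_elements M borel X0
       (path_space T \<Otimes>\<^sub>M path_space T) (\<lambda>\<omega>. (B \<omega>, W \<omega>))"

definition signal_equation ::
    "real \<Rightarrow> (real \<Rightarrow> real^'d \<Rightarrow> real^'d) \<Rightarrow> (real \<Rightarrow> real^'d^'d) \<Rightarrow> (real \<Rightarrow> real^'n^'d)
      \<Rightarrow> 'w measure \<Rightarrow> ('w \<Rightarrow> real^'d) \<Rightarrow> ('w \<Rightarrow> real \<Rightarrow> real^'d) \<Rightarrow> ('w \<Rightarrow> real \<Rightarrow> real^'n)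
      \<Rightarrow> ('w \<Rightarrow> real \<Rightarrow> real^'d) \<Rightarrow> bool" where
  "signal_equation T b \<sigma>0 \<sigma>1 M X0 B W X \<longleftrightarrow>
     continuous_process T M X \<and>
     (AE \<omega> in M. set_integrable lborel {0..T} (\<lambda>s. b s (X \<omega> s))) \<and>
     (\<exists>I J. has_stochastic_integral T M \<sigma>0 B I \<and> has_stochastic_integral T M \<sigma>1 W J \<and>
        (AE \<omega> in M. \<forall>t\<in>{0..T}.
           X \<omega> t = X0 \<omega> + (LINT s:{0..t}|lborel. b s (X \<omega> s)) + I \<omega> t + J \<omega> t))"

definition observation_equation ::
    "real \<Rightarrow> (real^'d \<Rightarrow> real^'n) \<Rightarrow> 'w measure \<Rightarrow> ('w \<Rightarrow> real \<Rightarrow> real^'n)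
      \<Rightarrow> ('w \<Rightarrow> real \<Rightarrow> real^'d) \<Rightarrow> ('w \<Rightarrow> real \<Rightarrow> real^'n) \<Rightarrow> bool" where
  "observation_equation T h M W X Y \<longleftrightarrow>
     continuous_process T M Y \<and>
     (AE \<omega> in M. set_integrable lborel {0..T} (\<lambda>s. h (X \<omega> s))) \<and>
     (AE \<omega> in M. \<forall>t\<in>{0..T}. Y \<omega> t = (LINT s:{0..t}|lborel. h (X \<omega> s)) + W \<omega> t)"

definition system_solution ::
    "real \<Rightarrow> (real^'d) measure \<Rightarrow> (real \<Rightarrow> real^'d \<Rightarrow> real^'d) \<Rightarrow> (real \<Rightarrow> real^'d^'d)
      \<Rightarrow> (real \<Rightarrow> real^'n^'d) \<Rightarrow> (real^'d \<Rightarrow> real^'n) \<Rightarrow> 'w measure \<Rightarrow> ('w \<Rightarrow> real^'d)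
      \<Rightarrow> ('w \<Rightarrow> real \<Rightarrow> real^'d) \<Rightarrow> ('w \<Rightarrow> real \<Rightarrow> real^'n)
      \<Rightarrow> ('w \<Rightarrow> real \<Rightarrow> real^'d) \<Rightarrow> ('w \<Rightarrow> real \<Rightarrow> real^'n) \<Rightarrow> bool" where
  "system_solution T \<mu> b \<sigma>0 \<sigma>1 h M X0 B W X Y \<longleftrightarrow>
     system_inputs T \<mu> M X0 B W \<and>
     signal_equation T b \<sigma>0 \<sigma>1 M X0 B W X \<and>
     observation_equation T h M W X Y"

definition law_X :: "real \<Rightarrow> 'w measure \<Rightarrow> ('w \<Rightarrow> real \<Rightarrow> real^'d) \<Rightarrow> (real \<Rightarrow> real^'d) measure" where
  "law_X T M X = distr M (path_space T) X"

definition law_XY ::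
    "real \<Rightarrow> 'w measure \<Rightarrow> ('w \<Rightarrow> real \<Rightarrow> real^'d) \<Rightarrow> ('w \<Rightarrow> real \<Rightarrow> real^'n)
      \<Rightarrow> ((real \<Rightarrow> real^'d) \<times> (real \<Rightarrow> real^'n)) measure" where
  "law_XY T M X Y = distr M (path_space T \<Otimes>\<^sub>M path_space T) (\<lambda>\<omega>. (X \<omega>, Y \<omega>))"

text \<open>
  The solutions compared here live on the type of tuples \<open>(X0, B, W, X, Y)\<close>. This is no
  restriction: any solution on another type is carried, with its law, to the coordinate maps of that
  type by the joint law of its five components.
\<close>

definition unique_in_law ::
    "real \<Rightarrow> (real^'d) measure \<Rightarrow> (real \<Rightarrow> real^'d \<Rightarrow> real^'d) \<Rightarrow> (real \<Rightarrow> real^'d^'d)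
      \<Rightarrow> (real \<Rightarrow> real^'n^'d) \<Rightarrow> (real^'d \<Rightarrow> real^'n) \<Rightarrow> bool" where
  "unique_in_law T \<mu> b \<sigma>0 \<sigma>1 h \<longleftrightarrow>
     (\<forall>(M :: ((real^'d) \<times> (real \<Rightarrow> real^'d) \<times> (real \<Rightarrow> real^'n)
               \<times> (real \<Rightarrow> real^'d) \<times> (real \<Rightarrow> real^'n)) measure) X0 B W X Y
       (M' :: ((real^'d) \<times> (real \<Rightarrow> real^'d) \<times> (real \<Rightarrow> real^'n)
               \<times> (real \<Rightarrow> real^'d) \<times> (real \<Rightarrow> real^'n)) measure) X0' B' W' X' Y'.
        system_solution T \<mu> b \<sigma>0 \<sigma>1 h M X0 B W X Y \<and>
        system_solution T \<mu> b \<sigma>0 \<sigma>1 h M' X0' B' W' X' Y' \<longrightarrow>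
        law_XY T M X Y = law_XY T M' X' Y')"

definition input_history ::
    "'w measure \<Rightarrow> ('w \<Rightarrow> real^'d) \<Rightarrow> ('w \<Rightarrow> real \<Rightarrow> real^'d) \<Rightarrow> ('w \<Rightarrow> real \<Rightarrow> real^'n)
      \<Rightarrow> real \<Rightarrow> 'w measure" where
  "input_history M X0 B W t =
     vimage_algebra (space M) (\<lambda>\<omega>. (X0 \<omega>, \<lambda>s\<in>{0..t}. (B \<omega> s, W \<omega> s)))
       (borel \<Otimes>\<^sub>M (\<Pi>\<^sub>M s\<in>{0..t}. borel))"

text \<open>
  A strong solution is adapted to the completed filtration generated by the inputs. Measurability
  with respect to the completed \<open>\<sigma>\<close>-algebra is expressed by a version \<open>Z\<close> that is
  measurable with respect to the uncompleted one.
\<close>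

definition strong_signal_solution ::
    "real \<Rightarrow> (real \<Rightarrow> real^'d \<Rightarrow> real^'d) \<Rightarrow> (real \<Rightarrow> real^'d^'d) \<Rightarrow> (real \<Rightarrow> real^'n^'d)
      \<Rightarrow> 'w measure \<Rightarrow> ('w \<Rightarrow> real^'d) \<Rightarrow> ('w \<Rightarrow> real \<Rightarrow> real^'d) \<Rightarrow> ('w \<Rightarrow> real \<Rightarrow> real^'n)
      \<Rightarrow> ('w \<Rightarrow> real \<Rightarrow> real^'d) \<Rightarrow> bool" where
  "strong_signal_solution T b \<sigma>0 \<sigma>1 M X0 B W X \<longleftrightarrow>
     signal_equation T b \<sigma>0 \<sigma>1 M X0 B W X \<and>
     (\<forall>t\<in>{0..T}. \<exists>Z \<in> borel_measurable (input_history M X0 B W t). AE \<omega> in M. X \<omega> t = Z \<omega>)"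

end

theory Submission
  imports Defs
begin

text \<open>
  The paths of a solution retain the noise that they share, and the covariation detects it. Write
  \<open>Z\<close> for the sum of the two stochastic integrals in the signal equation. Then \<open>X\<close> is \<open>Z\<close> plus a path
  of finite variation, and \<open>Y\<close> is \<open>W\<close> plus a path of finite variation. For a component \<open>i\<close> of the
  signal, a component \<open>j\<close> of the observation and a partition of the interval from 0 to \<open>t\<close>, let
  \<open>Q(x, y)\<close> be the sum of the products of the increments of \<open>x\<^sub>i\<close> and \<open>y\<^sub>j\<close> over the cells.

  Under the joint law, the finite variation parts contribute nothing in the limit of vanishing mesh
  (lemma \<open>bracket_finite_variation_tendsto_0\<close>). Neither does the integral against \<open>B\<close>, which is
  independent of \<open>W\<close>. So along a suitable sequence of partitions \<open>Q(X, Y)\<close> tends almost surely to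
  the integral \<open>c\<close> of the entry \<open>(i, j)\<close> of \<open>\<sigma>1\<close> from 0 to \<open>t\<close> (lemma \<open>bracket_sequence\<close>). As \<open>\<sigma>1\<close>
  is not almost everywhere zero, some choice of \<open>i\<close>, \<open>j\<close> and \<open>t\<close> makes \<open>c\<close> nonzero.

  Now freeze the second argument at a continuous path \<open>y\<close>. Again \<open>Q(X, y)\<close> and \<open>Q(Z, y)\<close> have the same
  limit, because they differ by a finite variation part. For each partition, \<open>Q(Z, y)\<close> is a linear
  functional of a centered Gaussian process, hence a centered normal variable. Its variance is
  unknown and may behave in any way as the partition changes, but this does not matter: the density of
  a centered normal law at a point \<open>x\<close> other than 0 is at most \<open>1 / \<bar>x\<bar>\<close>, whatever the variance. The
  probability that \<open>Q(Z, y)\<close> falls within \<open>e\<close> of \<open>c\<close> is therefore at most \<open>8 e / \<bar>c\<bar>\<close> for all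
  small \<open>e\<close> and all partitions at once, so the limit \<open>c\<close> is attained with probability zero (lemma
  \<open>bracket_with_fixed_path_avoids\<close>).

  The set of pairs \<open>(x, y)\<close> for which \<open>Q(x, y)\<close> tends to \<open>c\<close> thus has full measure under the joint law,
  whereas each of its sections at fixed \<open>y\<close> is a null set for the law of the signal. By Fubini it is
  a null set of the product of that law with any \<open>\<sigma>\<close>-finite measure.
\<close>

section \<open>Centered normal laws\<close>

text \<open>
  The law is described as an image of the standard normal law, rather than by a density, in order to
  include the variance \<open>v = 0\<close>: a variable that vanishes almost surely.
\<close>

definition centered_normal :: "'a measure \<Rightarrow> ('a \<Rightarrow> real) \<Rightarrow> real \<Rightarrow> bool" where
  "centered_normal M f v \<longleftrightarrow> f \<in> borel_measurable M \<and> 0 \<le> v \<and>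
     distr M borel f = distr std_normal_distribution borel (\<lambda>x. sqrt v * x)"

text \<open>
  Characteristic functions treat the degenerate and the nondegenerate case alike and turn sums of
  independent variables into products.
\<close>

lemma centered_normal_iff_char:
  assumes "prob_space M"
  shows "centered_normal M f v \<longleftrightarrow> f \<in> borel_measurable M \<and> 0 \<le> v \<and>
    (\<forall>t. char (distr M borel f) t = complex_of_real (exp (- (v * t\<^sup>2) / 2)))"
proof -
  interpret prob_space M by fact
  interpret N: real_distribution std_normal_distribution by (rule real_dist_normal_dist)
  have N: "real_distribution (distr std_normal_distribution borel (\<lambda>x. sqrt v * x))"
    by (simp add: N.real_distribution_distr)
  have charN: "char (distr std_normal_distribution borel (\<lambda>x. sqrt v * x))
      = (\<lambda>t. complex_of_real (exp (- (v * t\<^sup>2) / 2)))" if "0 \<le> v"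
  proof
    fix t
    have "char (distr std_normal_distribution borel (\<lambda>x. sqrt v * x)) t
        = char std_normal_distribution (t * sqrt v)"
      unfolding char_def by (subst integral_distr) (auto simp: mult_ac)
    also have "\<dots> = complex_of_real (exp (- (v * t\<^sup>2) / 2))"
      using that by (simp add: char_std_normal_distribution power_mult_distrib mult.commute)
    finally show "char (distr std_normal_distribution borel (\<lambda>x. sqrt v * x)) t
        = complex_of_real (exp (- (v * t\<^sup>2) / 2))" .
  qed
  have D: "real_distribution (distr M borel f)" if "f \<in> borel_measurable M"
    using that by (rule real_distribution_distr)
  show ?thesis
  proof (intro iffI conjI; (elim conjE)?)
    assume "f \<in> borel_measurable M" "0 \<le> v"
      "\<forall>t. char (distr M borel f) t = complex_of_real (exp (- (v * t\<^sup>2) / 2))"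
    then show "centered_normal M f v"
      unfolding centered_normal_def using Levy_uniqueness[OF D N] charN by auto
  qed (auto simp: centered_normal_def charN)
qed

lemma centered_normal_0:
  assumes "prob_space M" shows "centered_normal M (\<lambda>_. 0) 0"
proof -
  interpret prob_space M by fact
  show ?thesis
    by (subst centered_normal_iff_char)
      (auto simp: assms char_def integral_distr prob_space simp del: distr_const)
qed

lemma centered_normal_cong_AE:
  assumes "centered_normal M f v" "AE x in M. f x = g x" "g \<in> borel_measurable M"
  shows "centered_normal M g v"
proof -
  have "distr M borel g = distr M borel f"
    using assms by (intro distr_cong_AE) (auto simp: centered_normal_def)
  then show ?thesis using assms by (simp add: centered_normal_def)
qed

lemma centered_normal_cmult:
  assumes M: "prob_space M" and f: "centered_normal M f v"
  shows "centered_normal M (\<lambda>x. a * f x) (a\<^sup>2 * v)"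
proof -
  interpret prob_space M by fact
  have [measurable]: "f \<in> borel_measurable M" using f by (simp add: centered_normal_def)
  have "char (distr M borel (\<lambda>x. a * f x)) t = char (distr M borel f) (t * a)" for t
    unfolding char_def by (simp add: integral_distr mult_ac)
  then show ?thesis
    using f by (auto simp: centered_normal_iff_char[OF M] power_mult_distrib mult_ac)
qed

lemma centered_normal_sum:
  assumes M: "prob_space M" and ind: "prob_space.indep_vars M (\<lambda>_. borel) f A"
    and "finite A" and f: "\<And>i. i \<in> A \<Longrightarrow> centered_normal M (f i) (v i)"
  shows "centered_normal M (\<lambda>x. \<Sum>i\<in>A. f i x) (\<Sum>i\<in>A. v i)"
proof -
  interpret prob_space M by fact
  have [measurable]: "\<And>i. i \<in> A \<Longrightarrow> f i \<in> borel_measurable M"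
    using f by (simp add: centered_normal_def)
  have "char (distr M borel (\<lambda>x. \<Sum>i\<in>A. f i x)) t
      = complex_of_real (exp (- ((\<Sum>i\<in>A. v i) * t\<^sup>2) / 2))" for t
  proof -
    have "char (distr M borel (\<lambda>x. \<Sum>i\<in>A. f i x)) t = (\<Prod>i\<in>A. char (distr M borel (f i)) t)"
      by (rule char_distr_sum[OF ind])
    also have "\<dots> = (\<Prod>i\<in>A. complex_of_real (exp (- (v i * t\<^sup>2) / 2)))"
      using f by (intro prod.cong) (auto simp: centered_normal_iff_char[OF M])
    also have "\<dots> = complex_of_real (exp (\<Sum>i\<in>A. - (v i * t\<^sup>2) / 2))"
      using \<open>finite A\<close> by (simp add: exp_sum)
    also have "(\<Sum>i\<in>A. - (v i * t\<^sup>2) / 2) = - ((\<Sum>i\<in>A. v i) * t\<^sup>2) / 2"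
      by (simp add: sum_distrib_right sum_divide_distrib sum_negf)
    finally show ?thesis .
  qed
  moreover have "0 \<le> (\<Sum>i\<in>A. v i)"
    using f by (intro sum_nonneg) (auto simp: centered_normal_def)
  ultimately show ?thesis by (auto simp: centered_normal_iff_char[OF M])
qed

lemma centered_normal_add:
  assumes M: "prob_space M" and ind: "prob_space.indep_var M borel f borel g"
    and f: "centered_normal M f v" and g: "centered_normal M g w"
  shows "centered_normal M (\<lambda>x. f x + g x) (v + w)"
proof -
  interpret prob_space M by fact
  have [measurable]: "f \<in> borel_measurable M" "g \<in> borel_measurable M"
    using f g by (auto simp: centered_normal_def)
  show ?thesis
    using f g char_distr_add[OF ind]
    by (auto simp: centered_normal_iff_char[OF M] distrib_right diff_divide_distrib
        simp flip: of_real_mult exp_add)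
qed

lemma centered_normal_moments:
  assumes "centered_normal M f v"
  shows "integrable M (\<lambda>x. f x ^ k)" "(LINT x|M. f x) = 0" "(LINT x|M. (f x)\<^sup>2) = v"
    "(LINT x|M. f x ^ 4) = 3 * v\<^sup>2"
proof -
  have [measurable]: "f \<in> borel_measurable M" and v: "0 \<le> v"
    and D: "distr M borel f = distr std_normal_distribution borel (\<lambda>x. sqrt v * x)"
    using assms by (auto simp: centered_normal_def)
  have *: "(LINT x|M. f x ^ k) = sqrt v ^ k * (LINT x|std_normal_distribution. x ^ k)" for k
  proof -
    have "(LINT x|M. f x ^ k) = (LINT y|distr M borel f. y ^ k)"
      by (simp add: integral_distr)
    also have "\<dots> = (LINT x|std_normal_distribution. (sqrt v * x) ^ k)"
      unfolding D by (subst integral_distr) auto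
    finally show ?thesis by (simp add: power_mult_distrib)
  qed
  have "integrable (distr M borel f) (\<lambda>y. y ^ k)"
    unfolding D using integrable_std_normal_distribution_moment[of k]
    by (subst integrable_distr_eq) (auto simp: power_mult_distrib)
  then show "integrable M (\<lambda>x. f x ^ k)"
    by (subst (asm) integrable_distr_eq) auto
  show "(LINT x|M. f x) = 0"
    using *[of 1] integral_std_normal_distribution_moment_odd[of 1] by simp
  show "(LINT x|M. (f x)\<^sup>2) = v"
    using *[of 2] std_normal_distribution_even_moments(1)[of 1] v by (simp add: fact_numeral)
  have "sqrt v ^ 4 = v\<^sup>2"
    using v by (metis mult_2_right numeral_Bit0 power_mult real_sqrt_pow2 power2_eq_square power_add)
  then show "(LINT x|M. f x ^ 4) = 3 * v\<^sup>2"
    using *[of 4] std_normal_distribution_even_moments(1)[of 2] by (simp add: fact_numeral)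
qed

text \<open>
  The bound does not involve \<open>v\<close>. With \<open>u = \<bar>x\<bar> / sqrt v\<close>, the density at \<open>x\<close> is \<open>1 / \<bar>x\<bar>\<close> times
  \<open>u exp (- u\<^sup>2 / 2) / sqrt (2 pi)\<close>, and the second factor is at most 1. On the ball of radius \<open>e\<close>
  around \<open>c\<close>, whose length is \<open>2 e\<close>, one has \<open>\<bar>x\<bar> \<ge> \<bar>c\<bar> / 2\<close>.
\<close>

lemma centered_normal_anticoncentration:
  assumes M: "prob_space M" and f: "centered_normal M f v"
    and e: "0 < e" "2 * e \<le> \<bar>c\<bar>"
  shows "measure M {x\<in>space M. \<bar>f x - c\<bar> \<le> e} \<le> 4 * e / \<bar>c\<bar>"
proof -
  interpret prob_space M by fact
  interpret N: real_distribution std_normal_distribution by (rule real_dist_normal_dist)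
  have [measurable]: "f \<in> borel_measurable M" and v: "0 \<le> v"
    and D: "distr M borel f = distr std_normal_distribution borel (\<lambda>x. sqrt v * x)"
    using f by (auto simp: centered_normal_def)
  define s where "s = sqrt v"
  have s0: "0 \<le> s" using v by (simp add: s_def)
  have c: "0 < \<bar>c\<bar>" using e by linarith
  have "measure M {x\<in>space M. \<bar>f x - c\<bar> \<le> e} = measure (distr M borel f) {y. \<bar>y - c\<bar> \<le> e}"
    by (subst measure_distr) (auto intro!: arg_cong[of _ _ "measure M"])
  also have "\<dots> = measure std_normal_distribution {x. \<bar>s * x - c\<bar> \<le> e}"
    unfolding D s_def[symmetric] by (subst measure_distr) (auto intro!: arg_cong[of _ _ "measure _"])
  also have "\<dots> \<le> 4 * e / \<bar>c\<bar>"
  proof (cases "s = 0")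
    case True
    then have "{x::real. \<bar>s * x - c\<bar> \<le> e} = {}" using e by auto
    then show ?thesis using e by simp
  next
    case False
    with s0 have s: "0 < s" by simp
    have set: "{x. \<bar>s * x - c\<bar> \<le> e} = {(c - e) / s .. (c + e) / s}"
      using s by (auto simp: field_simps abs_le_iff)
    have dens: "std_normal_density x \<le> 2 * s / \<bar>c\<bar>" if "\<bar>s * x - c\<bar> \<le> e" for x
    proof -
      \<comment> \<open>In standardised coordinates: \<open>x\<close> stands for the value divided by the standard deviation \<open>s\<close>.\<close>
      have x: "\<bar>c\<bar> / 2 \<le> s * \<bar>x\<bar>"
      proof -
        have "\<bar>c\<bar> - e \<le> \<bar>s * x\<bar>" using that by linarith
        then show ?thesis using e s by (simp add: abs_mult)
      qed
      then have x0: "0 < \<bar>x\<bar>" using c s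
        by (metis abs_ge_zero half_gt_zero linorder_not_le mult_zero_right order_le_less)
      have "\<bar>x\<bar> \<le> 1 + x\<^sup>2 / 2"
        using zero_le_power2[of "\<bar>x\<bar> - 1"] by (simp add: power2_diff)
      also have "\<dots> \<le> exp (x\<^sup>2 / 2)" by (rule exp_ge_add_one_self)
      finally have "exp (- x\<^sup>2 / 2) \<le> 1 / \<bar>x\<bar>"
        using x0 by (simp add: exp_minus field_simps)
      moreover have "1 / sqrt (2 * pi) \<le> 1" using pi_gt3 by simp
      ultimately have "std_normal_density x \<le> 1 * (1 / \<bar>x\<bar>)"
        unfolding std_normal_density_def by (intro mult_mono) auto
      also have "\<dots> \<le> 2 * s / \<bar>c\<bar>" using x x0 c by (simp add: field_simps)
      finally show ?thesis .
    qed
    have "emeasure std_normal_distribution {x. \<bar>s * x - c\<bar> \<le> e}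
        = (\<integral>\<^sup>+x. ennreal (std_normal_density x) * indicator {(c - e) / s .. (c + e) / s} x \<partial>lborel)"
      by (subst emeasure_density) (auto simp: set)
    also have "\<dots> \<le> (\<integral>\<^sup>+x. ennreal (2 * s / \<bar>c\<bar>) * indicator {(c - e) / s .. (c + e) / s} x \<partial>lborel)"
      using dens by (intro nn_integral_mono) (auto simp: indicator_def simp flip: set intro!: ennreal_leI)
    also have "\<dots> = ennreal (2 * s / \<bar>c\<bar>) * ennreal ((c + e) / s - (c - e) / s)"
      using s e by (subst nn_integral_cmult_indicator) (auto simp: field_simps)
    also have "\<dots> = ennreal (2 * s / \<bar>c\<bar> * ((c + e) / s - (c - e) / s))"
      using s e by (subst ennreal_mult) (auto simp: field_simps)
    also have "2 * s / \<bar>c\<bar> * ((c + e) / s - (c - e) / s) = 4 * e / \<bar>c\<bar>"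
      using s c by (simp add: field_simps)
    finally show ?thesis
      using e by (simp add: N.emeasure_eq_measure)
  qed
  finally show ?thesis .
qed

section \<open>Paths and Brownian increments\<close>

text \<open>
  Evaluation at a time is Lipschitz for the uniform metric, so preimages of open sets are open.
\<close>

lemma measurable_path_eval:
  assumes t: "t \<in> {0..T}"
  shows "(\<lambda>w :: real \<Rightarrow> 'a::euclidean_space. w t) \<in> path_space T \<rightarrow>\<^sub>M borel"
proof (rule borel_measurableI)
  fix S :: "'a set" assume S: "open S"
  let ?m = "path_metric T :: (real \<Rightarrow> 'a) metric"
  have "U \<subseteq> mspace ?m" if "openin (mtopology_of ?m) U" for U
    using openin_subset[OF that] by simp
  then have sub: "{U. openin (mtopology_of ?m) U} \<subseteq> Pow (mspace ?m)"
    by blast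
  have ms: "space (path_space T) = mspace ?m"
    unfolding path_space_def by (rule space_measure_of[OF sub])
  have "openin (mtopology_of ?m) ((\<lambda>w. w t) -` S \<inter> mspace ?m)"
    unfolding mtopology_of_def Metric_space.openin_mtopology[OF Metric_space_mspace_mdist]
  proof (rule conjI[OF Int_lower2], intro allI impI)
    fix w assume w: "w \<in> (\<lambda>w. w t) -` S \<inter> mspace ?m"
    then obtain r where r: "r > 0" "\<And>y. dist y (w t) < r \<Longrightarrow> y \<in> S"
      using S by (auto simp: open_dist)
    have "Metric_space.mball (mspace ?m) (mdist ?m) w r \<subseteq> (\<lambda>w. w t) -` S \<inter> mspace ?m"
    proof
      fix u assume "u \<in> Metric_space.mball (mspace ?m) (mdist ?m) w r"
      then have u: "u \<in> mspace ?m" "mdist ?m w u < r"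
        by (simp_all add: Metric_space.in_mball[OF Metric_space_mspace_mdist])
      have "w \<in> mspace ?m" using w by (rule IntD2)
      then have "mdist euclidean_metric (w t) (u t) \<le> mdist ?m w u"
        unfolding path_metric_def
        by (rule mdist_cfunspace_imp_mdist_le[OF _ u(1)[unfolded path_metric_def] order_refl])
          (use t in auto)
      then have "dist (u t) (w t) < r" using u(2) by (simp add: dist_commute)
      then show "u \<in> (\<lambda>w. w t) -` S \<inter> mspace ?m" using r u by auto
    qed
    then show "\<exists>r>0. Metric_space.mball (mspace ?m) (mdist ?m) w r \<subseteq> (\<lambda>w. w t) -` S \<inter> mspace ?m"
      using r(1) by (intro exI[of _ r] conjI)
  qed
  then show "(\<lambda>w. w t) -` S \<inter> space (path_space T) \<in> sets (path_space T)"
    unfolding ms unfolding path_space_def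
    unfolding sets_measure_of[OF sub] by (intro sigma_sets.Basic CollectI)
qed

lemma measurable_path_component:
  assumes "t \<in> {0..T}"
  shows "(\<lambda>w :: real \<Rightarrow> real^'m. w t $ k) \<in> borel_measurable (path_space T)"
  unfolding cart_eq_inner_axis
  by (intro borel_measurable_inner borel_measurable_const measurable_path_eval assms)

lemma continuous_process_measurable:
  assumes "continuous_process T M X" "t \<in> {0..T}"
  shows "(\<lambda>\<omega>. X \<omega> t) \<in> borel_measurable M"
  using measurable_compose[OF assms(1) measurable_path_eval[OF assms(2)]] .

lemma continuous_process_continuous_on:
  assumes "continuous_process T M X" "\<omega> \<in> space M"
  shows "continuous_on {0..T} (X \<omega>)"
  using measurable_space[OF assms] by (simp add: space_path_space)

text \<open>
  On boxes, the integral of the product density factorises over the coordinates. Boxes with a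
  single nontrivial side give the marginal laws.
\<close>

lemma indep_vars_components:
  fixes V :: "'w \<Rightarrow> real^'m"
  assumes M: "prob_space M" and s: "0 < s"
    and V: "distributed M lborel V (\<lambda>x. ennreal (\<Prod>i\<in>UNIV. normal_density 0 s (x $ i)))"
  shows "prob_space.indep_vars M (\<lambda>_. borel) (\<lambda>i \<omega>. V \<omega> $ i) UNIV"
    and "distributed M lborel (\<lambda>\<omega>. V \<omega> $ i) (normal_density 0 s)"
proof -
  interpret prob_space M by fact
  have V_meas[measurable]: "V \<in> borel_measurable M"
    using V by (simp add: distributed_def)
  have [measurable]: "(\<lambda>\<omega>. V \<omega> $ i) \<in> borel_measurable M" for i
    using borel_measurable_inner[OF V_meas borel_measurable_const[of "axis i 1"]]
    by (simp add: inner_axis)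
  have box: "emeasure M {\<omega>\<in>space M. \<forall>i. V \<omega> $ i \<in> A i}
      = (\<Prod>i\<in>UNIV. \<integral>\<^sup>+x. ennreal (normal_density 0 s x) * indicator (A i) x \<partial>lborel)"
    if [measurable]: "\<And>i. A i \<in> sets borel" for A :: "'m \<Rightarrow> real set"
  proof -
    define g where "g i x = ennreal (normal_density 0 s x) * indicator (A i) x" for i x
    have [measurable]: "\<And>i. g i \<in> borel_measurable borel" unfolding g_def by measurable
    define bi where "bi b = (THE i. b = axis i (1::real))" for b :: "real^'m"
    have bi: "bi (axis i 1) = i" for i :: 'm
      unfolding bi_def by (rule the_equality) (auto simp: axis_eq_axis)
    have B: "Basis = (\<lambda>i. axis i (1::real)) ` (UNIV :: 'm set)"
      by (auto simp: Basis_vec_def)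
    have inj: "inj (\<lambda>i::'m. axis i (1::real))" by (auto simp: inj_def axis_eq_axis)
    have pr: "(\<Prod>b\<in>Basis. F b) = (\<Prod>i\<in>UNIV. F (axis i 1))" for F :: "real^'m \<Rightarrow> ennreal"
      unfolding B by (subst prod.reindex[OF inj]) auto
    have "{\<omega>\<in>space M. \<forall>i. V \<omega> $ i \<in> A i} = V -` {x. \<forall>i. x $ i \<in> A i} \<inter> space M" by auto
    then have "emeasure M {\<omega>\<in>space M. \<forall>i. V \<omega> $ i \<in> A i}
        = (\<integral>\<^sup>+x. ennreal (\<Prod>i\<in>UNIV. normal_density 0 s (x $ i)) * indicator {x. \<forall>i. x $ i \<in> A i} x \<partial>lborel)"
      using distributed_emeasure[OF V, of "{x. \<forall>i. x $ i \<in> A i}"] by simp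
    also have "\<dots> = (\<integral>\<^sup>+x. (\<Prod>i\<in>UNIV. g i (x $ i)) \<partial>lborel)"
    proof (rule nn_integral_cong)
      fix x :: "real^'m"
      have "indicator {x. \<forall>i. x $ i \<in> A i} x = (\<Prod>i\<in>UNIV. indicator (A i) (x $ i) :: ennreal)"
        by (auto simp: indicator_def)
      then show "ennreal (\<Prod>i\<in>UNIV. normal_density 0 s (x $ i)) * indicator {x. \<forall>i. x $ i \<in> A i} x
          = (\<Prod>i\<in>UNIV. g i (x $ i))"
        by (simp add: g_def prod.distrib prod_ennreal)
    qed
    also have "\<dots> = (\<integral>\<^sup>+x. (\<Prod>b\<in>Basis. g (bi b) (x \<bullet> b)) \<partial>lborel)"
      by (simp add: pr bi inner_axis)
    also have "\<dots> = (\<Prod>b\<in>Basis. \<integral>\<^sup>+x. g (bi b) x \<partial>lborel)"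
      by (rule nn_integral_lborel_prod) auto
    also have "\<dots> = (\<Prod>i\<in>UNIV. \<integral>\<^sup>+x. g i x \<partial>lborel)"
      by (simp add: pr bi)
    finally show ?thesis unfolding g_def .
  qed
  interpret N: prob_space "density lborel (normal_density 0 s)"
    using s by (rule prob_space_normal_density)
  have total: "(\<integral>\<^sup>+x. ennreal (normal_density 0 s x) \<partial>lborel) = 1"
    using N.emeasure_space_1 by (simp add: emeasure_density)
  have comp: "distributed M lborel (\<lambda>\<omega>. V \<omega> $ i) (normal_density 0 s)" for i
  proof -
    have "emeasure (distr M lborel (\<lambda>\<omega>. V \<omega> $ i)) A
        = emeasure (density lborel (normal_density 0 s)) A"
      if "A \<in> sets (distr M lborel (\<lambda>\<omega>. V \<omega> $ i))" for A
    proof -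
      from that have [measurable]: "A \<in> sets borel" by simp
      have "emeasure (distr M lborel (\<lambda>\<omega>. V \<omega> $ i)) A
          = emeasure M {\<omega>\<in>space M. \<forall>k. V \<omega> $ k \<in> (if k = i then A else UNIV)}"
      proof (subst emeasure_distr)
        have "(\<lambda>\<omega>. V \<omega> $ i) -` A \<inter> space M = {\<omega>\<in>space M. \<forall>k. V \<omega> $ k \<in> (if k = i then A else UNIV)}"
          by auto
        then show "emeasure M ((\<lambda>\<omega>. V \<omega> $ i) -` A \<inter> space M)
          = emeasure M {\<omega>\<in>space M. \<forall>k. V \<omega> $ k \<in> (if k = i then A else UNIV)}" by simp
      qed simp_all
      also have "\<dots> = (\<Prod>k\<in>UNIV. if k = i then
          (\<integral>\<^sup>+x. ennreal (normal_density 0 s x) * indicator A x \<partial>lborel) else 1)"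
        by (subst box, simp, rule prod.cong) (auto simp: total)
      also have "\<dots> = emeasure (density lborel (normal_density 0 s)) A"
        by (simp add: emeasure_density prod.delta)
      finally show ?thesis .
    qed
    then have "distr M lborel (\<lambda>\<omega>. V \<omega> $ i) = density lborel (normal_density 0 s)"
      by (intro measure_eqI) auto
    then show ?thesis by (auto simp: distributed_def)
  qed
  show "distributed M lborel (\<lambda>\<omega>. V \<omega> $ i) (normal_density 0 s)" by (rule comp)
  show "indep_vars (\<lambda>_. borel) (\<lambda>i \<omega>. V \<omega> $ i) UNIV"
  proof (subst indep_vars_finite[where E = "\<lambda>_. sets borel"])
    have "prob (\<Inter>j\<in>UNIV. (\<lambda>\<omega>. V \<omega> $ j) -` A j \<inter> space M)
        = (\<Prod>j\<in>UNIV. prob ((\<lambda>\<omega>. V \<omega> $ j) -` A j \<inter> space M))"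
      if A: "\<And>j. A j \<in> sets borel" for A :: "'m \<Rightarrow> real set"
    proof -
      have e: "emeasure M ((\<lambda>\<omega>. V \<omega> $ j) -` A j \<inter> space M)
          = (\<integral>\<^sup>+x. ennreal (normal_density 0 s x) * indicator (A j) x \<partial>lborel)" for j
        using A distributed_emeasure[OF comp[of j], of "A j"] by simp
      have "(\<Inter>j\<in>UNIV. (\<lambda>\<omega>. V \<omega> $ j) -` A j \<inter> space M) = {\<omega>\<in>space M. \<forall>i. V \<omega> $ i \<in> A i}"
        by auto
      then have "emeasure M (\<Inter>j\<in>UNIV. (\<lambda>\<omega>. V \<omega> $ j) -` A j \<inter> space M)
          = (\<Prod>j\<in>UNIV. emeasure M ((\<lambda>\<omega>. V \<omega> $ j) -` A j \<inter> space M))"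
        using A by (simp add: box e)
      then show ?thesis
        by (simp add: emeasure_eq_measure prod_ennreal prod_nonneg)
    qed
    then show "\<forall>A\<in>UNIV \<rightarrow> sets borel. prob (\<Inter>j\<in>UNIV. (\<lambda>\<omega>. V \<omega> $ j) -` A j \<inter> space M)
        = (\<Prod>j\<in>UNIV. prob ((\<lambda>\<omega>. V \<omega> $ j) -` A j \<inter> space M))"
      by (simp add: Pi_iff)
    show "Int_stable (sets (borel :: real measure))" by (rule sets.Int_stable)
    show "sets (borel :: real measure) = sigma_sets (space borel) (sets borel)"
      by (rule sets.sigma_sets_eq[symmetric])
  qed (simp_all add: sets.space_closed[of "borel :: real measure", simplified])
qed

lemma distributed_normal_centered_normal:
  assumes M: "prob_space M" and "0 < s" and f: "distributed M lborel f (normal_density 0 s)"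
  shows "centered_normal M f (s\<^sup>2)"
proof -
  interpret prob_space M by fact
  interpret N: prob_space std_normal_distribution by (rule prob_space_normal_density) simp
  have "distributed std_normal_distribution lborel (\<lambda>x. x) (normal_density 0 1)"
    by (auto simp: distributed_def distr_id2)
  from N.normal_density_affine[OF this, of s 0] \<open>0 < s\<close>
  have "distributed std_normal_distribution lborel (\<lambda>x. s * x) (normal_density 0 s)" by simp
  with f have "distr M lborel f = distr std_normal_distribution lborel (\<lambda>x. s * x)"
    by (simp add: distributed_def)
  then have "distr M borel f = distr std_normal_distribution borel (\<lambda>x. s * x)"
    by (metis distr_cong sets_lborel)
  then show ?thesis
    using assms by (simp add: centered_normal_def distributed_def)
qed

lemma brownian_increment_normal:
  assumes M: "prob_space M" and W: "std_brownian_motion T M W" and st: "0 \<le> s" "s \<le> t" "t \<le> T"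
  shows "centered_normal M (\<lambda>\<omega>. a \<bullet> (W \<omega> t - W \<omega> s)) ((norm a)\<^sup>2 * (t - s))"
proof (cases "s = t")
  case True
  then show ?thesis using centered_normal_0[OF M] by simp
next
  case False
  interpret prob_space M by fact
  define V where "V \<omega> = W \<omega> t - W \<omega> s" for \<omega>
  have s: "0 < sqrt (t - s)" using False st by simp
  have V: "distributed M lborel V (\<lambda>x. ennreal (\<Prod>i\<in>UNIV. normal_density 0 (sqrt (t - s)) (x $ i)))"
    unfolding V_def using W st False by (auto simp: std_brownian_motion_def)
  have "centered_normal M (\<lambda>\<omega>. V \<omega> $ i) (t - s)" for i
    using distributed_normal_centered_normal[OF M s indep_vars_components(2)[OF M s V]] st by simp
  then have "centered_normal M (\<lambda>\<omega>. \<Sum>i\<in>UNIV. a $ i * V \<omega> $ i) (\<Sum>i\<in>UNIV. (a $ i)\<^sup>2 * (t - s))"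
    by (intro centered_normal_sum[OF M] indep_vars_compose2[OF indep_vars_components(1)[OF M s V]]
        centered_normal_cmult[OF M]) auto
  moreover have "(\<Sum>i\<in>UNIV. (a $ i)\<^sup>2 * (t - s)) = (norm a)\<^sup>2 * (t - s)"
    by (simp add: power2_norm_eq_inner inner_vec_def power2_eq_square[of "a $ _"] sum_distrib_right)
  ultimately show ?thesis
    by (simp add: inner_vec_def V_def)
qed

lemma brownian_increments_indep:
  assumes M: "prob_space M" and W: "std_brownian_motion T M W"
    and r: "0 \<le> r 0" "\<And>k. k < n \<Longrightarrow> r k \<le> r (Suc k)" "r n \<le> T"
  shows "prob_space.indep_vars M (\<lambda>_. borel) (\<lambda>k \<omega>. W \<omega> (r (Suc k)) - W \<omega> (r k)) {..<n}"
  using W r unfolding std_brownian_motion_def by blast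

lemma monotone_grid_mono:
  fixes r :: "nat \<Rightarrow> real"
  assumes r: "\<And>k. k < n \<Longrightarrow> r k \<le> r (Suc k)" and "i \<le> j" "j \<le> n"
  shows "r i \<le> r j"
  using assms(2,3) by (induction rule: dec_induct) (use r in \<open>auto intro: order_trans\<close>)

lemma monotone_grid_bounds:
  fixes r :: "nat \<Rightarrow> real"
  assumes "\<And>k. k < n \<Longrightarrow> r k \<le> r (Suc k)" and "k \<le> n"
  shows "r 0 \<le> r k" "r k \<le> r n"
  using monotone_grid_mono[of n r 0 k] monotone_grid_mono[of n r k n] assms by auto

text \<open>
  The increments are independent, so their variances add up. Read as a second moment, the variance
  is the isometry for integrals of step functions.
\<close>

lemma brownian_increments_sum_normal:
  assumes M: "prob_space M" and W: "std_brownian_motion T M W"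
    and r: "0 \<le> r 0" "\<And>k. k < n \<Longrightarrow> r k \<le> r (Suc k)" "r n \<le> T"
  shows "centered_normal M (\<lambda>\<omega>. \<Sum>k<n. a k \<bullet> (W \<omega> (r (Suc k)) - W \<omega> (r k)))
    (\<Sum>k<n. (norm (a k))\<^sup>2 * (r (Suc k) - r k))"
proof -
  interpret prob_space M by fact
  have b: "0 \<le> r k" "r k \<le> T" if "k \<le> n" for k
    using monotone_grid_bounds[of n r k, OF r(2) that] r(1,3) by linarith+
  show ?thesis
    by (intro centered_normal_sum[OF M] brownian_increment_normal[OF M W]
        indep_vars_compose2[OF brownian_increments_indep[OF M W r]])
      (use r b in auto)
qed

text \<open>
  For a path that starts at 0 the first term disappears, and a combination of values becomes a
  combination of increments over disjoint intervals.
\<close>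

lemma summation_by_parts_increments:
  fixes w :: "real \<Rightarrow> 'a::real_inner"
  shows "(\<Sum>p\<le>n. \<beta> p \<bullet> w (r p))
    = (\<Sum>p\<le>n. \<beta> p) \<bullet> w (r 0) + (\<Sum>k<n. (\<Sum>p\<in>{k<..n}. \<beta> p) \<bullet> (w (r (Suc k)) - w (r k)))"
proof (induction n)
  case (Suc n)
  have "(\<Sum>p\<in>{k<..Suc n}. \<beta> p) = (\<Sum>p\<in>{k<..n}. \<beta> p) + \<beta> (Suc n)" if "k \<le> n" for k
    using that by (simp add: greaterThanAtMost_def atMost_Suc Int_insert_right add.commute)
  then have "(\<Sum>k<Suc n. (\<Sum>p\<in>{k<..Suc n}. \<beta> p) \<bullet> (w (r (Suc k)) - w (r k)))
      = (\<Sum>k<n. (\<Sum>p\<in>{k<..n}. \<beta> p) \<bullet> (w (r (Suc k)) - w (r k)))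
        + \<beta> (Suc n) \<bullet> (\<Sum>k<Suc n. w (r (Suc k)) - w (r k))"
    by (simp add: inner_sum_right inner_add_left inner_add_right sum.distrib)
  also have "(\<Sum>k<Suc n. w (r (Suc k)) - w (r k)) = w (r (Suc n)) - w (r 0)"
    by (rule sum_lessThan_telescope)
  finally show ?case
    using Suc by (simp add: inner_add_left inner_diff_right)
qed simp

text \<open>
  Finite-dimensional distributions of Brownian motion are Gaussian. The times may come in any order
  and may repeat: they are collected in the set \<open>A\<close>, enumerated increasingly, and summation by parts
  reduces the claim to independent increments. Adding the time 0 to \<open>A\<close> supplies the starting point.
\<close>

lemma brownian_linear_combination_normal:
  fixes W :: "'w \<Rightarrow> real \<Rightarrow> real^'m"
  assumes M: "prob_space M" and W: "std_brownian_motion T M W"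
    and K: "finite K" "\<And>k. k \<in> K \<Longrightarrow> \<tau> k \<in> {0..T}" and T: "0 \<le> T"
  shows "\<exists>v. centered_normal M (\<lambda>\<omega>. \<Sum>k\<in>K. \<alpha> k \<bullet> W \<omega> (\<tau> k)) v"
proof -
  interpret prob_space M by fact
  have W0: "AE \<omega> in M. W \<omega> 0 = 0" and cW: "continuous_process T M W"
    using W by (auto simp: std_brownian_motion_def)
  define A where "A = insert 0 (\<tau> ` K)"
  have A: "finite A" "A \<subseteq> {0..T}" "0 \<in> A" using K T by (auto simp: A_def)
  define N where "N = card A - 1"
  have cA: "card A = Suc N" 
  proof -
    have "card A \<noteq> 0" using A by auto
    then show ?thesis by (simp add: N_def)
  qed
  define h where "h p = sorted_list_of_set A ! p" for p
  have h: "bij_betw h {..<card A} A"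
    unfolding h_def using A(1) by (intro bij_betw_nth) auto
  have le: "{..<card A} = {..N}" using cA by auto
  have hA: "h p \<in> A" if "p \<le> N" for p
    using bij_betwE[OF h] that le by simp
  have mono: "h k \<le> h (Suc k)" if "k < N" for k
    unfolding h_def using that cA by (intro sorted_nth_mono) auto
  have h0: "h 0 = 0"
  proof -
    obtain p where p: "p \<le> N" "h p = 0" 
      using bij_betw_imp_surj_on[OF h] A(3) le by (metis atMost_iff imageE)
    have "h 0 \<le> h p" using monotone_grid_bounds(1)[of N h p] mono p by auto
    moreover have "0 \<le> h 0" using hA[of 0] A by auto
    ultimately show ?thesis using p by simp
  qed
  define \<beta> where "\<beta> t = (\<Sum>k\<in>{k\<in>K. \<tau> k = t}. \<alpha> k)" for t
  have eq: "(\<Sum>k\<in>K. \<alpha> k \<bullet> w (\<tau> k)) = (\<Sum>k<N. (\<Sum>p\<in>{k<..N}. \<beta> (h p)) \<bullet> (w (h (Suc k)) - w (h k)))"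
    if "w 0 = 0" for w :: "real \<Rightarrow> real^'m"
  proof -
    have "(\<Sum>k\<in>K. \<alpha> k \<bullet> w (\<tau> k)) = (\<Sum>t\<in>A. \<Sum>k\<in>{k\<in>K. \<tau> k = t}. \<alpha> k \<bullet> w (\<tau> k))"
      using A K by (intro sum.group[symmetric]) (auto simp: A_def)
    also have "\<dots> = (\<Sum>t\<in>A. \<beta> t \<bullet> w t)"
      unfolding \<beta>_def by (intro sum.cong) (auto simp: inner_sum_left)
    also have "\<dots> = (\<Sum>p\<le>N. \<beta> (h p) \<bullet> w (h p))"
      using sum.reindex_bij_betw[OF h, of "\<lambda>t. \<beta> t \<bullet> w t"] le by simp
    finally show ?thesis
      using that by (simp add: summation_by_parts_increments[of "\<lambda>p. \<beta> (h p)"] h0)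
  qed
  have "centered_normal M (\<lambda>\<omega>. \<Sum>k<N. (\<Sum>p\<in>{k<..N}. \<beta> (h p)) \<bullet> (W \<omega> (h (Suc k)) - W \<omega> (h k)))
      (\<Sum>k<N. (norm (\<Sum>p\<in>{k<..N}. \<beta> (h p)))\<^sup>2 * (h (Suc k) - h k))"
    using hA[of N] A by (intro brownian_increments_sum_normal[OF M W]) (auto simp: h0 mono)
  moreover have "AE \<omega> in M. (\<Sum>k<N. (\<Sum>p\<in>{k<..N}. \<beta> (h p)) \<bullet> (W \<omega> (h (Suc k)) - W \<omega> (h k)))
      = (\<Sum>k\<in>K. \<alpha> k \<bullet> W \<omega> (\<tau> k))"
    using W0 by eventually_elim (simp add: eq)
  moreover have "(\<lambda>\<omega>. \<Sum>k\<in>K. \<alpha> k \<bullet> W \<omega> (\<tau> k)) \<in> borel_measurable M"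
    using continuous_process_measurable[OF cW] K(2)
    by (intro borel_measurable_sum borel_measurable_inner borel_measurable_const) blast
  ultimately show ?thesis by (blast intro: centered_normal_cong_AE)
qed

section \<open>Step integrands and the isometry\<close>

text \<open>
  The values are extended nonnegative reals, so no integrability has to be known beforehand.
\<close>

definition mean_square :: "'w measure \<Rightarrow> ('w \<Rightarrow> real) \<Rightarrow> ennreal" where
  "mean_square M f = (\<integral>\<^sup>+\<omega>. ennreal ((f \<omega>)\<^sup>2) \<partial>M)"

lemma mean_square_add_le:
  assumes [measurable]: "f \<in> borel_measurable M" "g \<in> borel_measurable M"
  shows "mean_square M (\<lambda>\<omega>. f \<omega> + g \<omega>) \<le> 2 * mean_square M f + 2 * mean_square M g"
proof -
  have "ennreal ((f \<omega> + g \<omega>)\<^sup>2) \<le> 2 * ennreal ((f \<omega>)\<^sup>2) + 2 * ennreal ((g \<omega>)\<^sup>2)" for \<omega>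
  proof -
    have "(f \<omega> + g \<omega>)\<^sup>2 \<le> 2 * (f \<omega>)\<^sup>2 + 2 * (g \<omega>)\<^sup>2"
      using zero_le_power2[of "f \<omega> - g \<omega>"] by (simp add: power2_sum power2_diff)
    then have "ennreal ((f \<omega> + g \<omega>)\<^sup>2) \<le> ennreal (2 * (f \<omega>)\<^sup>2 + 2 * (g \<omega>)\<^sup>2)"
      by (rule ennreal_leI)
    then show ?thesis by (simp add: ennreal_plus ennreal_mult)
  qed
  then have "mean_square M (\<lambda>\<omega>. f \<omega> + g \<omega>)
      \<le> (\<integral>\<^sup>+\<omega>. 2 * ennreal ((f \<omega>)\<^sup>2) + 2 * ennreal ((g \<omega>)\<^sup>2) \<partial>M)"
    unfolding mean_square_def by (intro nn_integral_mono)
  then show ?thesis by (simp add: mean_square_def nn_integral_add nn_integral_cmult)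
qed

lemma mean_square_cmult:
  assumes [measurable]: "f \<in> borel_measurable M"
  shows "mean_square M (\<lambda>\<omega>. a * f \<omega>) = ennreal (a\<^sup>2) * mean_square M f"
  by (simp add: mean_square_def power_mult_distrib ennreal_mult nn_integral_cmult)

lemma ennreal_tendsto_0_le:
  fixes f g :: "'i \<Rightarrow> ennreal"
  assumes "\<And>q. f q \<le> g q" "(g \<longlongrightarrow> 0) F"
  shows "(f \<longlongrightarrow> 0) F"
  using assms by (intro tendsto_sandwich[OF _ _ tendsto_const assms(2)]) auto

lemma mean_square_tendsto_sum:
  assumes "finite K"
    and "\<And>k q. k \<in> K \<Longrightarrow> F q k \<in> borel_measurable M"
    and "\<And>k. k \<in> K \<Longrightarrow> G k \<in> borel_measurable M"
    and "\<And>k. k \<in> K \<Longrightarrow> (\<lambda>q. mean_square M (\<lambda>\<omega>. F q k \<omega> - G k \<omega>)) \<longlonglongrightarrow> 0"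
  shows "(\<lambda>q. mean_square M (\<lambda>\<omega>. (\<Sum>k\<in>K. a k * F q k \<omega>) - (\<Sum>k\<in>K. a k * G k \<omega>))) \<longlonglongrightarrow> 0"
  using assms
proof (induction K)
  case empty
  then show ?case by (simp add: mean_square_def)
next
  case (insert k K)
  have [measurable]: "\<And>i q. i \<in> K \<Longrightarrow> F q i \<in> borel_measurable M" "\<And>q. F q k \<in> borel_measurable M"
    "\<And>i. i \<in> K \<Longrightarrow> G i \<in> borel_measurable M" "G k \<in> borel_measurable M"
    using insert.prems by auto
  let ?D = "\<lambda>q \<omega>. (\<Sum>k\<in>K. a k * F q k \<omega>) - (\<Sum>k\<in>K. a k * G k \<omega>)"
  have IH: "(\<lambda>q. mean_square M (?D q)) \<longlonglongrightarrow> 0"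
    using insert.prems by (intro insert.IH) auto
  have k: "(\<lambda>q. mean_square M (\<lambda>\<omega>. F q k \<omega> - G k \<omega>)) \<longlonglongrightarrow> 0"
    using insert.prems by auto
  have eq: "(\<Sum>k\<in>insert k K. a k * F q k \<omega>) - (\<Sum>k\<in>insert k K. a k * G k \<omega>)
      = a k * (F q k \<omega> - G k \<omega>) + ?D q \<omega>" for q \<omega>
    using insert.hyps by (simp add: algebra_simps)
  have "(\<lambda>q. 2 * (ennreal ((a k)\<^sup>2) * mean_square M (\<lambda>\<omega>. F q k \<omega> - G k \<omega>)) + 2 * mean_square M (?D q))
      \<longlonglongrightarrow> 2 * (ennreal ((a k)\<^sup>2) * 0) + 2 * 0"
    by (intro tendsto_add ennreal_tendsto_cmult IH k) auto
  then show ?case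
  proof (rule ennreal_tendsto_0_le[rotated, OF tendsto_eq_rhs])
      fix q
      have "mean_square M (\<lambda>\<omega>. a k * (F q k \<omega> - G k \<omega>) + ?D q \<omega>)
        \<le> 2 * mean_square M (\<lambda>\<omega>. a k * (F q k \<omega> - G k \<omega>)) + 2 * mean_square M (?D q)"
        by (rule mean_square_add_le) measurable
      then show "mean_square M (\<lambda>\<omega>. (\<Sum>k\<in>insert k K. a k * F q k \<omega>)
        - (\<Sum>k\<in>insert k K. a k * G k \<omega>))
      \<le> 2 * (ennreal ((a k)\<^sup>2) * mean_square M (\<lambda>\<omega>. F q k \<omega> - G k \<omega>)) + 2 * mean_square M (?D q)"
        unfolding eq by (simp add: mean_square_cmult)
  qed simp
qed

lemma centered_normal_mean_square:
  assumes "centered_normal M f v"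
  shows "mean_square M f = ennreal v"
  unfolding mean_square_def
  using centered_normal_moments(1)[OF assms, of 2] centered_normal_moments(3)[OF assms]
  by (subst nn_integral_eq_integral) auto

definition vector_step :: "nat \<Rightarrow> (nat \<Rightarrow> real) \<Rightarrow> (nat \<Rightarrow> 'a::real_inner) \<Rightarrow> real \<Rightarrow> 'a" where
  "vector_step n r c s = (\<Sum>k<n. indicator {r k<..r (Suc k)} s *\<^sub>R c k)"

text \<open>
  One row of \<^const>\<open>step_integral\<close>, so that integrands are vectors and integrals are real.
\<close>

definition vector_step_integral ::
    "nat \<Rightarrow> (nat \<Rightarrow> real) \<Rightarrow> (nat \<Rightarrow> 'a::real_inner) \<Rightarrow> (real \<Rightarrow> 'a) \<Rightarrow> real \<Rightarrow> real" where
  "vector_step_integral n r c w t = (\<Sum>k<n. c k \<bullet> (w (min (r (Suc k)) t) - w (min (r k) t)))"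

text \<open>
  One component of \<^const>\<open>has_stochastic_integral\<close>. The integrand \<open>g\<close> lives on the whole line; for a row
  of \<open>\<sigma>\<close> it is the extension by zero, which makes integrals over the line and over the interval from
  0 to T agree.
\<close>

definition wiener_integral ::
    "real \<Rightarrow> 'w measure \<Rightarrow> (real \<Rightarrow> real^'m) \<Rightarrow> ('w \<Rightarrow> real \<Rightarrow> real^'m) \<Rightarrow> ('w \<Rightarrow> real \<Rightarrow> real) \<Rightarrow> bool"
  where
  "wiener_integral T M g W J \<longleftrightarrow>
     g \<in> borel_measurable borel \<and>
     (\<forall>t\<in>{0..T}. (\<lambda>\<omega>. J \<omega> t) \<in> borel_measurable M) \<and>
     (\<exists>n r c.
        (\<forall>m::nat. partition_of T (n m) (r m)) \<and>
        (\<lambda>m. \<integral>\<^sup>+s. ennreal ((norm (vector_step (n m) (r m) (c m) s - g s))\<^sup>2) \<partial>lborel) \<longlonglongrightarrow> 0 \<and>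
        (\<forall>t\<in>{0..T}. (\<lambda>m. mean_square M
           (\<lambda>\<omega>. vector_step_integral (n m) (r m) (c m) (W \<omega>) t - J \<omega> t)) \<longlonglongrightarrow> 0))"

lemma vector_step_measurable [measurable]:
  "vector_step n r (c :: nat \<Rightarrow> 'a::euclidean_space) \<in> borel_measurable borel"
  unfolding vector_step_def by measurable

lemma vector_step_eq:
  assumes r: "\<And>k. k < n \<Longrightarrow> r k \<le> r (Suc k)" and k: "k < n" and s: "s \<in> {r k<..r (Suc k)}"
  shows "vector_step n r c s = c k"
proof -
  have "indicator {r l<..r (Suc l)} s *\<^sub>R c l = (if l = k then c k else 0)" if "l < n" for l
  proof (cases l k rule: linorder_cases)
    case less
    then have "r (Suc l) \<le> r k" using monotone_grid_mono[of n r "Suc l" k] r k by auto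
    then show ?thesis using less s by auto
  next
    case greater
    then have "r (Suc k) \<le> r l" using monotone_grid_mono[of n r "Suc k" l] r that by auto
    then show ?thesis using greater s by auto
  qed (use s in auto)
  then have "vector_step n r c s = (\<Sum>l<n. if l = k then c k else 0)"
    unfolding vector_step_def by (intro sum.cong) auto
  then show ?thesis using k by simp
qed

lemma sum_indicator_grid:
  fixes r :: "nat \<Rightarrow> real"
  assumes "\<And>k. k < n \<Longrightarrow> r k \<le> r (Suc k)"
  shows "(\<Sum>k<n. indicator {r k<..r (Suc k)} s) = (indicator {r 0<..r n} s :: 'b::semiring_1)"
  using assms
proof (induction n)
  case (Suc n)
  have "r 0 \<le> r n" "r n \<le> r (Suc n)"
    using monotone_grid_mono[of "Suc n" r 0 n] Suc.prems by auto
  moreover have "(\<Sum>k<n. indicator {r k<..r (Suc k)} s) = (indicator {r 0<..r n} s :: 'b::semiring_1)"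
    using Suc.prems by (intro Suc.IH) auto
  ultimately show ?case
    unfolding sum.lessThan_Suc by (simp only:) (auto split: split_indicator)
qed simp

lemma nn_integral_grid:
  fixes r :: "nat \<Rightarrow> real"
  assumes "\<And>k. k < n \<Longrightarrow> r k \<le> r (Suc k)" and [measurable]: "f \<in> borel_measurable borel"
  shows "(\<Sum>k<n. \<integral>\<^sup>+s\<in>{r k<..r (Suc k)}. f s \<partial>lborel) = (\<integral>\<^sup>+s\<in>{r 0<..r n}. f s \<partial>lborel)"
proof -
  have "(\<Sum>k<n. \<integral>\<^sup>+s\<in>{r k<..r (Suc k)}. f s \<partial>lborel)
      = (\<integral>\<^sup>+s. (\<Sum>k<n. f s * indicator {r k<..r (Suc k)} s) \<partial>lborel)"
    by (subst nn_integral_sum) auto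
  also have "\<dots> = (\<integral>\<^sup>+s\<in>{r 0<..r n}. f s \<partial>lborel)"
    by (simp add: sum_indicator_grid[of n r, OF assms(1)] flip: sum_distrib_left)
  finally show ?thesis .
qed

text \<open>
  Clamping the points of a partition to the interval from \<open>a\<close> to \<open>b\<close> yields a partition of that interval
  whose cells lie inside the original ones. The increment of a step integral from \<open>a\<close> to \<open>b\<close> is a sum
  over these cells.
\<close>

lemma clamp_grid:
  assumes p: "partition_of T n r" and ab: "0 \<le> a" "a \<le> b" "b \<le> T"
  defines "\<rho> \<equiv> \<lambda>k. max a (min b (r k))"
  shows "\<rho> 0 = a" "\<rho> n = b" "\<And>k. k < n \<Longrightarrow> \<rho> k \<le> \<rho> (Suc k)"
    and "\<And>k. {\<rho> k<..\<rho> (Suc k)} \<subseteq> {r k<..r (Suc k)} \<inter> {a<..b}"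
  using p ab by (auto simp: partition_of_def \<rho>_def max_def min_def)

lemma step_increment_eq:
  assumes p: "partition_of T n r" and ab: "0 \<le> a" "a \<le> b" "b \<le> T"
  defines "\<rho> \<equiv> \<lambda>k. max a (min b (r k))"
  shows "vector_step_integral n r c w b - vector_step_integral n r c w a - C \<bullet> (w b - w a)
    = (\<Sum>k<n. (c k - C) \<bullet> (w (\<rho> (Suc k)) - w (\<rho> k)))"
proof -
  have min: "w (min x b) = w (min x a) + (w (max a (min b x)) - w a)" for x
    using ab by (auto simp: min_def max_def)
  have "w (min (r (Suc k)) b) - w (min (r k) b) - (w (min (r (Suc k)) a) - w (min (r k) a))
      = w (\<rho> (Suc k)) - w (\<rho> k)" for k
    unfolding min[of "r (Suc k)"] min[of "r k"] \<rho>_def by simp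
  then have 1: "vector_step_integral n r c w b - vector_step_integral n r c w a
      = (\<Sum>k<n. c k \<bullet> (w (\<rho> (Suc k)) - w (\<rho> k)))"
    unfolding vector_step_integral_def sum_subtractf[symmetric] inner_diff_right[symmetric]
    by simp
  have "(\<Sum>k<n. w (\<rho> (Suc k)) - w (\<rho> k)) = w b - w a"
    using clamp_grid(1,2)[OF p ab] unfolding \<rho>_def by (subst sum_lessThan_telescope) simp
  then have "C \<bullet> (w b - w a) = (\<Sum>k<n. C \<bullet> (w (\<rho> (Suc k)) - w (\<rho> k)))"
    by (simp flip: inner_sum_right)
  with 1 show ?thesis by (simp add: inner_diff_left sum_subtractf)
qed

text \<open>
  The difference between an increment of a step integral and the increment of the integral of a
  constant \<open>C\<close> is again a combination of independent Brownian increments, with weights \<open>c k - C\<close>.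
\<close>

lemma step_isometry:
  fixes W :: "'w \<Rightarrow> real \<Rightarrow> real^'m"
  assumes M: "prob_space M" and W: "std_brownian_motion T M W"
    and p: "partition_of T n r" and ab: "0 \<le> a" "a \<le> b" "b \<le> T"
  shows "mean_square M (\<lambda>\<omega>. vector_step_integral n r c (W \<omega>) b
      - vector_step_integral n r c (W \<omega>) a - C \<bullet> (W \<omega> b - W \<omega> a))
    = (\<integral>\<^sup>+s\<in>{a<..b}. ennreal ((norm (vector_step n r c s - C))\<^sup>2) \<partial>lborel)" (is ?isom)
    and "(\<integral>\<^sup>+s\<in>{a<..b}. ennreal ((norm (vector_step n r c s - C))\<^sup>2) \<partial>lborel) < \<infinity>"
proof -
  let ?L = "\<integral>\<^sup>+s\<in>{a<..b}. ennreal ((norm (vector_step n r c s - C))\<^sup>2) \<partial>lborel"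
  define \<rho> where "\<rho> k = max a (min b (r k))" for k
  note \<rho> = clamp_grid[OF p ab, folded \<rho>_def]
  have mono: "\<And>k. k < n \<Longrightarrow> r k \<le> r (Suc k)" using p by (auto simp: partition_of_def)
  have "(?L)
      = (\<Sum>k<n. \<integral>\<^sup>+s\<in>{\<rho> k<..\<rho> (Suc k)}. ennreal ((norm (vector_step n r c s - C))\<^sup>2) \<partial>lborel)"
    using nn_integral_grid[of n \<rho> "\<lambda>s. ennreal ((norm (vector_step n r c s - C))\<^sup>2)", OF \<rho>(3)] \<rho>(1,2)
    by simp
  also have "\<dots> = (\<Sum>k<n. \<integral>\<^sup>+s. ennreal ((norm (c k - C))\<^sup>2) * indicator {\<rho> k<..\<rho> (Suc k)} s \<partial>lborel)"
  proof (intro sum.cong refl nn_integral_cong)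
    fix k s assume k: "k \<in> {..<n}"
    show "ennreal ((norm (vector_step n r c s - C))\<^sup>2) * indicator {\<rho> k<..\<rho> (Suc k)} s
      = ennreal ((norm (c k - C))\<^sup>2) * indicator {\<rho> k<..\<rho> (Suc k)} s"
      using vector_step_eq[of n r k s c] mono k \<rho>(4)[of k] by (auto simp: indicator_def)
  qed
  also have "\<dots> = (\<Sum>k<n. ennreal ((norm (c k - C))\<^sup>2) * ennreal (\<rho> (Suc k) - \<rho> k))"
    using \<rho>(3) by (intro sum.cong refl) (simp add: nn_integral_cmult_indicator)
  also have "\<dots> = ennreal (\<Sum>k<n. (norm (c k - C))\<^sup>2 * (\<rho> (Suc k) - \<rho> k))"
    using \<rho>(3) by (subst sum_ennreal[symmetric]) (auto simp: ennreal_mult)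
  finally have eq: "(?L)
      = ennreal (\<Sum>k<n. (norm (c k - C))\<^sup>2 * (\<rho> (Suc k) - \<rho> k))" .
  then show "(?L) < \<infinity>"
    by simp
  have "centered_normal M (\<lambda>\<omega>. \<Sum>k<n. (c k - C) \<bullet> (W \<omega> (\<rho> (Suc k)) - W \<omega> (\<rho> k)))
      (\<Sum>k<n. (norm (c k - C))\<^sup>2 * (\<rho> (Suc k) - \<rho> k))"
    using \<rho> ab by (intro brownian_increments_sum_normal[OF M W]) auto
  then show ?isom
    unfolding eq step_increment_eq[OF p ab] \<rho>_def[symmetric]
    by (rule centered_normal_mean_square)
qed

section \<open>Wiener integrals with deterministic integrands\<close>

lemma nn_integral_norm_diff_le:
  fixes f g :: "'a \<Rightarrow> 'b::euclidean_space"
  assumes [measurable]: "f \<in> borel_measurable N" "g \<in> borel_measurable N" "A \<in> sets N"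
  shows "(\<integral>\<^sup>+s\<in>A. ennreal ((norm (f s - C))\<^sup>2) \<partial>N)
    \<le> 2 * (\<integral>\<^sup>+s\<in>A. ennreal ((norm (g s - C))\<^sup>2) \<partial>N) + 2 * (\<integral>\<^sup>+s. ennreal ((norm (f s - g s))\<^sup>2) \<partial>N)"
proof -
  have le: "ennreal ((norm (f s - C))\<^sup>2)
      \<le> 2 * ennreal ((norm (g s - C))\<^sup>2) + 2 * ennreal ((norm (f s - g s))\<^sup>2)" for s
  proof -
    have "norm (f s - C) \<le> norm (g s - C) + norm (f s - g s)"
      using norm_triangle_ineq[of "g s - C" "f s - g s"] by simp
    then have "(norm (f s - C))\<^sup>2 \<le> (norm (g s - C) + norm (f s - g s))\<^sup>2"
      by (intro power_mono) auto
    also have "\<dots> \<le> 2 * (norm (g s - C))\<^sup>2 + 2 * (norm (f s - g s))\<^sup>2"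
      using zero_le_power2[of "norm (g s - C) - norm (f s - g s)"]
      by (simp add: power2_sum power2_diff)
    finally have "ennreal ((norm (f s - C))\<^sup>2)
        \<le> ennreal (2 * (norm (g s - C))\<^sup>2 + 2 * (norm (f s - g s))\<^sup>2)" by (rule ennreal_leI)
    then show ?thesis by (simp add: ennreal_plus ennreal_mult)
  qed
  have "(\<integral>\<^sup>+s\<in>A. ennreal ((norm (f s - C))\<^sup>2) \<partial>N)
      \<le> (\<integral>\<^sup>+s. 2 * (ennreal ((norm (g s - C))\<^sup>2) * indicator A s)
          + 2 * ennreal ((norm (f s - g s))\<^sup>2) \<partial>N)"
    using le by (intro nn_integral_mono) (auto split: split_indicator)
  also have "\<dots> = 2 * (\<integral>\<^sup>+s\<in>A. ennreal ((norm (g s - C))\<^sup>2) \<partial>N)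
      + 2 * (\<integral>\<^sup>+s. ennreal ((norm (f s - g s))\<^sup>2) \<partial>N)"
    by (simp add: nn_integral_add nn_integral_cmult)
  finally show ?thesis .
qed

lemma brownian_motion_measurable:
  assumes "std_brownian_motion T M W" "t \<in> {0..T}"
  shows "(\<lambda>\<omega>. W \<omega> t) \<in> borel_measurable M"
  using assms continuous_process_measurable[of W M T t] by (auto simp: std_brownian_motion_def)

lemma vector_step_integral_measurable:
  fixes W :: "'w \<Rightarrow> real \<Rightarrow> real^'m"
  assumes W: "std_brownian_motion T M W" and p: "partition_of T n r" and t: "t \<in> {0..T}"
  shows "(\<lambda>\<omega>. vector_step_integral n r c (W \<omega>) t) \<in> borel_measurable M"
proof -
  have "min (r k) t \<in> {0..T}" if "k \<le> n" for k
    using monotone_grid_bounds[of n r k] p that t by (auto simp: partition_of_def)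
  then have "(\<lambda>\<omega>. W \<omega> (min (r k) t)) \<in> borel_measurable M" if "k \<le> n" for k
    using brownian_motion_measurable[OF W] that by blast
  then show ?thesis
    unfolding vector_step_integral_def
    by (intro borel_measurable_sum borel_measurable_inner borel_measurable_diff borel_measurable_const) auto
qed

lemma wiener_integral_measurable:
  "wiener_integral T M g W J \<Longrightarrow> t \<in> {0..T} \<Longrightarrow> (\<lambda>\<omega>. J \<omega> t) \<in> borel_measurable M"
  by (simp add: wiener_integral_def)

text \<open>
  On an interval where \<open>g\<close> is close to the constant \<open>C\<close>, the integral behaves like \<open>C\<close> times the Brownian
  increment. The statement holds for step integrands with factor 1; passing to the limit twice by
  \<open>(x + y)\<^sup>2 \<le> 2 x\<^sup>2 + 2 y\<^sup>2\<close> costs the factor 4, which is harmless below.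
\<close>

lemma wiener_integral_increment_le:
  fixes W :: "'w \<Rightarrow> real \<Rightarrow> real^'m"
  assumes M: "prob_space M" and W: "std_brownian_motion T M W"
    and J: "wiener_integral T M g W J" and ab: "0 \<le> a" "a \<le> b" "b \<le> T"
  shows "mean_square M (\<lambda>\<omega>. J \<omega> b - J \<omega> a - C \<bullet> (W \<omega> b - W \<omega> a))
    \<le> 4 * (\<integral>\<^sup>+s\<in>{a<..b}. ennreal ((norm (g s - C))\<^sup>2) \<partial>lborel)"
proof -
  obtain n r c where p: "\<And>m. partition_of T (n m) (r m)"
    and g: "(\<lambda>m. \<integral>\<^sup>+s. ennreal ((norm (vector_step (n m) (r m) (c m) s - g s))\<^sup>2) \<partial>lborel) \<longlonglongrightarrow> 0"
    and conv: "\<And>t. t \<in> {0..T} \<Longrightarrow> (\<lambda>m. mean_square M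
         (\<lambda>\<omega>. vector_step_integral (n m) (r m) (c m) (W \<omega>) t - J \<omega> t)) \<longlonglongrightarrow> 0"
    using J unfolding wiener_integral_def by blast
  have [measurable]: "g \<in> borel_measurable borel" using J by (auto simp: wiener_integral_def)
  have t: "a \<in> {0..T}" "b \<in> {0..T}" using ab by auto
  have [measurable]: "(\<lambda>\<omega>. J \<omega> a) \<in> borel_measurable M" "(\<lambda>\<omega>. J \<omega> b) \<in> borel_measurable M"
    using J t by (auto simp: wiener_integral_def)
  note [measurable] = brownian_motion_measurable[OF W t(1)] brownian_motion_measurable[OF W t(2)]
  define S where "S m t \<omega> = vector_step_integral (n m) (r m) (c m) (W \<omega>) t" for m t \<omega>
  have [measurable]: "S m a \<in> borel_measurable M" "S m b \<in> borel_measurable M" for m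
    unfolding S_def using vector_step_integral_measurable[OF W p] t by auto
  let ?G = "\<integral>\<^sup>+s\<in>{a<..b}. ennreal ((norm (g s - C))\<^sup>2) \<partial>lborel"
  let ?e = "\<lambda>m. \<integral>\<^sup>+s. ennreal ((norm (vector_step (n m) (r m) (c m) s - g s))\<^sup>2) \<partial>lborel"
  let ?d = "\<lambda>t m. mean_square M (\<lambda>\<omega>. S m t \<omega> - J \<omega> t)"
  have d: "?d t \<longlonglongrightarrow> 0" if "t \<in> {0..T}" for t using conv[OF that] by (simp add: S_def)
  have neg: "mean_square M (\<lambda>\<omega>. f \<omega> - h \<omega>) = mean_square M (\<lambda>\<omega>. h \<omega> - f \<omega>)" for f h
    by (simp add: mean_square_def power2_commute)
  have "mean_square M (\<lambda>\<omega>. J \<omega> b - J \<omega> a - C \<bullet> (W \<omega> b - W \<omega> a))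
      \<le> 4 * ?G + 4 * ?e m + (4 * ?d b m + 4 * ?d a m)" for m
  proof -
    have "mean_square M (\<lambda>\<omega>. (S m b \<omega> - S m a \<omega> - C \<bullet> (W \<omega> b - W \<omega> a))
        + ((J \<omega> b - S m b \<omega>) + (S m a \<omega> - J \<omega> a)))
      \<le> 2 * mean_square M (\<lambda>\<omega>. S m b \<omega> - S m a \<omega> - C \<bullet> (W \<omega> b - W \<omega> a))
        + 2 * mean_square M (\<lambda>\<omega>. (J \<omega> b - S m b \<omega>) + (S m a \<omega> - J \<omega> a))"
      by (rule mean_square_add_le) measurable
    also have "\<dots> \<le> 2 * (2 * ?G + 2 * ?e m)
        + 2 * (2 * mean_square M (\<lambda>\<omega>. J \<omega> b - S m b \<omega>) + 2 * mean_square M (\<lambda>\<omega>. S m a \<omega> - J \<omega> a))"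
    proof (intro add_mono mult_left_mono mean_square_add_le)
      show "mean_square M (\<lambda>\<omega>. S m b \<omega> - S m a \<omega> - C \<bullet> (W \<omega> b - W \<omega> a)) \<le> 2 * ?G + 2 * ?e m"
        unfolding S_def step_isometry(1)[OF M W p ab] by (rule nn_integral_norm_diff_le) measurable
    qed auto
    also have "\<dots> = 4 * ?G + 4 * ?e m + (4 * ?d b m + 4 * ?d a m)"
      by (simp add: neg[of "\<lambda>\<omega>. J \<omega> b"] distrib_left flip: mult.assoc)
    finally show ?thesis by (simp add: algebra_simps)
  qed
  moreover have "(\<lambda>m. 4 * ?G + 4 * ?e m + (4 * ?d b m + 4 * ?d a m))
      \<longlonglongrightarrow> 4 * ?G + 4 * 0 + (4 * 0 + 4 * 0)"
    by (intro tendsto_add tendsto_const ennreal_tendsto_cmult g d t) auto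
  ultimately show ?thesis
    by (intro LIMSEQ_le_const[where X = "\<lambda>m. 4 * ?G + 4 * ?e m + (4 * ?d b m + 4 * ?d a m)"]) auto
qed

lemma wiener_integrand_square_integrable:
  assumes M: "prob_space M" and W: "std_brownian_motion T M W"
    and J: "wiener_integral T M g W J" and T: "0 \<le> T"
  shows "(\<integral>\<^sup>+s\<in>{0<..T}. ennreal ((norm (g s))\<^sup>2) \<partial>lborel) < \<infinity>"
proof -
  obtain n r c where p: "\<And>m. partition_of T (n m) (r m)"
    and g: "(\<lambda>m. \<integral>\<^sup>+s. ennreal ((norm (vector_step (n m) (r m) (c m) s - g s))\<^sup>2) \<partial>lborel) \<longlonglongrightarrow> 0"
    using J by (auto simp: wiener_integral_def)
  let ?e = "\<lambda>m. \<integral>\<^sup>+s. ennreal ((norm (vector_step (n m) (r m) (c m) s - g s))\<^sup>2) \<partial>lborel"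
  have [measurable]: "g \<in> borel_measurable borel" using J by (auto simp: wiener_integral_def)
  have "eventually (\<lambda>m. (?e m) < 1)
      sequentially"
    using order_tendstoD(2)[OF g, of 1] by simp
  then obtain m where m: "(?e m) < 1"
    by (auto simp: eventually_sequentially)
  have "(\<integral>\<^sup>+s\<in>{0<..T}. ennreal ((norm (g s - 0))\<^sup>2) \<partial>lborel)
      \<le> 2 * (\<integral>\<^sup>+s\<in>{0<..T}. ennreal ((norm (vector_step (n m) (r m) (c m) s - 0))\<^sup>2) \<partial>lborel)
      + 2 * (\<integral>\<^sup>+s. ennreal ((norm (g s - vector_step (n m) (r m) (c m) s))\<^sup>2) \<partial>lborel)"
    by (rule nn_integral_norm_diff_le) measurable
  also have "\<dots> < \<infinity>"
    using step_isometry(2)[OF M W p order_refl T order_refl, where C = 0] m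
    by (auto simp: ennreal_mult_less_top norm_minus_commute intro: less_trans)
  finally show ?thesis by simp
qed

text \<open>
  The modulus of a component is at most the Frobenius norm, so both limits pass to the rows.
\<close>

lemma stochastic_integral_component:
  fixes W :: "'w \<Rightarrow> real \<Rightarrow> real^'m" and \<sigma> :: "real \<Rightarrow> real^'m^'k"
  assumes I: "has_stochastic_integral T M \<sigma> W I"
    and \<sigma>: "\<sigma> \<in> borel_measurable (restrict_space borel {0..T})"
  shows "wiener_integral T M (\<lambda>s. indicator {0..T} s *\<^sub>R (\<sigma> s $ i)) W (\<lambda>\<omega> t. I \<omega> t $ i)"
proof -
  obtain n r c where p: "\<And>m::nat. partition_of T (n m) (r m)"
    and s: "(\<lambda>m. \<integral>\<^sup>+s\<in>{0..T}. ennreal ((norm (step_fun (n m) (r m) (c m) s - \<sigma> s))\<^sup>2) \<partial>lborel) \<longlonglongrightarrow> 0"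
    and i: "\<And>t. t \<in> {0..T} \<Longrightarrow>
      (\<lambda>m. \<integral>\<^sup>+\<omega>. ennreal ((norm (step_integral (n m) (r m) (c m) (W \<omega>) t - I \<omega> t))\<^sup>2) \<partial>M) \<longlonglongrightarrow> 0"
    and cI: "continuous_process T M I"
    using I unfolding has_stochastic_integral_def by blast
  have step: "vector_step n r (\<lambda>k. c k $ i) s = step_fun n r c s $ i"
    for n r s and c :: "nat \<Rightarrow> real^'m^'k"
    by (simp add: vector_step_def step_fun_def)
  have int: "vector_step_integral n r (\<lambda>k. c k $ i) w t = step_integral n r c w t $ i"
    for n r w t and c :: "nat \<Rightarrow> real^'m^'k"
    by (simp add: vector_step_integral_def step_integral_def matrix_vector_mul_component)
  have g: "(\<lambda>s. indicator {0..T} s *\<^sub>R (\<sigma> s $ i)) \<in> borel_measurable borel"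
  proof -
    have "(\<lambda>s. \<sigma> s $ i) \<in> borel_measurable (restrict_space borel {0..T})"
      using measurable_compose[OF \<sigma> borel_measurable_continuous_onI[of "\<lambda>A :: real^'m^'k. A $ i"]]
      by (simp add: continuous_on_component)
    then show ?thesis
      by (subst (asm) borel_measurable_restrict_space_iff) auto
  qed
  have J: "(\<lambda>\<omega>. I \<omega> t $ i) \<in> borel_measurable M" if "t \<in> {0..T}" for t
    using borel_measurable_inner[OF continuous_process_measurable[OF cI that]
        borel_measurable_const[of "axis i 1"]]
    by (simp add: inner_axis)
  have zero: "vector_step (n m) (r m) d s = 0" if "s \<notin> {0..T}" for m s and d :: "nat \<Rightarrow> real^'m"
  proof -
    have "s \<notin> {r m k<..r m (Suc k)}" if "k < n m" for k
      using monotone_grid_bounds[of "n m" "r m" k] monotone_grid_bounds[of "n m" "r m" "Suc k"]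
        p[of m] that \<open>s \<notin> {0..T}\<close> by (auto simp: partition_of_def)
    then show ?thesis by (simp add: vector_step_def)
  qed
  have "(\<lambda>m. \<integral>\<^sup>+s. ennreal ((norm (vector_step (n m) (r m) (\<lambda>k. c m k $ i) s
      - indicator {0..T} s *\<^sub>R (\<sigma> s $ i)))\<^sup>2) \<partial>lborel) \<longlonglongrightarrow> 0"
  proof (rule ennreal_tendsto_0_le[OF _ s], rule nn_integral_mono)
    fix m s
    show "ennreal ((norm (vector_step (n m) (r m) (\<lambda>k. c m k $ i) s - indicator {0..T} s *\<^sub>R (\<sigma> s $ i)))\<^sup>2)
        \<le> ennreal ((norm (step_fun (n m) (r m) (c m) s - \<sigma> s))\<^sup>2) * indicator {0..T} s"
    proof (cases "s \<in> {0..T}")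
      case True
      have "norm ((step_fun (n m) (r m) (c m) s - \<sigma> s) $ i) \<le> norm (step_fun (n m) (r m) (c m) s - \<sigma> s)"
        by (rule Finite_Cartesian_Product.norm_nth_le)
      then show ?thesis using True by (auto simp: step intro!: ennreal_leI power_mono)
    qed (simp add: zero)
  qed
  moreover have "(\<lambda>m. mean_square M
      (\<lambda>\<omega>. vector_step_integral (n m) (r m) (\<lambda>k. c m k $ i) (W \<omega>) t - I \<omega> t $ i)) \<longlonglongrightarrow> 0"
    if t: "t \<in> {0..T}" for t
    unfolding mean_square_def
  proof (rule ennreal_tendsto_0_le[OF _ i[OF t]], rule nn_integral_mono)
    fix m \<omega>
    have "norm ((step_integral (n m) (r m) (c m) (W \<omega>) t - I \<omega> t) $ i)
        \<le> norm (step_integral (n m) (r m) (c m) (W \<omega>) t - I \<omega> t)"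
      by (rule Finite_Cartesian_Product.norm_nth_le)
    then show "ennreal ((vector_step_integral (n m) (r m) (\<lambda>k. c m k $ i) (W \<omega>) t - I \<omega> t $ i)\<^sup>2)
        \<le> ennreal ((norm (step_integral (n m) (r m) (c m) (W \<omega>) t - I \<omega> t))\<^sup>2)"
      by (intro ennreal_leI) (metis int abs_le_square_iff abs_norm_cancel real_norm_def vector_minus_component)
  qed
  ultimately show ?thesis
    unfolding wiener_integral_def using p g J
    by (intro conjI ballI exI[of _ n] exI[of _ r] exI[of _ "\<lambda>m k. c m k $ i"]) auto
qed

section \<open>Anticoncentration of Gaussian path functionals\<close>

text \<open>
  Continuous linear functionals of a path that depend on finitely many times. A list of weights and
  times, with repetitions, makes the sum of two functionals a concatenation.
\<close>

definition path_combination :: "real \<Rightarrow> ((real \<Rightarrow> real^'m) \<Rightarrow> real) \<Rightarrow> bool" where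
  "path_combination T F \<longleftrightarrow>
     (\<exists>xs. (\<forall>(a, t)\<in>set xs. t \<in> {0..T}) \<and> F = (\<lambda>w. \<Sum>(a, t)\<leftarrow>xs. a \<bullet> w t))"

lemma path_combination_eval: "t \<in> {0..T} \<Longrightarrow> path_combination T (\<lambda>w. a \<bullet> w t)"
  unfolding path_combination_def by (intro exI[of _ "[(a, t)]"]) auto

lemma path_combination_0: "path_combination T (\<lambda>_. 0)"
  unfolding path_combination_def by (intro exI[of _ "[]"]) auto

lemma path_combination_add:
  assumes "path_combination T F" "path_combination T G"
  shows "path_combination T (\<lambda>w. F w + G w)"
proof -
  obtain xs ys where "\<forall>(a, t)\<in>set xs. t \<in> {0..T}" "F = (\<lambda>w. \<Sum>(a, t)\<leftarrow>xs. a \<bullet> w t)"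
    "\<forall>(a, t)\<in>set ys. t \<in> {0..T}" "G = (\<lambda>w. \<Sum>(a, t)\<leftarrow>ys. a \<bullet> w t)"
    using assms unfolding path_combination_def by blast
  then show ?thesis unfolding path_combination_def by (intro exI[of _ "xs @ ys"]) auto
qed

lemma path_combination_cmult:
  assumes "path_combination T F"
  shows "path_combination T (\<lambda>w. b * F w)"
proof -
  obtain xs where xs: "\<forall>(a, t)\<in>set xs. t \<in> {0..T}" "F = (\<lambda>w. \<Sum>(a, t)\<leftarrow>xs. a \<bullet> w t)"
    using assms unfolding path_combination_def by blast
  have "b * F w = (\<Sum>(a, t)\<leftarrow>map (\<lambda>(a, t). (b *\<^sub>R a, t)) xs. a \<bullet> w t)" for w
    unfolding xs(2) by (induction xs) (auto simp: distrib_left)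
  then show ?thesis
    using xs(1) unfolding path_combination_def
    by (intro exI[of _ "map (\<lambda>(a, t). (b *\<^sub>R a, t)) xs"]) auto
qed

lemma path_combination_sum:
  assumes "\<And>k. k \<in> K \<Longrightarrow> path_combination T (F k)"
  shows "path_combination T (\<lambda>w. \<Sum>k\<in>K. F k w)"
  using assms
  by (induction K rule: infinite_finite_induct) (auto intro: path_combination_0 path_combination_add)

lemma path_combination_step_integral:
  fixes c :: "nat \<Rightarrow> real^'m"
  assumes p: "partition_of T n r" and t: "t \<in> {0..T}"
  shows "path_combination T (\<lambda>w. vector_step_integral n r c w t)"
proof -
  have T: "min (r k) t \<in> {0..T}" if "k \<le> n" for k
    using monotone_grid_bounds[of n r k] p that t by (auto simp: partition_of_def)
  have "path_combination T (\<lambda>w. \<Sum>k<n. c k \<bullet> w (min (r (Suc k)) t) + (- 1) * (c k \<bullet> w (min (r k) t)))"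
    by (intro path_combination_sum path_combination_add path_combination_cmult
        path_combination_eval T) auto
  then show ?thesis by (simp add: vector_step_integral_def inner_diff_right)
qed

lemma path_combination_measurable:
  fixes F :: "(real \<Rightarrow> real^'m) \<Rightarrow> real"
  assumes "path_combination T F"
  shows "F \<in> borel_measurable (path_space T)"
proof -
  obtain xs where xs: "\<forall>(a, t)\<in>set xs. t \<in> {0..T}" "F = (\<lambda>w. \<Sum>(a, t)\<leftarrow>xs. a \<bullet> w t)"
    using assms unfolding path_combination_def by blast
  from xs(1) have "(\<lambda>w. \<Sum>(a, t)\<leftarrow>xs. a \<bullet> w t) \<in> borel_measurable (path_space T)"
  proof (induction xs)
    case (Cons x xs)
    obtain a t where x: "x = (a, t)" by (cases x)
    have "(\<lambda>w :: real \<Rightarrow> real^'m. a \<bullet> w t) \<in> borel_measurable (path_space T)"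
      using Cons.prems by (intro borel_measurable_inner measurable_path_eval) (auto simp: x)
    then show ?case using Cons by (simp add: x)
  qed simp
  then show ?thesis unfolding xs(2) .
qed

lemma brownian_path_combination_normal:
  fixes W :: "'w \<Rightarrow> real \<Rightarrow> real^'m"
  assumes M: "prob_space M" and W: "std_brownian_motion T M W"
    and F: "path_combination T F" and T: "0 \<le> T"
  shows "\<exists>v. centered_normal M (\<lambda>\<omega>. F (W \<omega>)) v"
proof -
  obtain xs where xs: "\<forall>(a, t)\<in>set xs. t \<in> {0..T}" "F = (\<lambda>w. \<Sum>(a, t)\<leftarrow>xs. a \<bullet> w t)"
    using F unfolding path_combination_def by blast
  have "F w = (\<Sum>k<length xs. fst (xs ! k) \<bullet> w (snd (xs ! k)))" for w
    unfolding xs(2) by (simp add: sum_list_sum_nth case_prod_beta atLeast0LessThan)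
  then show ?thesis
    using brownian_linear_combination_normal[OF M W, of "{..<length xs}" "\<lambda>k. snd (xs ! k)"] xs(1) T
    by (auto simp: case_prod_beta)
qed

text \<open>
  Composition can only shrink the generated \<open>\<sigma>\<close>-algebra; independence passes to functions of the two
  elements.
\<close>

lemma sigma_sets_compose_subset:
  assumes U: "U \<in> M \<rightarrow>\<^sub>M N" and f: "f \<in> N \<rightarrow>\<^sub>M L"
  shows "sigma_sets (space M) {(\<lambda>\<omega>. f (U \<omega>)) -` A \<inter> space M | A. A \<in> sets L}
      \<subseteq> sets (vimage_algebra (space M) U N)"
proof -
  have "(\<lambda>\<omega>. f (U \<omega>)) -` A \<inter> space M \<in> sets (vimage_algebra (space M) U N)"
    if A: "A \<in> sets L" for A
  proof -
    have "(\<lambda>\<omega>. f (U \<omega>)) -` A \<inter> space M = U -` (f -` A \<inter> space N) \<inter> space M"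
      using measurable_space[OF U] by auto
    then show ?thesis
      using in_vimage_algebra[OF measurable_sets[OF f A], of U "space M"] by simp
  qed
  then have "{(\<lambda>\<omega>. f (U \<omega>)) -` A \<inter> space M | A. A \<in> sets L}
      \<subseteq> sets (vimage_algebra (space M) U N)" by auto
  then show ?thesis
    using sets.sigma_sets_subset[of _ "vimage_algebra (space M) U N"] by simp
qed

lemma indep_elements_compose:
  assumes M: "prob_space M" and ind: "indep_elements M N U N' V"
    and f: "f \<in> borel_measurable N" and g: "g \<in> borel_measurable N'"
  shows "prob_space.indep_var M borel (\<lambda>\<omega>. f (U \<omega>)) borel (\<lambda>\<omega>. g (V \<omega>))"
proof -
  interpret prob_space M by fact
  have U: "U \<in> M \<rightarrow>\<^sub>M N" and V: "V \<in> M \<rightarrow>\<^sub>M N'"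
    and i: "indep_set (sets (vimage_algebra (space M) U N)) (sets (vimage_algebra (space M) V N'))"
    using ind by (auto simp: indep_elements_def)
  have "indep_set (sigma_sets (space M) {(\<lambda>\<omega>. f (U \<omega>)) -` A \<inter> space M | A. A \<in> sets borel})
      (sigma_sets (space M) {(\<lambda>\<omega>. g (V \<omega>)) -` A \<inter> space M | A. A \<in> sets borel})"
    using i sigma_sets_compose_subset[OF U f] sigma_sets_compose_subset[OF V g] unfolding indep_sets2_eq
    by (meson subset_iff subset_trans)
  then show ?thesis
    unfolding indep_var_eq using measurable_compose[OF U f] measurable_compose[OF V g] by auto
qed

lemma wiener_integral_approximation:
  fixes W :: "'w \<Rightarrow> real \<Rightarrow> real^'m"
  assumes W: "std_brownian_motion T M W" and J: "wiener_integral T M g W J"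
    and K: "finite K" "\<And>k. k \<in> K \<Longrightarrow> \<tau> k \<in> {0..T}"
  obtains F where "\<And>q::nat. path_combination T (F q)"
    "(\<lambda>q. mean_square M (\<lambda>\<omega>. F q (W \<omega>) - (\<Sum>k\<in>K. \<beta> k * J \<omega> (\<tau> k)))) \<longlonglongrightarrow> 0"
proof -
  obtain n r c where p: "\<And>m. partition_of T (n m) (r m)"
    and conv: "\<And>t. t \<in> {0..T} \<Longrightarrow> (\<lambda>m. mean_square M
         (\<lambda>\<omega>. vector_step_integral (n m) (r m) (c m) (W \<omega>) t - J \<omega> t)) \<longlonglongrightarrow> 0"
    and Jm: "\<And>t. t \<in> {0..T} \<Longrightarrow> (\<lambda>\<omega>. J \<omega> t) \<in> borel_measurable M"
    using J unfolding wiener_integral_def by blast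
  let ?F = "\<lambda>q w. \<Sum>k\<in>K. \<beta> k * vector_step_integral (n q) (r q) (c q) w (\<tau> k)"
  show ?thesis
  proof
    show "path_combination T (?F q)" for q
      using K by (intro path_combination_sum path_combination_cmult path_combination_step_integral p)
    show "(\<lambda>q. mean_square M (\<lambda>\<omega>. ?F q (W \<omega>) - (\<Sum>k\<in>K. \<beta> k * J \<omega> (\<tau> k)))) \<longlonglongrightarrow> 0"
      using K vector_step_integral_measurable[OF W p] Jm conv
      by (intro mean_square_tendsto_sum) auto
  qed
qed

text \<open>
  Replacing both integrals by step integrals gives a functional of \<open>B\<close> plus an independent functional
  of \<open>W\<close>, which is centered normal. The anticoncentration bound is uniform in the variance, so it
  survives the mean square limit, for balls of half the radius.
\<close>

lemma gaussian_integral_anticoncentration: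
  fixes B :: "'w \<Rightarrow> real \<Rightarrow> real^'d" and W :: "'w \<Rightarrow> real \<Rightarrow> real^'n"
  assumes M: "prob_space M" and B: "std_brownian_motion T M B" and W: "std_brownian_motion T M W"
    and ind: "indep_elements M (path_space T) B (path_space T) W"
    and I: "wiener_integral T M g0 B I" and J: "wiener_integral T M g1 W J" and T: "0 \<le> T"
    and K: "finite K" "\<And>k. k \<in> K \<Longrightarrow> \<tau> k \<in> {0..T}"
    and e: "0 < e" "4 * e \<le> \<bar>c\<bar>"
  shows "measure M {\<omega>\<in>space M. \<bar>(\<Sum>k\<in>K. \<beta> k * (I \<omega> (\<tau> k) + J \<omega> (\<tau> k))) - c\<bar> \<le> e} \<le> 8 * e / \<bar>c\<bar>"
proof -
  interpret prob_space M by fact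
  obtain F where F: "\<And>q::nat. path_combination T (F q)"
    and Fl: "(\<lambda>q. mean_square M (\<lambda>\<omega>. F q (B \<omega>) - (\<Sum>k\<in>K. \<beta> k * I \<omega> (\<tau> k)))) \<longlonglongrightarrow> 0"
    using wiener_integral_approximation[where \<tau> = \<tau> and \<beta> = \<beta>, OF B I K] by blast
  obtain G where G: "\<And>q::nat. path_combination T (G q)"
    and Gl: "(\<lambda>q. mean_square M (\<lambda>\<omega>. G q (W \<omega>) - (\<Sum>k\<in>K. \<beta> k * J \<omega> (\<tau> k)))) \<longlonglongrightarrow> 0"
    using wiener_integral_approximation[where \<tau> = \<tau> and \<beta> = \<beta>, OF W J K] by blast
  have Im: "(\<lambda>\<omega>. \<Sum>k\<in>K. \<beta> k * I \<omega> (\<tau> k)) \<in> borel_measurable M"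
    and Jm: "(\<lambda>\<omega>. \<Sum>k\<in>K. \<beta> k * J \<omega> (\<tau> k)) \<in> borel_measurable M"
    using I J K by (auto simp: wiener_integral_def intro!: borel_measurable_sum borel_measurable_times)
  define f where "f \<omega> = (\<Sum>k\<in>K. \<beta> k * (I \<omega> (\<tau> k) + J \<omega> (\<tau> k)))" for \<omega>
  have f_eq: "f \<omega> = (\<Sum>k\<in>K. \<beta> k * I \<omega> (\<tau> k)) + (\<Sum>k\<in>K. \<beta> k * J \<omega> (\<tau> k))" for \<omega>
    by (simp add: f_def distrib_left sum.distrib)
  have fm[measurable]: "f \<in> borel_measurable M"
    unfolding f_eq using Im Jm by simp
  define h where "h q \<omega> = F q (B \<omega>) + G q (W \<omega>)" for q \<omega>
  have "\<exists>v. centered_normal M (h q) v" for q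
  proof -
    obtain v where "centered_normal M (\<lambda>\<omega>. F q (B \<omega>)) v"
      using brownian_path_combination_normal[OF M B F T] by blast
    moreover obtain w where "centered_normal M (\<lambda>\<omega>. G q (W \<omega>)) w"
      using brownian_path_combination_normal[OF M W G T] by blast
    ultimately show ?thesis
      unfolding h_def
      using centered_normal_add[OF M indep_elements_compose[OF M ind
            path_combination_measurable[OF F] path_combination_measurable[OF G]]]
      by blast
  qed
  then obtain v where h: "\<And>q. centered_normal M (h q) (v q)" by metis
  have BW: "B \<in> M \<rightarrow>\<^sub>M path_space T" "W \<in> M \<rightarrow>\<^sub>M path_space T"
    using B W by (auto simp: std_brownian_motion_def)
  have Fm[measurable]: "(\<lambda>\<omega>. F q (B \<omega>)) \<in> borel_measurable M" "(\<lambda>\<omega>. G q (W \<omega>)) \<in> borel_measurable M" for q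
    using measurable_compose[OF BW(1) path_combination_measurable[OF F]]
      measurable_compose[OF BW(2) path_combination_measurable[OF G]] by auto
  have hm[measurable]: "h q \<in> borel_measurable M" for q unfolding h_def by measurable
  have hl: "(\<lambda>q. mean_square M (\<lambda>\<omega>. h q \<omega> - f \<omega>)) \<longlonglongrightarrow> 0"
  proof (rule ennreal_tendsto_0_le)
    let ?A = "\<lambda>q \<omega>. F q (B \<omega>) - (\<Sum>k\<in>K. \<beta> k * I \<omega> (\<tau> k))"
    let ?C = "\<lambda>q \<omega>. G q (W \<omega>) - (\<Sum>k\<in>K. \<beta> k * J \<omega> (\<tau> k))"
    show "mean_square M (\<lambda>\<omega>. h q \<omega> - f \<omega>) \<le> 2 * mean_square M (?A q) + 2 * mean_square M (?C q)" for q
    proof -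
      have "h q \<omega> - f \<omega> = ?A q \<omega> + ?C q \<omega>" for \<omega> by (simp add: h_def f_eq)
      then show ?thesis
        using Im Jm Fm by (simp only:) (intro mean_square_add_le borel_measurable_diff)
    qed
    have "(\<lambda>q. 2 * mean_square M (?A q) + 2 * mean_square M (?C q)) \<longlonglongrightarrow> 2 * 0 + 2 * 0"
      by (intro tendsto_add ennreal_tendsto_cmult Fl Gl) auto
    then show "(\<lambda>q. 2 * mean_square M (?A q) + 2 * mean_square M (?C q)) \<longlonglongrightarrow> 0" by simp
  qed
  have "emeasure M {\<omega>\<in>space M. \<bar>f \<omega> - c\<bar> \<le> e}
      \<le> ennreal (8 * e / \<bar>c\<bar>) + ennreal (1 / e\<^sup>2) * mean_square M (\<lambda>\<omega>. h q \<omega> - f \<omega>)" for q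
  proof -
    have "emeasure M {\<omega>\<in>space M. \<bar>f \<omega> - c\<bar> \<le> e}
        \<le> emeasure M ({\<omega>\<in>space M. \<bar>h q \<omega> - c\<bar> \<le> 2 * e} \<union> {\<omega>\<in>space M. e \<le> \<bar>h q \<omega> - f \<omega>\<bar>})"
      by (intro emeasure_mono) auto
    also have "\<dots> \<le> emeasure M {\<omega>\<in>space M. \<bar>h q \<omega> - c\<bar> \<le> 2 * e}
        + emeasure M {\<omega>\<in>space M. e \<le> \<bar>h q \<omega> - f \<omega>\<bar>}"
      by (intro emeasure_subadditive) auto
    also have "\<dots> \<le> ennreal (8 * e / \<bar>c\<bar>) + ennreal (1 / e\<^sup>2) * mean_square M (\<lambda>\<omega>. h q \<omega> - f \<omega>)"
    proof (rule add_mono)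
      show "emeasure M {\<omega>\<in>space M. \<bar>h q \<omega> - c\<bar> \<le> 2 * e} \<le> ennreal (8 * e / \<bar>c\<bar>)"
        using centered_normal_anticoncentration[OF M h, of "2 * e" c q] e
        by (simp add: emeasure_eq_measure)
      have "emeasure M {\<omega>\<in>space M. e \<le> \<bar>h q \<omega> - f \<omega>\<bar>}
          = (\<integral>\<^sup>+\<omega>. indicator {\<omega>\<in>space M. e \<le> \<bar>h q \<omega> - f \<omega>\<bar>} \<omega> \<partial>M)" by simp
      also have "\<dots> \<le> (\<integral>\<^sup>+\<omega>. ennreal (1 / e\<^sup>2) * ennreal ((h q \<omega> - f \<omega>)\<^sup>2) \<partial>M)"
      proof (rule nn_integral_mono)
        fix \<omega>
        have "1 \<le> 1 / e\<^sup>2 * (h q \<omega> - f \<omega>)\<^sup>2" if "e \<le> \<bar>h q \<omega> - f \<omega>\<bar>"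
        proof -
          have "e\<^sup>2 \<le> (h q \<omega> - f \<omega>)\<^sup>2" using that e abs_le_square_iff[of e "h q \<omega> - f \<omega>"] by auto
          then show ?thesis using e by (simp add: field_simps)
        qed
        then show "indicator {\<omega>\<in>space M. e \<le> \<bar>h q \<omega> - f \<omega>\<bar>} \<omega>
            \<le> ennreal (1 / e\<^sup>2) * ennreal ((h q \<omega> - f \<omega>)\<^sup>2)"
          using ennreal_leI[of 1 "1 / e\<^sup>2 * (h q \<omega> - f \<omega>)\<^sup>2"]
          by (auto simp: ennreal_mult[symmetric] split: split_indicator)
      qed
      finally show "emeasure M {\<omega>\<in>space M. e \<le> \<bar>h q \<omega> - f \<omega>\<bar>}
          \<le> ennreal (1 / e\<^sup>2) * mean_square M (\<lambda>\<omega>. h q \<omega> - f \<omega>)"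
        by (simp add: nn_integral_cmult mean_square_def)
    qed
    finally show ?thesis .
  qed
  moreover have "(\<lambda>q. ennreal (8 * e / \<bar>c\<bar>) + ennreal (1 / e\<^sup>2) * mean_square M (\<lambda>\<omega>. h q \<omega> - f \<omega>))
      \<longlonglongrightarrow> ennreal (8 * e / \<bar>c\<bar>) + ennreal (1 / e\<^sup>2) * 0"
    by (intro tendsto_add tendsto_const ennreal_tendsto_cmult hl) auto
  ultimately have "emeasure M {\<omega>\<in>space M. \<bar>f \<omega> - c\<bar> \<le> e} \<le> ennreal (8 * e / \<bar>c\<bar>)"
    by (intro LIMSEQ_le_const[where X = "\<lambda>q. ennreal (8 * e / \<bar>c\<bar>)
          + ennreal (1 / e\<^sup>2) * mean_square M (\<lambda>\<omega>. h q \<omega> - f \<omega>)"]) auto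
  then show ?thesis using e by (simp add: emeasure_eq_measure f_def)
qed

text \<open>
  On the event of convergence, almost all members of the sequence lie in every ball around \<open>c\<close>; by
  continuity from below its probability is at most \<open>L e\<close>, for every small \<open>e\<close>.
\<close>

lemma AE_not_tendsto_of_small_ball:
  fixes X :: "nat \<Rightarrow> 'w \<Rightarrow> real"
  assumes M: "prob_space M" and [measurable]: "\<And>m. X m \<in> borel_measurable M" and "0 < \<rho>"
    and small: "\<And>m e. 0 < e \<Longrightarrow> e \<le> \<rho> \<Longrightarrow> measure M {\<omega>\<in>space M. \<bar>X m \<omega> - c\<bar> \<le> e} \<le> L * e"
  shows "AE \<omega> in M. \<not> (\<lambda>m. X m \<omega>) \<longlonglongrightarrow> c"
proof -
  interpret prob_space M by fact
  define A where "A = {\<omega>\<in>space M. (\<lambda>m. X m \<omega>) \<longlonglongrightarrow> c}"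
  have [measurable]: "A \<in> sets M" unfolding A_def by measurable
  have bound: "prob A \<le> L * e" if e: "0 < e" "e \<le> \<rho>" for e
  proof -
    define D where "D n = {\<omega>\<in>space M. \<forall>m\<ge>n. \<bar>X m \<omega> - c\<bar> \<le> e}" for n
    have [measurable]: "\<And>n. D n \<in> sets M" unfolding D_def by measurable
    have "A \<subseteq> (\<Union>n. D n)"
    proof
      fix \<omega> assume \<omega>: "\<omega> \<in> A"
      then obtain n where "\<forall>m\<ge>n. norm (X m \<omega> - c) < e"
        using LIMSEQ_D[of "\<lambda>m. X m \<omega>" c e] e by (auto simp: A_def)
      then have "\<omega> \<in> D n" using \<omega> by (auto simp: D_def A_def less_imp_le)
      then show "\<omega> \<in> (\<Union>n. D n)" by blast
    qed
    then have "prob A \<le> prob (\<Union>n. D n)" by (intro finite_measure_mono) auto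
    also have "\<dots> \<le> L * e"
    proof (rule LIMSEQ_le_const2)
      show "(\<lambda>n. prob (D n)) \<longlonglongrightarrow> prob (\<Union>n. D n)"
        by (intro finite_Lim_measure_incseq) (auto simp: incseq_def D_def)
      have "prob (D n) \<le> L * e" for n
      proof -
        have "prob (D n) \<le> prob {\<omega>\<in>space M. \<bar>X n \<omega> - c\<bar> \<le> e}"
          by (intro finite_measure_mono) (auto simp: D_def)
        then show ?thesis using small[OF e, of n] by simp
      qed
      then show "\<exists>N. \<forall>n\<ge>N. prob (D n) \<le> L * e" by blast
    qed
    finally show ?thesis .
  qed
  have "prob A \<le> 0"
  proof (rule tendsto_lowerbound)
    have "((\<lambda>e. L * e) \<longlongrightarrow> L * 0) (at_right 0)" by (intro tendsto_intros)
    then show "((\<lambda>e. L * e) \<longlongrightarrow> 0) (at_right 0)" by simp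
    show "\<forall>\<^sub>F e in at_right 0. prob A \<le> L * e"
      using \<open>0 < \<rho>\<close> bound by (auto simp: eventually_at_right intro!: exI[of _ \<rho>])
  qed simp
  then have "prob A = 0" using measure_nonneg[of M A] by linarith
  then have "A \<in> null_sets M" by (auto simp: emeasure_eq_measure null_sets_def)
  then show ?thesis by (rule AE_I') (auto simp: A_def)
qed

section \<open>Covariation of a Brownian motion with a step integral\<close>

text \<open>
  Polarisation of the variance formula, since sums and differences of such combinations are of the
  same form.
\<close>

lemma brownian_increments_covariance:
  fixes W :: "'w \<Rightarrow> real \<Rightarrow> real^'m"
  assumes M: "prob_space M" and W: "std_brownian_motion T M W"
    and r: "0 \<le> r 0" "\<And>k. k < n \<Longrightarrow> r k \<le> r (Suc k)" "r n \<le> T"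
  defines "S \<equiv> \<lambda>a \<omega>. \<Sum>k<n. a k \<bullet> (W \<omega> (r (Suc k)) - W \<omega> (r k))"
  shows "integrable M (\<lambda>\<omega>. S a \<omega> * S b \<omega>)"
    and "(LINT \<omega>|M. S a \<omega> * S b \<omega>) = (\<Sum>k<n. (a k \<bullet> b k) * (r (Suc k) - r k))"
proof -
  have N: "centered_normal M (S a) (\<Sum>k<n. (norm (a k))\<^sup>2 * (r (Suc k) - r k))" for a
    unfolding S_def by (rule brownian_increments_sum_normal[OF M W r])
  note m = centered_normal_moments(1)[OF N, of _ 2] centered_normal_moments(3)[OF N]
  have add: "S (\<lambda>k. a k + b k) \<omega> = S a \<omega> + S b \<omega>" and diff: "S (\<lambda>k. a k - b k) \<omega> = S a \<omega> - S b \<omega>" for \<omega>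
    by (simp_all add: S_def inner_add_left inner_diff_left sum.distrib sum_subtractf)
  have eq: "S a \<omega> * S b \<omega> = ((S (\<lambda>k. a k + b k) \<omega>)\<^sup>2 - (S (\<lambda>k. a k - b k) \<omega>)\<^sup>2) / 4" for \<omega>
    unfolding add diff by (simp add: power2_eq_square algebra_simps)
  show "integrable M (\<lambda>\<omega>. S a \<omega> * S b \<omega>)"
    unfolding eq using m(1) by (intro integrable_divide Bochner_Integration.integrable_diff)
  have "(LINT \<omega>|M. S a \<omega> * S b \<omega>)
      = ((\<Sum>k<n. (norm (a k + b k))\<^sup>2 * (r (Suc k) - r k))
        - (\<Sum>k<n. (norm (a k - b k))\<^sup>2 * (r (Suc k) - r k))) / 4"
    unfolding eq using m by simp
  also have "\<dots> = (\<Sum>k<n. ((norm (a k + b k))\<^sup>2 - (norm (a k - b k))\<^sup>2) / 4 * (r (Suc k) - r k))"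
    by (simp add: left_diff_distrib sum_subtractf diff_divide_distrib sum_divide_distrib)
  also have "\<dots> = (\<Sum>k<n. (a k \<bullet> b k) * (r (Suc k) - r k))"
    by (simp add: power2_norm_eq_inner inner_add_left inner_add_right
        inner_diff_left inner_diff_right inner_commute)
  finally show "(LINT \<omega>|M. S a \<omega> * S b \<omega>) = (\<Sum>k<n. (a k \<bullet> b k) * (r (Suc k) - r k))" .
qed

lemma brownian_increment_pair_moment:
  fixes W :: "'w \<Rightarrow> real \<Rightarrow> real^'m"
  assumes M: "prob_space M" and W: "std_brownian_motion T M W"
    and r: "0 \<le> r 0" "\<And>k. k < n \<Longrightarrow> r k \<le> r (Suc k)" "r n \<le> T" and kl: "k < n" "l < n"
  shows "integrable M (\<lambda>\<omega>. (a \<bullet> (W \<omega> (r (Suc k)) - W \<omega> (r k))) * (b \<bullet> (W \<omega> (r (Suc l)) - W \<omega> (r l))))" (is ?int)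
    and "(LINT \<omega>|M. (a \<bullet> (W \<omega> (r (Suc k)) - W \<omega> (r k))) * (b \<bullet> (W \<omega> (r (Suc l)) - W \<omega> (r l))))
      = (if k = l then (a \<bullet> b) * (r (Suc k) - r k) else 0)" (is ?eq)
proof -
  have single: "(\<Sum>i<n. (if i = k then a else 0) \<bullet> D i) = a \<bullet> D k" if "k < n"
    for k a and D :: "nat \<Rightarrow> real^'m"
    using that by (simp add: if_distrib[of "\<lambda>x. x \<bullet> _"] cong: if_cong)
  note c = brownian_increments_covariance[OF M W r, of "\<lambda>i. if i = k then a else 0"
      "\<lambda>i. if i = l then b else 0", unfolded single[OF kl(1)] single[OF kl(2)]]
  show ?int
    by (rule c(1))
  have "((if i = k then a else 0) \<bullet> (if i = l then b else 0)) * (r (Suc i) - r i)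
      = (if i = k then (if k = l then (a \<bullet> b) * (r (Suc k) - r k) else 0) else 0)" for i
    by auto
  then show ?eq
    using c(2) kl by simp
qed

lemma uncorrelated_sum_mean_square:
  fixes \<xi> :: "nat \<Rightarrow> 'w \<Rightarrow> real"
  assumes int: "\<And>k l. k < n \<Longrightarrow> l < n \<Longrightarrow> integrable M (\<lambda>\<omega>. \<xi> k \<omega> * \<xi> l \<omega>)"
    and unc: "\<And>k l. k < n \<Longrightarrow> l < n \<Longrightarrow> k \<noteq> l \<Longrightarrow> (LINT \<omega>|M. \<xi> k \<omega> * \<xi> l \<omega>) = 0"
  shows "mean_square M (\<lambda>\<omega>. \<Sum>k<n. \<xi> k \<omega>) = ennreal (\<Sum>k<n. LINT \<omega>|M. (\<xi> k \<omega>)\<^sup>2)"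
proof -
  have sq: "(\<Sum>k<n. \<xi> k \<omega>)\<^sup>2 = (\<Sum>k<n. \<Sum>l<n. \<xi> k \<omega> * \<xi> l \<omega>)" for \<omega>
    by (simp add: power2_eq_square sum_product)
  have i: "integrable M (\<lambda>\<omega>. (\<Sum>k<n. \<xi> k \<omega>)\<^sup>2)"
    unfolding sq using int by (intro Bochner_Integration.integrable_sum) auto
  have "(LINT \<omega>|M. (\<Sum>k<n. \<xi> k \<omega>)\<^sup>2) = (\<Sum>k<n. \<Sum>l<n. LINT \<omega>|M. \<xi> k \<omega> * \<xi> l \<omega>)"
    unfolding sq using int
    by (subst Bochner_Integration.integral_sum; (intro Bochner_Integration.integrable_sum)?) 
      (auto intro!: sum.cong Bochner_Integration.integral_sum)
  also have "\<dots> = (\<Sum>k<n. \<Sum>l<n. if l = k then LINT \<omega>|M. (\<xi> k \<omega>)\<^sup>2 else 0)"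
    using unc by (intro sum.cong refl) (auto simp: power2_eq_square)
  also have "\<dots> = (\<Sum>k<n. LINT \<omega>|M. (\<xi> k \<omega>)\<^sup>2)" by simp
  finally show ?thesis
    unfolding mean_square_def using i by (subst nn_integral_eq_integral) auto
qed

text \<open>
  The summands are centered functions of different Brownian increments, hence uncorrelated, and the
  second moment of each is of the order of the squared length of its cell by the fourth moments of
  normal variables. Summing leaves one factor \<open>\<delta>\<close>.
\<close>

lemma bracket_of_step_integral:
  fixes W :: "'w \<Rightarrow> real \<Rightarrow> real^'m" and c :: "nat \<Rightarrow> real^'m"
  assumes M: "prob_space M" and W: "std_brownian_motion T M W"
    and r: "0 \<le> r 0" "\<And>k. k < n \<Longrightarrow> r k \<le> r (Suc k)" "r n \<le> T"
    and \<delta>: "\<And>k. k < n \<Longrightarrow> r (Suc k) - r k \<le> \<delta>" and \<delta>0: "0 \<le> \<delta>"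
    and \<Gamma>: "\<And>k. k < n \<Longrightarrow> norm (c k) \<le> \<Gamma>"
  shows "mean_square M (\<lambda>\<omega>. \<Sum>k<n. (c k \<bullet> (W \<omega> (r (Suc k)) - W \<omega> (r k))) *
      (W \<omega> (r (Suc k)) - W \<omega> (r k)) $ j - c k $ j * (r (Suc k) - r k))
    \<le> ennreal (2 * (\<Gamma> ^ 4 + 1) * \<delta> * T)"
proof -
  interpret prob_space M by fact
  define D where "D k \<omega> = W \<omega> (r (Suc k)) - W \<omega> (r k)" for k \<omega>
  define d where "d k = r (Suc k) - r k" for k
  define \<xi> where "\<xi> k \<omega> = (c k \<bullet> D k \<omega>) * D k \<omega> $ j - c k $ j * d k" for k \<omega>
  have b: "0 \<le> r k" "r k \<le> T" if "k \<le> n" for k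
    using monotone_grid_bounds[of n r k, OF r(2) that] r(1,3) by linarith+
  have d0: "0 \<le> d k" if "k < n" for k using r(2)[OF that] by (simp add: d_def)
  have D: "D k \<omega> $ j = axis j 1 \<bullet> D k \<omega>" for k \<omega> by (simp add: inner_axis inner_commute)
  have N: "centered_normal M (\<lambda>\<omega>. a \<bullet> D k \<omega>) ((norm a)\<^sup>2 * d k)" if "k < n" for a k
    unfolding D_def d_def using brownian_increment_normal[OF M W] b[of k] b[of "Suc k"] r(2) that by auto
  have [measurable]: "D k \<in> borel_measurable M" if "k < n" for k
    unfolding D_def using brownian_motion_measurable[OF W] b[of k] b[of "Suc k"] that
    by (intro borel_measurable_diff) auto
  have pair: "integrable M (\<lambda>\<omega>. (c k \<bullet> D k \<omega>) * (axis j 1 \<bullet> D k \<omega>))"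
    "(LINT \<omega>|M. (c k \<bullet> D k \<omega>) * (axis j 1 \<bullet> D k \<omega>)) = c k $ j * d k" if "k < n" for k
    using brownian_increment_pair_moment[of M T W r n k k "c k" "axis j 1", OF M W r that that]
    unfolding D_def d_def by (simp_all add: inner_axis)
  have \<xi>1: "integrable M (\<xi> k)" "(LINT \<omega>|M. \<xi> k \<omega>) = 0" if "k < n" for k
    unfolding \<xi>_def D using pair[OF that] by (simp_all add: prob_space)
  have four: "integrable M (\<lambda>\<omega>. ((c k \<bullet> D k \<omega>) * (axis j 1 \<bullet> D k \<omega>))\<^sup>2)"
    "(LINT \<omega>|M. ((c k \<bullet> D k \<omega>) * (axis j 1 \<bullet> D k \<omega>))\<^sup>2) \<le> 2 * (\<Gamma> ^ 4 + 1) * (d k)\<^sup>2" if k: "k < n" for k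
  proof -
    let ?u = "\<lambda>\<omega>. c k \<bullet> D k \<omega>" and ?v = "\<lambda>\<omega>. axis j 1 \<bullet> D k \<omega>"
    note u = centered_normal_moments[OF N[OF k, of "c k"]]
    note v = centered_normal_moments[OF N[OF k, of "axis j 1"]]
    have le: "(?u \<omega> * ?v \<omega>)\<^sup>2 \<le> (?u \<omega> ^ 4 + ?v \<omega> ^ 4) / 2" for \<omega>
      using zero_le_power2[of "(?u \<omega>)\<^sup>2 - (?v \<omega>)\<^sup>2"]
      by (simp add: power2_eq_square power4_eq_xxxx algebra_simps)
    have iu: "integrable M (\<lambda>\<omega>. (?u \<omega> ^ 4 + ?v \<omega> ^ 4) / 2)"
      using u(1)[of 4] v(1)[of 4] by auto
    show int: "integrable M (\<lambda>\<omega>. (?u \<omega> * ?v \<omega>)\<^sup>2)"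
      by (rule Bochner_Integration.integrable_bound[OF iu]) (use le k in \<open>auto intro: order_trans\<close>)
    have "(LINT \<omega>|M. (?u \<omega> * ?v \<omega>)\<^sup>2) \<le> (LINT \<omega>|M. (?u \<omega> ^ 4 + ?v \<omega> ^ 4) / 2)"
      by (rule integral_mono[OF int iu le])
    also have "\<dots> = 3 / 2 * (norm (c k) ^ 4 + 1) * (d k)\<^sup>2"
      using u(1)[of 4] v(1)[of 4] u(4) v(4)
      by (simp add: norm_axis_1 power_mult_distrib algebra_simps flip: power_mult)
    also have "\<dots> \<le> 2 * (\<Gamma> ^ 4 + 1) * (d k)\<^sup>2"
      using \<Gamma>[OF k] by (intro mult_right_mono mult_mono add_mono power_mono) auto
    finally show "(LINT \<omega>|M. (?u \<omega> * ?v \<omega>)\<^sup>2) \<le> 2 * (\<Gamma> ^ 4 + 1) * (d k)\<^sup>2" .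
  qed
  have \<xi>2: "integrable M (\<lambda>\<omega>. (\<xi> k \<omega>)\<^sup>2)" "(LINT \<omega>|M. (\<xi> k \<omega>)\<^sup>2) \<le> 2 * (\<Gamma> ^ 4 + 1) * (d k)\<^sup>2" if k: "k < n" for k
  proof -
    let ?p = "\<lambda>\<omega>. (c k \<bullet> D k \<omega>) * (axis j 1 \<bullet> D k \<omega>)"
    have eq: "(\<xi> k \<omega>)\<^sup>2 = (?p \<omega>)\<^sup>2 - 2 * (c k $ j * d k) * ?p \<omega> + (c k $ j * d k)\<^sup>2" for \<omega>
      unfolding \<xi>_def D by (simp add: power2_diff)
    show "integrable M (\<lambda>\<omega>. (\<xi> k \<omega>)\<^sup>2)"
      unfolding eq using four(1)[OF k] pair(1)[OF k] by auto
    have "(LINT \<omega>|M. (\<xi> k \<omega>)\<^sup>2) = (LINT \<omega>|M. (?p \<omega>)\<^sup>2) - (c k $ j * d k)\<^sup>2"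
      unfolding eq using four(1)[OF k] pair[OF k] by (simp add: prob_space power2_eq_square)
    also have "\<dots> \<le> 2 * (\<Gamma> ^ 4 + 1) * (d k)\<^sup>2" using four(2)[OF k] by (smt (verit) zero_le_power2)
    finally show "(LINT \<omega>|M. (\<xi> k \<omega>)\<^sup>2) \<le> 2 * (\<Gamma> ^ 4 + 1) * (d k)\<^sup>2" .
  qed
  have ind: "indep_vars (\<lambda>_. borel) \<xi> {..<n}"
  proof -
    have "(\<lambda>v::real^'m. (c k \<bullet> v) * (axis j 1 \<bullet> v) - c k $ j * d k) \<in> borel_measurable borel" for k
      by measurable
    from indep_vars_compose2[OF brownian_increments_indep[of M T W r n, OF M W r] this]
    show ?thesis unfolding \<xi>_def D by (simp add: D_def)
  qed
  have cross: "integrable M (\<lambda>\<omega>. \<xi> k \<omega> * \<xi> l \<omega>)" "(LINT \<omega>|M. \<xi> k \<omega> * \<xi> l \<omega>) = 0"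
    if "k < n" "l < n" "k \<noteq> l" for k l
  proof -
    have ind: "indep_vars (\<lambda>_. borel) \<xi> {k, l}" using ind by (rule indep_vars_subset) (use that in auto)
    have int: "integrable M (\<xi> i)" if "i \<in> {k, l}" for i
      using that \<open>k < n\<close> \<open>l < n\<close> \<xi>1(1) by blast
    have prod: "(\<Prod>i\<in>{k, l}. f i) = f k * f l" for f :: "nat \<Rightarrow> real"
      using \<open>k \<noteq> l\<close> by simp
    show "integrable M (\<lambda>\<omega>. \<xi> k \<omega> * \<xi> l \<omega>)"
      using indep_vars_integrable[OF _ ind int] unfolding prod by simp
    show "(LINT \<omega>|M. \<xi> k \<omega> * \<xi> l \<omega>) = 0"
      using indep_vars_lebesgue_integral[OF _ ind int] \<xi>1(2)[OF \<open>k < n\<close>] unfolding prod by simp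
  qed
  have "mean_square M (\<lambda>\<omega>. \<Sum>k<n. \<xi> k \<omega>) = ennreal (\<Sum>k<n. LINT \<omega>|M. (\<xi> k \<omega>)\<^sup>2)"
  proof (rule uncorrelated_sum_mean_square)
    show "integrable M (\<lambda>\<omega>. \<xi> k \<omega> * \<xi> l \<omega>)" if "k < n" "l < n" for k l
      using cross(1)[OF that] \<xi>2(1)[OF that(1)] by (cases "k = l") (auto simp: power2_eq_square)
  qed (rule cross(2))
  also have "\<dots> \<le> ennreal (2 * (\<Gamma> ^ 4 + 1) * \<delta> * T)"
  proof (rule ennreal_leI)
    have "(\<Sum>k<n. LINT \<omega>|M. (\<xi> k \<omega>)\<^sup>2) \<le> (\<Sum>k<n. 2 * (\<Gamma> ^ 4 + 1) * \<delta> * d k)"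
    proof (rule sum_mono)
      fix k assume "k \<in> {..<n}"
      then have k: "k < n" by simp
      have "(d k)\<^sup>2 \<le> \<delta> * d k"
        unfolding power2_eq_square using \<delta>[OF k] d0[OF k] by (intro mult_right_mono) (auto simp: d_def)
      then have "2 * (\<Gamma> ^ 4 + 1) * (d k)\<^sup>2 \<le> 2 * (\<Gamma> ^ 4 + 1) * (\<delta> * d k)"
        by (intro mult_left_mono) auto
      then show "(LINT \<omega>|M. (\<xi> k \<omega>)\<^sup>2) \<le> 2 * (\<Gamma> ^ 4 + 1) * \<delta> * d k"
        using \<xi>2(2)[OF k] by (simp add: mult_ac)
    qed
    also have "\<dots> = 2 * (\<Gamma> ^ 4 + 1) * \<delta> * (r n - r 0)"
      by (simp add: sum_distrib_left[symmetric] d_def sum_lessThan_telescope)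
    also have "\<dots> \<le> 2 * (\<Gamma> ^ 4 + 1) * \<delta> * T"
      using r \<delta>0 by (intro mult_left_mono) auto
    finally show "(\<Sum>k<n. LINT \<omega>|M. (\<xi> k \<omega>)\<^sup>2) \<le> 2 * (\<Gamma> ^ 4 + 1) * \<delta> * T" .
  qed
  finally show ?thesis
    unfolding \<xi>_def D_def d_def .
qed

section \<open>Covariation with an independent integral\<close>

text \<open>
  The sum of all \<open>\<bar>f m\<bar>\<close> has a finite integral, hence is finite almost everywhere.
\<close>

lemma AE_tendsto_0_of_small_integrals:
  fixes f :: "nat \<Rightarrow> 'w \<Rightarrow> real"
  assumes [measurable]: "\<And>m. f m \<in> borel_measurable M"
    and small: "\<And>m. (\<integral>\<^sup>+\<omega>. ennreal \<bar>f m \<omega>\<bar> \<partial>M) \<le> ennreal ((1 / 2) ^ m)"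
  shows "AE \<omega> in M. (\<lambda>m. f m \<omega>) \<longlonglongrightarrow> 0"
proof -
  have "(\<integral>\<^sup>+\<omega>. (\<Sum>m. ennreal \<bar>f m \<omega>\<bar>) \<partial>M) = (\<Sum>m. \<integral>\<^sup>+\<omega>. ennreal \<bar>f m \<omega>\<bar> \<partial>M)"
    by (rule nn_integral_suminf) measurable
  also have "\<dots> \<le> (\<Sum>m. ennreal ((1 / 2) ^ m))"
    by (intro suminf_le small) auto
  also have "\<dots> = ennreal (\<Sum>m. (1 / 2) ^ m)"
    by (intro suminf_ennreal2 summable_geometric) auto
  finally have "(\<integral>\<^sup>+\<omega>. (\<Sum>m. ennreal \<bar>f m \<omega>\<bar>) \<partial>M) \<noteq> \<infinity>"
    by (auto simp: top_unique)
  then have "AE \<omega> in M. (\<Sum>m. ennreal \<bar>f m \<omega>\<bar>) \<noteq> \<infinity>"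
    by (intro nn_integral_PInf_AE) measurable
  then show ?thesis
  proof eventually_elim
    case (elim \<omega>)
    then have "summable (\<lambda>m. \<bar>f m \<omega>\<bar>)"
      by (intro summable_suminf_not_top) auto
    then have "(\<lambda>m. \<bar>f m \<omega>\<bar>) \<longlonglongrightarrow> 0" by (rule summable_LIMSEQ_zero)
    then show ?case by (simp add: tendsto_rabs_zero_iff)
  qed
qed

text \<open>
  A subsequence of the approximating step integrals converges almost surely, and its pointwise limit
  is a measurable function of the path. In this form the independence of \<open>B\<close> and \<open>W\<close> applies to
  integrals against \<open>B\<close>.
\<close>

lemma wiener_integral_path_functional:
  fixes W :: "'w \<Rightarrow> real \<Rightarrow> real^'m"
  assumes W: "std_brownian_motion T M W" and J: "wiener_integral T M g W J" and t: "t \<in> {0..T}"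
  obtains F where "F \<in> borel_measurable (path_space T)" "AE \<omega> in M. J \<omega> t = F (W \<omega>)"
proof -
  obtain F where F: "\<And>q::nat. path_combination T (F q)"
    and Fl: "(\<lambda>q. mean_square M (\<lambda>\<omega>. F q (W \<omega>) - J \<omega> t)) \<longlonglongrightarrow> 0"
    using wiener_integral_approximation[OF W J, of "{()}" "\<lambda>_. t" "\<lambda>_. 1"] t by auto
  have Fm: "F q \<in> borel_measurable (path_space T)" for q
    by (rule path_combination_measurable[OF F])
  have [measurable]: "(\<lambda>\<omega>. J \<omega> t) \<in> borel_measurable M"
    using J t by (auto simp: wiener_integral_def)
  have WM: "W \<in> M \<rightarrow>\<^sub>M path_space T" using W by (auto simp: std_brownian_motion_def)
  have [measurable]: "(\<lambda>\<omega>. F q (W \<omega>)) \<in> borel_measurable M" for q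
    by (rule measurable_compose[OF WM Fm])
  have "\<exists>q. mean_square M (\<lambda>\<omega>. F q (W \<omega>) - J \<omega> t) \<le> ennreal ((1 / 2) ^ m)" for m
  proof -
    have "eventually (\<lambda>q. mean_square M (\<lambda>\<omega>. F q (W \<omega>) - J \<omega> t) < ennreal ((1 / 2) ^ m)) sequentially"
      by (rule order_tendstoD(2)[OF Fl]) simp
    then show ?thesis by (auto simp: eventually_sequentially intro: less_imp_le)
  qed
  then obtain q where q: "\<And>m. mean_square M (\<lambda>\<omega>. F (q m) (W \<omega>) - J \<omega> t) \<le> ennreal ((1 / 2) ^ m)"
    by metis
  have "AE \<omega> in M. (\<lambda>m. (F (q m) (W \<omega>) - J \<omega> t)\<^sup>2) \<longlonglongrightarrow> 0"
    using q by (intro AE_tendsto_0_of_small_integrals) (auto simp: mean_square_def)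
  then have "AE \<omega> in M. J \<omega> t = lim (\<lambda>m. F (q m) (W \<omega>))"
  proof eventually_elim
    case (elim \<omega>)
    from tendsto_real_sqrt[OF this] have "(\<lambda>m. \<bar>F (q m) (W \<omega>) - J \<omega> t\<bar>) \<longlonglongrightarrow> 0" by simp
    then have "(\<lambda>m. F (q m) (W \<omega>)) \<longlonglongrightarrow> J \<omega> t"
      by (simp add: tendsto_rabs_zero_iff LIM_zero_iff)
    then show ?case by (simp add: limI)
  qed
  moreover have "(\<lambda>w. lim (\<lambda>m. F (q m) w)) \<in> borel_measurable (path_space T)"
    by (rule borel_measurable_lim_metric[OF Fm])
  ultimately show ?thesis using that by blast
qed

lemma mean_square_cong_AE:
  "AE \<omega> in M. f \<omega> = g \<omega> \<Longrightarrow> mean_square M f = mean_square M g"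
  unfolding mean_square_def by (rule nn_integral_cong_AE) auto

text \<open>
  By independence, the expectation of a product of two summands splits into an expectation over
  increments of \<open>I\<close> and one over increments of \<open>W\<close>. The latter vanishes off the diagonal and is the
  length of the cell, at most \<open>\<delta>\<close>, on the diagonal. The second moments of the increments of \<open>I\<close> add up
  to at most four times the energy of \<open>g\<close>.
\<close>

lemma bracket_of_independent_integral:
  fixes B :: "'w \<Rightarrow> real \<Rightarrow> real^'d" and W :: "'w \<Rightarrow> real \<Rightarrow> real^'n"
  assumes M: "prob_space M" and B: "std_brownian_motion T M B" and W: "std_brownian_motion T M W"
    and ind: "indep_elements M (path_space T) B (path_space T) W"
    and I: "wiener_integral T M g B I" and T: "0 \<le> T"
    and r: "0 \<le> r 0" "\<And>k. k < n \<Longrightarrow> r k \<le> r (Suc k)" "r n \<le> T"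
    and \<delta>: "\<And>k. k < n \<Longrightarrow> r (Suc k) - r k \<le> \<delta>"
  shows "mean_square M (\<lambda>\<omega>. \<Sum>k<n. (I \<omega> (r (Suc k)) - I \<omega> (r k)) * (W \<omega> (r (Suc k)) - W \<omega> (r k)) $ j)
    \<le> ennreal \<delta> * (4 * (\<integral>\<^sup>+s\<in>{0<..T}. ennreal ((norm (g s))\<^sup>2) \<partial>lborel))"
proof -
  let ?S = "\<lambda>\<omega>. \<Sum>k<n. (I \<omega> (r (Suc k)) - I \<omega> (r k)) * (W \<omega> (r (Suc k)) - W \<omega> (r k)) $ j"
  interpret prob_space M by fact
  have b: "r k \<in> {0..T}" if "k \<le> n" for k
    using monotone_grid_bounds[of n r k, OF r(2) that] r(1,3) by auto
  have gm[measurable]: "g \<in> borel_measurable borel" using I by (auto simp: wiener_integral_def)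
  have "\<exists>F. F \<in> borel_measurable (path_space T) \<and> (AE \<omega> in M. I \<omega> (r k) = F (B \<omega>))" if "k \<le> n" for k
    using wiener_integral_path_functional[OF B I b[OF that]] by metis
  then obtain F where Fm: "\<And>k. k \<le> n \<Longrightarrow> F k \<in> borel_measurable (path_space T)"
    and FI: "\<And>k. k \<le> n \<Longrightarrow> AE \<omega> in M. I \<omega> (r k) = F k (B \<omega>)" by metis
  define a where "a k w = F (Suc k) w - F k w" for k w
  define v where "v k w = (w (r (Suc k)) - w (r k)) $ j" for k and w :: "real \<Rightarrow> real^'n"
  have am: "a k \<in> borel_measurable (path_space T)" if "k < n" for k
    unfolding a_def using Fm[of k] Fm[of "Suc k"] that by (intro borel_measurable_diff) auto
  have v_eq: "v k w = axis j 1 \<bullet> (w (r (Suc k)) - w (r k))" for k w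
    unfolding v_def cart_eq_inner_axis by (rule inner_commute)
  have vm: "v k \<in> borel_measurable (path_space T)" if "k < n" for k
    unfolding v_eq using b[of k] b[of "Suc k"] that
    by (intro borel_measurable_inner borel_measurable_diff measurable_path_eval borel_measurable_const) auto
  have aI: "AE \<omega> in M. I \<omega> (r (Suc k)) - I \<omega> (r k) = a k (B \<omega>)" if "k < n" for k
    using FI[of k] FI[of "Suc k"] that unfolding a_def by auto
  have BM: "B \<in> M \<rightarrow>\<^sub>M path_space T" using B by (auto simp: std_brownian_motion_def)
  have aM: "(\<lambda>\<omega>. a k (B \<omega>)) \<in> borel_measurable M" if "k < n" for k
    using measurable_compose[OF BM am[OF that]] .
  define G where "G k = (\<integral>\<^sup>+s\<in>{r k<..r (Suc k)}. ennreal ((norm (g s))\<^sup>2) \<partial>lborel)" for k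
  have Gsum: "(\<Sum>k<n. G k) \<le> (\<integral>\<^sup>+s\<in>{0<..T}. ennreal ((norm (g s))\<^sup>2) \<partial>lborel)"
  proof -
    have "(\<lambda>s. ennreal ((norm (g s))\<^sup>2)) \<in> borel_measurable borel" by measurable
    note nn_integral_grid[of n r, OF r(2) this]
    moreover have "(\<integral>\<^sup>+s\<in>{r 0<..r n}. ennreal ((norm (g s))\<^sup>2) \<partial>lborel)
        \<le> (\<integral>\<^sup>+s\<in>{0<..T}. ennreal ((norm (g s))\<^sup>2) \<partial>lborel)"
      using r(1,3) by (intro nn_integral_mono) (auto split: split_indicator)
    ultimately show ?thesis by (simp add: G_def)
  qed
  have fin: "(\<integral>\<^sup>+s\<in>{0<..T}. ennreal ((norm (g s))\<^sup>2) \<partial>lborel) < \<infinity>"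
    by (rule wiener_integrand_square_integrable[OF M B I T])
  have msa: "mean_square M (\<lambda>\<omega>. a k (B \<omega>)) \<le> 4 * G k" if k: "k < n" for k
  proof -
    have "mean_square M (\<lambda>\<omega>. I \<omega> (r (Suc k)) - I \<omega> (r k) - 0 \<bullet> (B \<omega> (r (Suc k)) - B \<omega> (r k)))
        \<le> 4 * (\<integral>\<^sup>+s\<in>{r k<..r (Suc k)}. ennreal ((norm (g s - 0))\<^sup>2) \<partial>lborel)"
      using b[of k] b[of "Suc k"] r(2)[OF k] k
      by (intro wiener_integral_increment_le[OF M B I]) auto
    moreover have "mean_square M (\<lambda>\<omega>. a k (B \<omega>)) = mean_square M (\<lambda>\<omega>. I \<omega> (r (Suc k)) - I \<omega> (r k))"
      using aI[OF k] by (intro mean_square_cong_AE) auto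
    ultimately show ?thesis by (simp add: G_def)
  qed
  have a2: "integrable M (\<lambda>\<omega>. (a k (B \<omega>))\<^sup>2)" if k: "k < n" for k
  proof (rule integrableI_nonneg)
    have "G k \<le> (\<Sum>k<n. G k)" using k by (intro member_le_sum) auto
    then have "4 * G k < \<infinity>" using Gsum fin by (auto simp: ennreal_mult_less_top intro: le_less_trans)
    then show "(\<integral>\<^sup>+\<omega>. ennreal ((a k (B \<omega>))\<^sup>2) \<partial>M) < \<infinity>"
      using msa[OF k] by (auto simp: mean_square_def intro: le_less_trans)
  qed (use aM[OF k] in auto)
  have aa: "integrable M (\<lambda>\<omega>. a k (B \<omega>) * a l (B \<omega>))" if kl: "k < n" "l < n" for k l
  proof (rule Bochner_Integration.integrable_bound)
    show "integrable M (\<lambda>\<omega>. (a k (B \<omega>))\<^sup>2 + (a l (B \<omega>))\<^sup>2)" using a2 kl by auto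
    have "\<bar>x * y\<bar> \<le> x\<^sup>2 + y\<^sup>2" for x y :: real
    proof -
      have "0 \<le> \<bar>x\<bar> * \<bar>y\<bar>" by simp
      then show ?thesis
        using zero_le_power2[of "\<bar>x\<bar> - \<bar>y\<bar>"] unfolding power2_diff abs_mult power2_abs by linarith
    qed
    then show "AE \<omega> in M. norm (a k (B \<omega>) * a l (B \<omega>)) \<le> norm ((a k (B \<omega>))\<^sup>2 + (a l (B \<omega>))\<^sup>2)"
      by auto
  qed (use aM kl in auto)
  have vv: "integrable M (\<lambda>\<omega>. v k (W \<omega>) * v l (W \<omega>))"
    "(LINT \<omega>|M. v k (W \<omega>) * v l (W \<omega>)) = (if k = l then r (Suc k) - r k else 0)"
    if kl: "k < n" "l < n" for k l
    using brownian_increment_pair_moment[of M T W r n k l "axis j 1" "axis j 1", OF M W r kl]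
    unfolding v_eq by (simp_all add: inner_axis_axis)
  have prod: "integrable M (\<lambda>\<omega>. (a k (B \<omega>) * v k (W \<omega>)) * (a l (B \<omega>) * v l (W \<omega>)))" (is ?int)
    "(LINT \<omega>|M. (a k (B \<omega>) * v k (W \<omega>)) * (a l (B \<omega>) * v l (W \<omega>)))
      = (LINT \<omega>|M. a k (B \<omega>) * a l (B \<omega>)) * (if k = l then r (Suc k) - r k else 0)" (is ?eq)
    if kl: "k < n" "l < n" for k l
  proof -
    have i: "indep_var borel (\<lambda>\<omega>. a k (B \<omega>) * a l (B \<omega>)) borel (\<lambda>\<omega>. v k (W \<omega>) * v l (W \<omega>))"
      using am vm kl
      by (intro indep_elements_compose[OF M ind, of "\<lambda>w. a k w * a l w" "\<lambda>w. v k w * v l w"]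
          borel_measurable_times) auto
    have eq: "(a k (B \<omega>) * v k (W \<omega>)) * (a l (B \<omega>) * v l (W \<omega>))
        = (a k (B \<omega>) * a l (B \<omega>)) * (v k (W \<omega>) * v l (W \<omega>))" for \<omega> by simp
    show ?int
      unfolding eq by (rule indep_var_integrable[OF i aa[OF kl] vv(1)[OF kl]])
    show ?eq
      unfolding eq indep_var_lebesgue_integral[OF i aa[OF kl] vv(1)[OF kl]] vv(2)[OF kl] ..
  qed
  have "AE \<omega> in M. \<forall>k\<in>{..<n}. I \<omega> (r (Suc k)) - I \<omega> (r k) = a k (B \<omega>)"
    using aI by (intro AE_finite_allI) auto
  then have "AE \<omega> in M. (?S \<omega>)
      = (\<Sum>k<n. a k (B \<omega>) * v k (W \<omega>))"
    by eventually_elim (auto simp: v_def intro!: sum.cong)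
  then have "mean_square M (\<lambda>\<omega>. ?S \<omega>)
      = mean_square M (\<lambda>\<omega>. \<Sum>k<n. a k (B \<omega>) * v k (W \<omega>))"
    by (rule mean_square_cong_AE)
  also have "\<dots> = ennreal (\<Sum>k<n. LINT \<omega>|M. (a k (B \<omega>) * v k (W \<omega>))\<^sup>2)"
    using prod by (intro uncorrelated_sum_mean_square) auto
  also have "\<dots> = ennreal (\<Sum>k<n. (LINT \<omega>|M. (a k (B \<omega>))\<^sup>2) * (r (Suc k) - r k))"
  proof (intro arg_cong[where f = ennreal] sum.cong refl)
    fix k assume "k \<in> {..<n}"
    then show "(LINT \<omega>|M. (a k (B \<omega>) * v k (W \<omega>))\<^sup>2) = (LINT \<omega>|M. (a k (B \<omega>))\<^sup>2) * (r (Suc k) - r k)"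
      using prod(2)[of k k] by (simp add: power2_eq_square)
  qed
  also have "\<dots> \<le> ennreal (\<Sum>k<n. \<delta> * (LINT \<omega>|M. (a k (B \<omega>))\<^sup>2))"
  proof (intro ennreal_leI sum_mono)
    fix k assume "k \<in> {..<n}"
    then have "(r (Suc k) - r k) * (LINT \<omega>|M. (a k (B \<omega>))\<^sup>2) \<le> \<delta> * (LINT \<omega>|M. (a k (B \<omega>))\<^sup>2)"
      using \<delta> by (intro mult_right_mono) auto
    then show "(LINT \<omega>|M. (a k (B \<omega>))\<^sup>2) * (r (Suc k) - r k) \<le> \<delta> * (LINT \<omega>|M. (a k (B \<omega>))\<^sup>2)"
      by (simp only: mult.commute)
  qed
  also have "\<dots> = ennreal \<delta> * (\<Sum>k<n. mean_square M (\<lambda>\<omega>. a k (B \<omega>)))"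
  proof -
    have "mean_square M (\<lambda>\<omega>. a k (B \<omega>)) = ennreal (LINT \<omega>|M. (a k (B \<omega>))\<^sup>2)" if "k < n" for k
      unfolding mean_square_def using a2[OF that] by (intro nn_integral_eq_integral) auto
    then have "(\<Sum>k<n. mean_square M (\<lambda>\<omega>. a k (B \<omega>))) = ennreal (\<Sum>k<n. LINT \<omega>|M. (a k (B \<omega>))\<^sup>2)"
      by (subst sum_ennreal[symmetric]) auto
    then show ?thesis
      by (simp add: sum_distrib_left[symmetric] ennreal_mult'' sum_nonneg)
  qed
  also have "\<dots> \<le> ennreal \<delta> * (\<Sum>k<n. 4 * G k)"
    using msa by (intro mult_left_mono sum_mono) auto
  also have "(\<Sum>k<n. 4 * G k) = 4 * (\<Sum>k<n. G k)" by (simp add: sum_distrib_left)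
  also have "ennreal \<delta> * (4 * (\<Sum>k<n. G k))
      \<le> ennreal \<delta> * (4 * (\<integral>\<^sup>+s\<in>{0<..T}. ennreal ((norm (g s))\<^sup>2) \<partial>lborel))"
    using Gsum by (intro mult_left_mono) auto
  finally show ?thesis .
qed

section \<open>Covariation of a Brownian motion with its own integral\<close>

text \<open>
  Young's inequality in the two forms used below. The free parameter \<open>\<eta>\<close> replaces the optimisation in
  the inequality of Cauchy and Schwarz, so that no square roots of extended reals appear.
\<close>

lemma abs_le_of_square:
  fixes x \<eta> :: real
  assumes "0 < \<eta>"
  shows "\<bar>x\<bar> \<le> \<eta> / 2 + x\<^sup>2 / (2 * \<eta>)"
proof -
  have "2 * \<eta> * \<bar>x\<bar> \<le> \<eta>\<^sup>2 + x\<^sup>2"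
    using zero_le_power2[of "\<bar>x\<bar> - \<eta>"] by (simp add: power2_diff mult_ac add_ac)
  then show ?thesis using assms by (simp add: field_simps power2_eq_square)
qed

lemma abs_mult_le_of_squares:
  fixes x y \<eta> :: real
  assumes "0 < \<eta>"
  shows "\<bar>x * y\<bar> \<le> x\<^sup>2 / (2 * \<eta>) + \<eta> / 2 * y\<^sup>2"
proof -
  have "2 * \<eta> * (\<bar>x\<bar> * \<bar>y\<bar>) \<le> x\<^sup>2 + \<eta>\<^sup>2 * y\<^sup>2"
    using zero_le_power2[of "\<bar>x\<bar> - \<eta> * \<bar>y\<bar>"] by (simp add: power2_diff power_mult_distrib mult_ac)
  then show ?thesis using assms by (simp add: field_simps power2_eq_square abs_mult)
qed

lemma nn_integral_abs_le:
  assumes M: "prob_space M" and [measurable]: "f \<in> borel_measurable M" and \<eta>: "0 < \<eta>"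
    and f: "mean_square M f \<le> ennreal K" and K: "0 \<le> K"
  shows "(\<integral>\<^sup>+\<omega>. ennreal \<bar>f \<omega>\<bar> \<partial>M) \<le> ennreal (\<eta> / 2 + K / (2 * \<eta>))"
proof -
  interpret prob_space M by fact
  have "(\<integral>\<^sup>+\<omega>. ennreal \<bar>f \<omega>\<bar> \<partial>M)
      \<le> (\<integral>\<^sup>+\<omega>. ennreal (\<eta> / 2) + ennreal (1 / (2 * \<eta>)) * ennreal ((f \<omega>)\<^sup>2) \<partial>M)"
    using ennreal_leI[OF abs_le_of_square[OF \<eta>]] \<eta>
    by (intro nn_integral_mono) (simp add: ennreal_plus[symmetric] ennreal_mult[symmetric] del: ennreal_plus)
  also have "\<dots> = ennreal (\<eta> / 2) + ennreal (1 / (2 * \<eta>)) * mean_square M f"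
    by (simp add: nn_integral_add nn_integral_cmult mean_square_def emeasure_space_1)
  also have "\<dots> \<le> ennreal (\<eta> / 2) + ennreal (1 / (2 * \<eta>)) * ennreal K"
    using f by (intro add_left_mono mult_left_mono) auto
  also have "\<dots> = ennreal (\<eta> / 2 + K / (2 * \<eta>))"
    using \<eta> K by (simp add: ennreal_mult[symmetric])
  finally show ?thesis .
qed

lemma nn_integral_abs_mult_le:
  assumes [measurable]: "f \<in> borel_measurable M" "g \<in> borel_measurable M" and \<eta>: "0 < \<eta>"
  shows "(\<integral>\<^sup>+\<omega>. ennreal \<bar>f \<omega> * g \<omega>\<bar> \<partial>M)
    \<le> ennreal (1 / (2 * \<eta>)) * mean_square M f + ennreal (\<eta> / 2) * mean_square M g"
proof -
  have "(\<integral>\<^sup>+\<omega>. ennreal \<bar>f \<omega> * g \<omega>\<bar> \<partial>M)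
      \<le> (\<integral>\<^sup>+\<omega>. ennreal (1 / (2 * \<eta>)) * ennreal ((f \<omega>)\<^sup>2) + ennreal (\<eta> / 2) * ennreal ((g \<omega>)\<^sup>2) \<partial>M)"
    using ennreal_leI[OF abs_mult_le_of_squares[OF \<eta>]] \<eta>
    by (intro nn_integral_mono) (simp add: ennreal_plus[symmetric] ennreal_mult[symmetric] del: ennreal_plus)
  then show ?thesis by (simp add: nn_integral_add nn_integral_cmult mean_square_def)
qed

lemma ennreal_sum_of_products:
  assumes "0 \<le> a" "0 \<le> b" "0 \<le> c" "0 \<le> d"
  shows "ennreal a * ennreal b + ennreal c * ennreal d = ennreal (a * b + c * d)"
  using assms by (simp add: ennreal_plus ennreal_mult)

text \<open>
  On each cell the increment of \<open>J\<close> is split into \<open>C k\<close> times the Brownian increment and a remainder \<open>R k\<close>.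
  The first parts form the sum treated in lemma \<open>bracket_of_step_integral\<close>. The second moments of the
  remainders add up to at most \<open>4 \<theta>\<close>, and those of the increments of \<open>W\<close> to at most \<open>T\<close>, so the
  remainders contribute \<open>2 \<theta> / \<eta> + \<eta> T / 2\<close>.
\<close>

lemma bracket_of_wiener_integral:
  fixes W :: "'w \<Rightarrow> real \<Rightarrow> real^'m" and C :: "nat \<Rightarrow> real^'m"
  assumes M: "prob_space M" and W: "std_brownian_motion T M W"
    and J: "wiener_integral T M g W J" and T: "0 \<le> T"
    and r: "0 \<le> r 0" "\<And>k. k < n \<Longrightarrow> r k \<le> r (Suc k)" "r n \<le> T"
    and \<delta>: "\<And>k. k < n \<Longrightarrow> r (Suc k) - r k \<le> \<delta>" and \<delta>0: "0 \<le> \<delta>"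
    and \<Gamma>: "\<And>k. k < n \<Longrightarrow> norm (C k) \<le> \<Gamma>"
    and [measurable]: "\<phi> \<in> borel_measurable borel"
    and \<phi>: "\<And>k u. k < n \<Longrightarrow> u \<in> {r k<..r (Suc k)} \<Longrightarrow> \<phi> u = C k"
    and \<theta>: "(\<integral>\<^sup>+s. ennreal ((norm (\<phi> s - g s))\<^sup>2) \<partial>lborel) \<le> ennreal \<theta>" "0 \<le> \<theta>"
    and \<eta>: "0 < \<eta>"
  shows "(\<integral>\<^sup>+\<omega>. ennreal \<bar>\<Sum>k<n. (J \<omega> (r (Suc k)) - J \<omega> (r k)) * (W \<omega> (r (Suc k)) - W \<omega> (r k)) $ j
      - C k $ j * (r (Suc k) - r k)\<bar> \<partial>M)
    \<le> ennreal (2 * \<theta> / \<eta> + \<eta> / 2 * T + (\<eta> / 2 + (\<Gamma> ^ 4 + 1) * \<delta> * T / \<eta>))"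
proof -
  let ?e = "\<lambda>a b. \<integral>\<^sup>+s\<in>{a<..b}. ennreal ((norm (\<phi> s - g s))\<^sup>2) \<partial>lborel"
  interpret prob_space M by fact
  have [measurable]: "g \<in> borel_measurable borel" using J by (auto simp: wiener_integral_def)
  have b: "r k \<in> {0..T}" if "k \<le> n" for k
    using monotone_grid_bounds[of n r k, OF r(2) that] r(1,3) by auto
  define D where "D k \<omega> = W \<omega> (r (Suc k)) - W \<omega> (r k)" for k \<omega>
  define R where "R k \<omega> = J \<omega> (r (Suc k)) - J \<omega> (r k) - C k \<bullet> D k \<omega>" for k \<omega>
  define Q where "Q \<omega> = (\<Sum>k<n. (C k \<bullet> D k \<omega>) * D k \<omega> $ j - C k $ j * (r (Suc k) - r k))" for \<omega>
  have Dj: "D k \<omega> $ j = axis j 1 \<bullet> D k \<omega>" for k \<omega>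
    unfolding cart_eq_inner_axis by (rule inner_commute)
  have Dm: "D k \<in> borel_measurable M" if "k < n" for k
    unfolding D_def using brownian_motion_measurable[OF W] b[of k] b[of "Suc k"] that
    by (intro borel_measurable_diff) auto
  have Djm: "(\<lambda>\<omega>. D k \<omega> $ j) \<in> borel_measurable M" if "k < n" for k
    unfolding Dj by (intro borel_measurable_inner borel_measurable_const Dm that)
  have Rm: "R k \<in> borel_measurable M" if "k < n" for k
    unfolding R_def using J b[of k] b[of "Suc k"] that
    by (intro borel_measurable_diff borel_measurable_inner borel_measurable_const Dm)
      (auto simp: wiener_integral_def)
  have Qm: "Q \<in> borel_measurable M"
    unfolding Q_def
    by (intro borel_measurable_sum borel_measurable_diff borel_measurable_times
        borel_measurable_inner borel_measurable_const Dm Djm) auto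
  have eq: "(\<Sum>k<n. (J \<omega> (r (Suc k)) - J \<omega> (r k)) * (W \<omega> (r (Suc k)) - W \<omega> (r k)) $ j
      - C k $ j * (r (Suc k) - r k)) = (\<Sum>k<n. R k \<omega> * D k \<omega> $ j) + Q \<omega>" for \<omega>
    unfolding Q_def R_def D_def[symmetric] sum.distrib[symmetric]
    by (intro sum.cong refl) (simp add: algebra_simps)
  have "(\<integral>\<^sup>+\<omega>. ennreal \<bar>(\<Sum>k<n. R k \<omega> * D k \<omega> $ j) + Q \<omega>\<bar> \<partial>M)
      \<le> (\<integral>\<^sup>+\<omega>. (\<Sum>k<n. ennreal \<bar>R k \<omega> * D k \<omega> $ j\<bar>) + ennreal \<bar>Q \<omega>\<bar> \<partial>M)"
  proof (rule nn_integral_mono)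
    fix \<omega>
    have "\<bar>(\<Sum>k<n. R k \<omega> * D k \<omega> $ j) + Q \<omega>\<bar> \<le> (\<Sum>k<n. \<bar>R k \<omega> * D k \<omega> $ j\<bar>) + \<bar>Q \<omega>\<bar>"
      using sum_abs[of "\<lambda>k. R k \<omega> * D k \<omega> $ j" "{..<n}"] by linarith
    from ennreal_leI[OF this]
    show "ennreal \<bar>(\<Sum>k<n. R k \<omega> * D k \<omega> $ j) + Q \<omega>\<bar>
        \<le> (\<Sum>k<n. ennreal \<bar>R k \<omega> * D k \<omega> $ j\<bar>) + ennreal \<bar>Q \<omega>\<bar>"
      by (simp add: ennreal_plus sum_nonneg)
  qed
  also have "\<dots> = (\<Sum>k<n. \<integral>\<^sup>+\<omega>. ennreal \<bar>R k \<omega> * D k \<omega> $ j\<bar> \<partial>M) + (\<integral>\<^sup>+\<omega>. ennreal \<bar>Q \<omega>\<bar> \<partial>M)"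
    using Rm Djm Qm
    by (subst nn_integral_add; (subst nn_integral_sum)?)
      (auto intro!: borel_measurable_sum measurable_compose[OF _ measurable_ennreal]
        borel_measurable_abs borel_measurable_times)
  also have "\<dots> \<le> ennreal (2 * \<theta> / \<eta> + \<eta> / 2 * T) + ennreal (\<eta> / 2 + (\<Gamma> ^ 4 + 1) * \<delta> * T / \<eta>)"
  proof (rule add_mono)
    have msR: "mean_square M (R k) \<le> 4 * ?e (r k) (r (Suc k))"
      if k: "k < n" for k
    proof -
      have "mean_square M (R k) \<le> 4 * (\<integral>\<^sup>+s\<in>{r k<..r (Suc k)}. ennreal ((norm (g s - C k))\<^sup>2) \<partial>lborel)"
        unfolding R_def D_def using b[of k] b[of "Suc k"] r(2)[OF k] k
        by (intro wiener_integral_increment_le[OF M W J]) auto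
      also have "(\<integral>\<^sup>+s\<in>{r k<..r (Suc k)}. ennreal ((norm (g s - C k))\<^sup>2) \<partial>lborel)
          = ?e (r k) (r (Suc k))"
        using \<phi>[OF k] by (intro nn_integral_cong) (auto simp: norm_minus_commute split: split_indicator)
      finally show ?thesis .
    qed
    have msD: "mean_square M (\<lambda>\<omega>. D k \<omega> $ j) = ennreal (r (Suc k) - r k)" if k: "k < n" for k
    proof -
      have "centered_normal M (\<lambda>\<omega>. axis j 1 \<bullet> (W \<omega> (r (Suc k)) - W \<omega> (r k)))
          ((norm (axis j 1 :: real^'m))\<^sup>2 * (r (Suc k) - r k))"
        using b[of k] b[of "Suc k"] r(2)[OF k] k by (intro brownian_increment_normal[OF M W]) auto
      from centered_normal_mean_square[OF this] show ?thesis
        unfolding Dj unfolding D_def by (simp only: norm_axis_1 power_one mult_1_left)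
    qed
    have "(\<Sum>k<n. \<integral>\<^sup>+\<omega>. ennreal \<bar>R k \<omega> * D k \<omega> $ j\<bar> \<partial>M)
        \<le> (\<Sum>k<n. ennreal (1 / (2 * \<eta>)) * (4 * ?e (r k) (r (Suc k)))
            + ennreal (\<eta> / 2) * ennreal (r (Suc k) - r k))"
    proof (rule sum_mono)
      fix k assume "k \<in> {..<n}"
      then have k: "k < n" by simp
      have "(\<integral>\<^sup>+\<omega>. ennreal \<bar>R k \<omega> * D k \<omega> $ j\<bar> \<partial>M)
          \<le> ennreal (1 / (2 * \<eta>)) * mean_square M (R k) + ennreal (\<eta> / 2) * mean_square M (\<lambda>\<omega>. D k \<omega> $ j)"
        by (rule nn_integral_abs_mult_le[OF Rm[OF k] Djm[OF k] \<eta>])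
      also have "\<dots> \<le> ennreal (1 / (2 * \<eta>)) * (4 * ?e (r k) (r (Suc k)))
            + ennreal (\<eta> / 2) * ennreal (r (Suc k) - r k)"
        unfolding msD[OF k] by (intro add_right_mono mult_left_mono msR[OF k]) auto
      finally show "(\<integral>\<^sup>+\<omega>. ennreal \<bar>R k \<omega> * D k \<omega> $ j\<bar> \<partial>M)
        \<le> ennreal (1 / (2 * \<eta>)) * (4 * ?e (r k) (r (Suc k)))
            + ennreal (\<eta> / 2) * ennreal (r (Suc k) - r k)" .
    qed
    also have "\<dots> = ennreal (1 / (2 * \<eta>)) * (4 * (\<Sum>k<n. ?e (r k) (r (Suc k))))
            + ennreal (\<eta> / 2) * ennreal (\<Sum>k<n. r (Suc k) - r k)"
    proof -
      have se: "(\<Sum>k<n. ennreal (r (Suc k) - r k)) = ennreal (\<Sum>k<n. r (Suc k) - r k)"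
        using r(2) by (intro sum_ennreal) auto
      show ?thesis unfolding sum.distrib sum_distrib_left[symmetric] se ..
    qed
    also have "(\<Sum>k<n. ?e (r k) (r (Suc k)))
        = ?e (r 0) (r n)"
    proof -
      have "(\<lambda>s. ennreal ((norm (\<phi> s - g s))\<^sup>2)) \<in> borel_measurable borel" by measurable
      from nn_integral_grid[of n r, OF r(2) this] show ?thesis .
    qed
    also have "(\<Sum>k<n. r (Suc k) - r k) = r n - r 0" by (rule sum_lessThan_telescope)
    also have "ennreal (1 / (2 * \<eta>)) * (4 * ?e (r 0) (r n))
          + ennreal (\<eta> / 2) * ennreal (r n - r 0)
        \<le> ennreal (1 / (2 * \<eta>)) * (4 * ennreal \<theta>) + ennreal (\<eta> / 2) * ennreal T"
    proof (intro add_mono mult_left_mono)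
      have "?e (r 0) (r n)
          \<le> (\<integral>\<^sup>+s. ennreal ((norm (\<phi> s - g s))\<^sup>2) \<partial>lborel)"
        by (intro nn_integral_mono) (auto split: split_indicator)
      then show "?e (r 0) (r n) \<le> ennreal \<theta>"
        using \<theta>(1) by (rule order_trans)
      show "ennreal (r n - r 0) \<le> ennreal T" using r by (intro ennreal_leI) auto
    qed auto
    also have "\<dots> = ennreal (1 / (2 * \<eta>) * (4 * \<theta>) + \<eta> / 2 * T)"
    proof -
      have "4 * ennreal \<theta> = ennreal (4 * \<theta>)" using \<theta>(2) by (simp add: ennreal_mult)
      then show ?thesis using \<eta> \<theta>(2) T by (simp only:) (rule ennreal_sum_of_products; simp)
    qed
    also have "1 / (2 * \<eta>) * (4 * \<theta>) + \<eta> / 2 * T = 2 * \<theta> / \<eta> + \<eta> / 2 * T"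
      by simp
    finally show "(\<Sum>k<n. \<integral>\<^sup>+\<omega>. ennreal \<bar>R k \<omega> * D k \<omega> $ j\<bar> \<partial>M) \<le> ennreal (2 * \<theta> / \<eta> + \<eta> / 2 * T)" .
    have "mean_square M Q \<le> ennreal (2 * (\<Gamma> ^ 4 + 1) * \<delta> * T)"
      unfolding Q_def D_def by (rule bracket_of_step_integral[OF M W r \<delta> \<delta>0 \<Gamma>])
    from nn_integral_abs_le[OF M Qm \<eta> this]
    have "(\<integral>\<^sup>+\<omega>. ennreal \<bar>Q \<omega>\<bar> \<partial>M) \<le> ennreal (\<eta> / 2 + 2 * (\<Gamma> ^ 4 + 1) * \<delta> * T / (2 * \<eta>))"
      using \<delta>0 T by simp
    moreover have "2 * (\<Gamma> ^ 4 + 1) * \<delta> * T / (2 * \<eta>) = (\<Gamma> ^ 4 + 1) * \<delta> * T / \<eta>"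
      using \<eta> by (simp add: field_simps)
    ultimately show "(\<integral>\<^sup>+\<omega>. ennreal \<bar>Q \<omega>\<bar> \<partial>M) \<le> ennreal (\<eta> / 2 + (\<Gamma> ^ 4 + 1) * \<delta> * T / \<eta>)"
      by (simp only:)
  qed
  also have "\<dots> = ennreal (2 * \<theta> / \<eta> + \<eta> / 2 * T + (\<eta> / 2 + (\<Gamma> ^ 4 + 1) * \<delta> * T / \<eta>))"
    using \<eta> \<theta>(2) \<delta>0 T by (intro ennreal_plus[symmetric] add_nonneg_nonneg) auto
  finally show ?thesis unfolding eq .
qed

text \<open>
  The sum is the integral of the component \<open>j\<close> of \<open>\<phi>\<close>, so only the mean distance of \<open>\<phi>\<close> and \<open>g\<close> has to be
  bounded by their mean square distance.
\<close>

lemma integral_near_step_sum: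
  fixes C :: "nat \<Rightarrow> real^'m"
  assumes r: "0 \<le> r 0" "\<And>k. k < n \<Longrightarrow> r k \<le> r (Suc k)" "r n \<le> T"
    and [measurable]: "\<phi> \<in> borel_measurable borel" "g \<in> borel_measurable borel"
    and \<phi>: "\<And>k u. k < n \<Longrightarrow> u \<in> {r k<..r (Suc k)} \<Longrightarrow> \<phi> u = C k"
    and \<theta>: "(\<integral>\<^sup>+s. ennreal ((norm (\<phi> s - g s))\<^sup>2) \<partial>lborel) \<le> ennreal \<theta>" "0 \<le> \<theta>"
    and \<eta>: "0 < \<eta>" and T: "0 \<le> T"
  shows "\<bar>(\<Sum>k<n. C k $ j * (r (Suc k) - r k)) - (LINT u:{r 0<..r n}|lborel. g u $ j)\<bar>
    \<le> \<eta> / 2 * T + \<theta> / (2 * \<eta>)"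
proof -
  have comp: "(\<lambda>u. f u $ j) \<in> borel_measurable borel"
    if "f \<in> borel_measurable borel" for f :: "real \<Rightarrow> real^'m"
    unfolding cart_eq_inner_axis using that by (intro borel_measurable_inner borel_measurable_const)
  note [measurable] = comp[OF assms(4)] comp[OF assms(5)]
  let ?A = "{r 0<..r n}"
  define d where "d u = indicator ?A u * (\<phi> u $ j - g u $ j)" for u
  have [measurable]: "d \<in> borel_measurable borel" unfolding d_def by measurable
  have rn: "r 0 \<le> r n" using monotone_grid_bounds(1)[of n r n] r(2) by auto
  have dint: "(\<integral>\<^sup>+u. ennreal \<bar>d u\<bar> \<partial>lborel) \<le> ennreal (\<eta> / 2 * T + \<theta> / (2 * \<eta>))"
  proof -
    have "(\<integral>\<^sup>+u. ennreal \<bar>d u\<bar> \<partial>lborel)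
        \<le> (\<integral>\<^sup>+u. ennreal (\<eta> / 2) * indicator ?A u
            + ennreal (1 / (2 * \<eta>)) * ennreal ((norm (\<phi> u - g u))\<^sup>2) \<partial>lborel)"
    proof (rule nn_integral_mono)
      fix u
      have "\<bar>\<phi> u $ j - g u $ j\<bar> \<le> norm (\<phi> u - g u)"
        using Finite_Cartesian_Product.norm_nth_le[of "\<phi> u - g u" j] by simp
      also have "\<dots> \<le> \<eta> / 2 + (norm (\<phi> u - g u))\<^sup>2 / (2 * \<eta>)"
        using abs_le_of_square[OF \<eta>, of "norm (\<phi> u - g u)"] by simp
      finally have "ennreal \<bar>\<phi> u $ j - g u $ j\<bar> \<le> ennreal (\<eta> / 2) + ennreal (1 / (2 * \<eta>)) * ennreal ((norm (\<phi> u - g u))\<^sup>2)"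
        using \<eta> by (simp add: ennreal_plus[symmetric] ennreal_mult[symmetric] ennreal_leI del: ennreal_plus)
      then show "ennreal \<bar>d u\<bar> \<le> ennreal (\<eta> / 2) * indicator ?A u
            + ennreal (1 / (2 * \<eta>)) * ennreal ((norm (\<phi> u - g u))\<^sup>2)"
        by (auto simp: d_def split: split_indicator)
    qed
    also have "\<dots> = ennreal (\<eta> / 2) * ennreal (r n - r 0)
        + ennreal (1 / (2 * \<eta>)) * (\<integral>\<^sup>+u. ennreal ((norm (\<phi> u - g u))\<^sup>2) \<partial>lborel)"
      using rn by (simp add: nn_integral_add nn_integral_cmult)
    also have "\<dots> \<le> ennreal (\<eta> / 2) * ennreal T + ennreal (1 / (2 * \<eta>)) * ennreal \<theta>"
      using r \<theta>(1) by (intro add_mono mult_left_mono ennreal_leI) auto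
    also have "\<dots> = ennreal (\<eta> / 2 * T + \<theta> / (2 * \<eta>))"
      using \<eta> T \<theta>(2) by (simp add: ennreal_plus ennreal_mult[symmetric])
    finally show ?thesis .
  qed
  have di: "integrable lborel d"
    by (rule integrableI_bounded) (use dint in \<open>auto intro: le_less_trans\<close>)
  have "(\<Sum>k<n. indicator {r k<..r (Suc k)} u * C k $ j) = indicator ?A u * \<phi> u $ j" for u
  proof -
    have "(\<Sum>k<n. indicator {r k<..r (Suc k)} u * C k $ j) = (\<Sum>k<n. indicator {r k<..r (Suc k)} u * \<phi> u $ j)"
      using \<phi> by (intro sum.cong refl) (auto split: split_indicator)
    also have "\<dots> = (\<Sum>k<n. indicator {r k<..r (Suc k)} u) * \<phi> u $ j" by (simp add: sum_distrib_right)
    also have "(\<Sum>k<n. indicator {r k<..r (Suc k)} u) = (indicator ?A u :: real)"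
      by (rule sum_indicator_grid[of n r, OF r(2)])
    finally show ?thesis .
  qed
  moreover have "has_bochner_integral lborel (\<lambda>u. \<Sum>k<n. indicator {r k<..r (Suc k)} u * C k $ j)
      (\<Sum>k<n. (r (Suc k) - r k) * C k $ j)"
    using r(2)
    by (intro has_bochner_integral_sum has_bochner_integral_mult_left) (auto simp: has_bochner_integral_iff)
  ultimately have "has_bochner_integral lborel (\<lambda>u. indicator ?A u * \<phi> u $ j) (\<Sum>k<n. C k $ j * (r (Suc k) - r k))"
    by (simp add: mult.commute)
  from has_bochner_integral_diff[OF this has_bochner_integral_integrable[OF di]]
  have "has_bochner_integral lborel (\<lambda>u. indicator ?A u * \<phi> u $ j - d u)
      ((\<Sum>k<n. C k $ j * (r (Suc k) - r k)) - (LINT u|lborel. d u))" .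
  moreover have "indicator ?A u * \<phi> u $ j - d u = indicator ?A u *\<^sub>R g u $ j" for u
    by (simp add: d_def algebra_simps)
  ultimately have "has_bochner_integral lborel (\<lambda>u. indicator ?A u *\<^sub>R g u $ j)
      ((\<Sum>k<n. C k $ j * (r (Suc k) - r k)) - (LINT u|lborel. d u))"
    by (simp only:)
  then have "(LINT u:?A|lborel. g u $ j) = (\<Sum>k<n. C k $ j * (r (Suc k) - r k)) - (LINT u|lborel. d u)"
    unfolding set_lebesgue_integral_def by (rule has_bochner_integral_integral_eq)
  moreover have "\<bar>LINT u|lborel. d u\<bar> \<le> \<eta> / 2 * T + \<theta> / (2 * \<eta>)"
  proof -
    have "ennreal \<bar>LINT u|lborel. d u\<bar> \<le> (\<integral>\<^sup>+u. ennreal \<bar>d u\<bar> \<partial>lborel)"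
      using integral_norm_bound_ennreal[OF di] by simp
    also note dint
    finally show ?thesis using \<eta> \<theta>(2) T by (subst (asm) ennreal_le_iff) auto
  qed
  ultimately show ?thesis by simp
qed

section \<open>Partitions along which the covariation converges\<close>

text \<open>
  Every cell is divided into equally many short pieces, cell after cell. A cell of the refinement stays
  inside one original cell, so a step function on the original partition is constant on it.
\<close>

lemma grid_refinement:
  fixes r :: "nat \<Rightarrow> real"
  assumes "\<And>k. k < n \<Longrightarrow> r k \<le> r (Suc k)" and \<delta>: "0 < \<delta>"
  shows "\<exists>N s. s 0 = r 0 \<and> s N = r n \<and> (\<forall>k<N. s k \<le> s (Suc k) \<and> s (Suc k) - s k \<le> \<delta> \<and>
    (\<exists>l<n. r l \<le> s k \<and> s (Suc k) \<le> r (Suc l)))"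
  using assms(1)
proof (induction n)
  case 0
  show ?case by (intro exI[of _ 0] exI[of _ "\<lambda>_. r 0"]) auto
next
  case (Suc n)
  then obtain N s where s: "s 0 = r 0" "s N = r n"
    and sk: "\<And>k. k < N \<Longrightarrow> s k \<le> s (Suc k) \<and> s (Suc k) - s k \<le> \<delta> \<and>
      (\<exists>l<n. r l \<le> s k \<and> s (Suc k) \<le> r (Suc l))"
    by (auto simp: less_Suc_eq)
  define D where "D = r (Suc n) - r n"
  have D: "0 \<le> D" using Suc.prems[of n] by (simp add: D_def)
  obtain P0 :: nat where P0: "D / \<delta> < P0" using reals_Archimedean2 by blast
  define P where "P = Suc P0"
  have P: "0 < P" "D / P \<le> \<delta>"
  proof -
    have "D / \<delta> \<le> P" using P0 by (simp add: P_def)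
    then show "D / P \<le> \<delta>" using \<delta> by (simp add: P_def field_simps)
  qed (simp add: P_def)
  define s' where "s' k = (if k \<le> N then s k else r n + real (k - N) * (D / P))" for k
  have s'N: "s' k = r n + real (k - N) * (D / P)" if "N \<le> k" for k
    using that s by (auto simp: s'_def)
  have "s' k \<le> s' (Suc k) \<and> s' (Suc k) - s' k \<le> \<delta> \<and>
      (\<exists>l<Suc n. r l \<le> s' k \<and> s' (Suc k) \<le> r (Suc l))" if k: "k < N + P" for k
  proof (cases "k < N")
    case True
    then have "s' k = s k" "s' (Suc k) = s (Suc k)" by (auto simp: s'_def)
    then show ?thesis using sk[OF True] by (auto simp: less_Suc_eq)
  next
    case False
    define i where "i = k - N"
    have i: "i < P" using False k by (auto simp: i_def)
    have e: "s' k = r n + real i * (D / P)" "s' (Suc k) = r n + real (Suc i) * (D / P)"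
      using False s'N[of k] s'N[of "Suc k"] by (auto simp: i_def Suc_diff_le)
    have DP: "0 \<le> D / P" using D by simp
    have "real (Suc i) * (D / P) \<le> real P * (D / P)" using i DP by (intro mult_right_mono) auto
    also have "\<dots> = D" using P by simp
    finally have "s' (Suc k) \<le> r (Suc n)" unfolding e by (simp add: D_def)
    moreover have "r n \<le> s' k"
      unfolding e using mult_nonneg_nonneg[OF of_nat_0_le_iff DP, of i] by simp
    moreover have "s' (Suc k) - s' k = D / P" unfolding e by (simp add: distrib_right add_divide_distrib)
    ultimately show ?thesis using DP P(2) by (auto intro!: exI[of _ n])
  qed
  moreover have "s' 0 = r 0" using s by (simp add: s'_def)
  moreover have "s' (N + P) = r (Suc n)" using s'N[of "N + P"] P by (simp add: D_def)
  ultimately show ?case by blast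
qed

text \<open>
  The partition refines one whose step function is close to \<open>g1\<close>. The order of choices matters: the
  fourth moments of the step integral grow with the size of the step function, so the mesh is fixed
  only after it.
\<close>

lemma bracket_approximation:
  fixes B :: "'w \<Rightarrow> real \<Rightarrow> real^'d" and W :: "'w \<Rightarrow> real \<Rightarrow> real^'n"
  assumes M: "prob_space M" and B: "std_brownian_motion T M B" and W: "std_brownian_motion T M W"
    and ind: "indep_elements M (path_space T) B (path_space T) W"
    and I: "wiener_integral T M g0 B I" and J: "wiener_integral T M g1 W J"
    and t: "0 < t" "t \<le> T" and \<epsilon>: "0 < \<epsilon>"
  shows "\<exists>N s. s 0 = 0 \<and> s N = t \<and> (\<forall>k<N. s k \<le> s (Suc k) \<and> s (Suc k) - s k \<le> \<epsilon>) \<and>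
    (\<integral>\<^sup>+\<omega>. ennreal \<bar>(\<Sum>k<N. ((I \<omega> (s (Suc k)) + J \<omega> (s (Suc k))) - (I \<omega> (s k) + J \<omega> (s k)))
        * (W \<omega> (s (Suc k)) $ j - W \<omega> (s k) $ j)) - (LINT u:{0<..t}|lborel. g1 u $ j)\<bar> \<partial>M) \<le> ennreal \<epsilon>"
proof -
  interpret prob_space M by fact
  have T: "0 < T" "0 \<le> T" using t by auto
  have g1m[measurable]: "g1 \<in> borel_measurable borel" using J by (auto simp: wiener_integral_def)
  obtain n r c where p: "\<And>m. partition_of T (n m) (r m)"
    and lim: "(\<lambda>m. \<integral>\<^sup>+s. ennreal ((norm (vector_step (n m) (r m) (c m) s - g1 s))\<^sup>2) \<partial>lborel) \<longlonglongrightarrow> 0"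
    using J unfolding wiener_integral_def by blast
  let ?e = "\<lambda>m. \<integral>\<^sup>+s. ennreal ((norm (vector_step (n m) (r m) (c m) s - g1 s))\<^sup>2) \<partial>lborel"
  let ?G = "4 * (\<integral>\<^sup>+s\<in>{0<..T}. ennreal ((norm (g0 s))\<^sup>2) \<partial>lborel)"
  have "?G < \<infinity>"
    using wiener_integrand_square_integrable[OF M B I T(2)] by (simp add: ennreal_mult_less_top)
  then obtain G0 where G0: "0 \<le> G0" "?G = ennreal G0"
    unfolding infinity_ennreal_def less_top_ennreal by blast
  \<comment> \<open>The total error is at most \<open>\<eta> (T + 1) + 5 \<theta> / (2 \<eta>) + \<delta> K / \<eta>\<close>; with these parameters the
    three terms are at most \<open>\<epsilon> / 3\<close>, \<open>5 \<epsilon> / 18\<close> and \<open>\<epsilon> / 3\<close>.\<close>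
  define \<eta> where "\<eta> = \<epsilon> / (3 * (T + 1))"
  have \<eta>: "0 < \<eta>" using \<epsilon> T by (simp add: \<eta>_def)
  define \<theta> where "\<theta> = \<eta> * \<epsilon> / 9"
  have \<theta>: "0 < \<theta>" using \<eta> \<epsilon> by (simp add: \<theta>_def)
  have "eventually (\<lambda>m. (?e m) < ennreal \<theta>)
      sequentially"
    using \<theta> by (intro order_tendstoD(2)[OF lim]) simp
  then obtain m where m: "(?e m) < ennreal \<theta>"
    by (auto simp: eventually_sequentially)
  define \<Gamma> where "\<Gamma> = (\<Sum>k<n m. norm (c m k))"
  define K where "K = (\<Gamma> ^ 4 + 1) * T + G0 + 1"
  have K: "0 < K" unfolding K_def using T G0 by (intro add_nonneg_pos add_nonneg_nonneg mult_nonneg_nonneg) auto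
  define \<delta> where "\<delta> = min \<epsilon> (\<eta> * \<epsilon> / (3 * K))"
  have \<delta>: "0 < \<delta>" using \<epsilon> \<eta> K by (simp add: \<delta>_def)
  have mono: "\<And>k. k < n m \<Longrightarrow> r m k \<le> r m (Suc k)" "r m 0 = 0" "r m (n m) = T"
    using p[of m] by (auto simp: partition_of_def)
  have "min t (r m k) \<le> min t (r m (Suc k))" if "k < n m" for k
    using mono(1)[OF that] by (intro min.mono) auto
  from grid_refinement[of "n m" "\<lambda>k. min t (r m k)" \<delta>, OF this \<delta>]
  obtain N s where s0: "s 0 = min t (r m 0)" "s N = min t (r m (n m))"
    and sk: "\<And>k. k < N \<Longrightarrow> s k \<le> s (Suc k) \<and> s (Suc k) - s k \<le> \<delta> \<and>
      (\<exists>l<n m. min t (r m l) \<le> s k \<and> s (Suc k) \<le> min t (r m (Suc l)))"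
    by blast
  have s: "s 0 = 0" "s N = t" using s0 mono t by auto
  obtain l where l: "\<And>k. k < N \<Longrightarrow> l k < n m"
    "\<And>k. k < N \<Longrightarrow> min t (r m (l k)) \<le> s k" "\<And>k. k < N \<Longrightarrow> s (Suc k) \<le> min t (r m (Suc (l k)))"
    using sk by metis
  define C where "C k = c m (l k)" for k
  define \<phi> where "\<phi> = vector_step (n m) (r m) (c m)"
  have \<phi>m: "\<phi> \<in> borel_measurable borel" unfolding \<phi>_def by measurable
  have \<phi>C: "\<phi> u = C k" if "k < N" "u \<in> {s k<..s (Suc k)}" for k u
    unfolding \<phi>_def C_def
  proof (rule vector_step_eq[of "n m" "r m" "l k", OF mono(1) l(1)[OF that(1)]])
    show "u \<in> {r m (l k)<..r m (Suc (l k))}" using l(2,3)[OF that(1)] that(2) by auto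
  qed
  have \<Gamma>: "norm (C k) \<le> \<Gamma>" if "k < N" for k
    unfolding \<Gamma>_def C_def using l(1)[OF that] by (intro member_le_sum) auto
  have grid: "0 \<le> s 0" "\<And>k. k < N \<Longrightarrow> s k \<le> s (Suc k)" "s N \<le> T"
    using s sk t by auto
  have mesh: "\<And>k. k < N \<Longrightarrow> s (Suc k) - s k \<le> \<delta>" using sk by auto
  have \<theta>': "(\<integral>\<^sup>+s. ennreal ((norm (\<phi> s - g1 s))\<^sup>2) \<partial>lborel) \<le> ennreal \<theta>"
    unfolding \<phi>_def using m by (rule less_imp_le)
  define w where "w k \<omega> = (W \<omega> (s (Suc k)) - W \<omega> (s k)) $ j" for k \<omega>
  define U where "U \<omega> = (\<Sum>k<N. (J \<omega> (s (Suc k)) - J \<omega> (s k)) * w k \<omega> - C k $ j * (s (Suc k) - s k))" for \<omega>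
  define V where "V \<omega> = (\<Sum>k<N. (I \<omega> (s (Suc k)) - I \<omega> (s k)) * w k \<omega>)" for \<omega>
  define d where "d = (\<Sum>k<N. C k $ j * (s (Suc k) - s k)) - (LINT u:{s 0<..s N}|lborel. g1 u $ j)"
  have b: "s k \<in> {0..T}" if "k \<le> N" for k
    using monotone_grid_bounds[of N s k, OF grid(2) that] grid(1,3) by auto
  have wm: "w k \<in> borel_measurable M" if "k < N" for k
    unfolding w_def cart_eq_inner_axis using brownian_motion_measurable[OF W] b[of k] b[of "Suc k"] that
    by (intro borel_measurable_inner borel_measurable_diff borel_measurable_const) auto
  have IJm: "(\<lambda>\<omega>. I \<omega> (s k)) \<in> borel_measurable M" "(\<lambda>\<omega>. J \<omega> (s k)) \<in> borel_measurable M" if "k \<le> N" for k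
    using I J b[OF that] by (auto simp: wiener_integral_def)
  have [measurable]: "U \<in> borel_measurable M" "V \<in> borel_measurable M"
    unfolding U_def V_def
    by (intro borel_measurable_sum borel_measurable_diff borel_measurable_times borel_measurable_const wm IJm; simp)+
  have U: "(\<integral>\<^sup>+\<omega>. ennreal \<bar>U \<omega>\<bar> \<partial>M)
      \<le> ennreal (2 * \<theta> / \<eta> + \<eta> / 2 * T + (\<eta> / 2 + (\<Gamma> ^ 4 + 1) * \<delta> * T / \<eta>))"
    unfolding U_def w_def using \<delta> \<theta>
    by (intro bracket_of_wiener_integral[OF M W J T(2) grid mesh _ \<Gamma> \<phi>m \<phi>C \<theta>' _ \<eta>]) auto
  have "mean_square M V \<le> ennreal (\<delta> * G0)"
    using bracket_of_independent_integral[OF M B W ind I T(2) grid mesh, of j] \<delta> G0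
    unfolding V_def w_def by (simp add: ennreal_mult)
  then have V: "(\<integral>\<^sup>+\<omega>. ennreal \<bar>V \<omega>\<bar> \<partial>M) \<le> ennreal (\<eta> / 2 + \<delta> * G0 / (2 * \<eta>))"
    using \<delta> G0 by (intro nn_integral_abs_le[OF M _ \<eta>]) auto
  have d: "\<bar>d\<bar> \<le> \<eta> / 2 * T + \<theta> / (2 * \<eta>)"
    unfolding d_def using \<theta>
    by (intro integral_near_step_sum[OF grid \<phi>m g1m \<phi>C \<theta>' _ \<eta> T(2)]) auto
  have eq: "(\<Sum>k<N. ((I \<omega> (s (Suc k)) + J \<omega> (s (Suc k))) - (I \<omega> (s k) + J \<omega> (s k)))
        * (W \<omega> (s (Suc k)) $ j - W \<omega> (s k) $ j)) - (LINT u:{0<..t}|lborel. g1 u $ j) = U \<omega> + V \<omega> + d" for \<omega>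
  proof -
    have "(\<Sum>k<N. ((I \<omega> (s (Suc k)) + J \<omega> (s (Suc k))) - (I \<omega> (s k) + J \<omega> (s k)))
        * (W \<omega> (s (Suc k)) $ j - W \<omega> (s k) $ j))
      = (\<Sum>k<N. ((J \<omega> (s (Suc k)) - J \<omega> (s k)) * w k \<omega> - C k $ j * (s (Suc k) - s k))
        + (I \<omega> (s (Suc k)) - I \<omega> (s k)) * w k \<omega> + C k $ j * (s (Suc k) - s k))"
      by (intro sum.cong refl) (simp add: w_def algebra_simps)
    then show ?thesis unfolding U_def V_def d_def sum.distrib s by (simp only: add_diff_eq)
  qed
  have "(\<integral>\<^sup>+\<omega>. ennreal \<bar>U \<omega> + V \<omega> + d\<bar> \<partial>M)
      \<le> (\<integral>\<^sup>+\<omega>. ennreal \<bar>U \<omega>\<bar> + ennreal \<bar>V \<omega>\<bar> + ennreal \<bar>d\<bar> \<partial>M)"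
  proof (rule nn_integral_mono)
    fix \<omega>
    have "\<bar>U \<omega> + V \<omega> + d\<bar> \<le> \<bar>U \<omega>\<bar> + \<bar>V \<omega>\<bar> + \<bar>d\<bar>" by linarith
    from ennreal_leI[OF this] show "ennreal \<bar>U \<omega> + V \<omega> + d\<bar> \<le> ennreal \<bar>U \<omega>\<bar> + ennreal \<bar>V \<omega>\<bar> + ennreal \<bar>d\<bar>"
      by (simp add: ennreal_plus)
  qed
  also have "\<dots> = (\<integral>\<^sup>+\<omega>. ennreal \<bar>U \<omega>\<bar> \<partial>M) + (\<integral>\<^sup>+\<omega>. ennreal \<bar>V \<omega>\<bar> \<partial>M) + ennreal \<bar>d\<bar>"
    by (simp add: nn_integral_add emeasure_space_1)
  also have "\<dots> \<le> ennreal (2 * \<theta> / \<eta> + \<eta> / 2 * T + (\<eta> / 2 + (\<Gamma> ^ 4 + 1) * \<delta> * T / \<eta>))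
      + ennreal (\<eta> / 2 + \<delta> * G0 / (2 * \<eta>)) + ennreal (\<eta> / 2 * T + \<theta> / (2 * \<eta>))"
    using d by (intro add_mono U V ennreal_leI) auto
  also have "\<dots> = ennreal ((2 * \<theta> / \<eta> + \<eta> / 2 * T + (\<eta> / 2 + (\<Gamma> ^ 4 + 1) * \<delta> * T / \<eta>))
      + (\<eta> / 2 + \<delta> * G0 / (2 * \<eta>)) + (\<eta> / 2 * T + \<theta> / (2 * \<eta>)))" (is "_ = ennreal ?E")
  proof -
    have "ennreal x + ennreal y + ennreal z = ennreal (x + y + z)" if "0 \<le> x" "0 \<le> y" "0 \<le> z" for x y z
      using that by (simp add: ennreal_plus)
    then show ?thesis
      using \<eta> \<theta> \<delta> T G0 by (simp only: add_nonneg_nonneg zero_le_even_power divide_nonneg_nonneg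
        mult_nonneg_nonneg less_imp_le even_numeral zero_le_numeral zero_le_one)
  qed
  also have "\<dots> \<le> ennreal \<epsilon>"
  proof (rule ennreal_leI)
    have a: "\<theta> / \<eta> = \<epsilon> / 9" using \<eta> by (simp add: \<theta>_def)
    have b: "\<eta> * (T + 1) = \<epsilon> / 3" using T by (simp add: \<eta>_def field_simps)
    have "\<delta> * K / \<eta> \<le> \<eta> * \<epsilon> / (3 * K) * K / \<eta>"
      using \<eta> K by (intro divide_right_mono mult_right_mono) (auto simp: \<delta>_def)
    also have "\<dots> = \<epsilon> / 3" using \<eta> K by (simp add: field_simps)
    finally have c: "\<delta> * K / \<eta> \<le> \<epsilon> / 3" .
    have "(\<Gamma> ^ 4 + 1) * \<delta> * T / \<eta> + \<delta> * G0 / (2 * \<eta>) \<le> \<delta> * K / \<eta>"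
    proof -
      have "\<delta> * K / \<eta> - ((\<Gamma> ^ 4 + 1) * \<delta> * T / \<eta> + \<delta> * G0 / (2 * \<eta>)) = \<delta> * (G0 / 2 + 1) / \<eta>"
        using \<eta> by (simp add: K_def field_simps)
      moreover have "0 \<le> \<delta> * (G0 / 2 + 1) / \<eta>" using \<delta> \<eta> G0 by simp
      ultimately show ?thesis by linarith
    qed
    moreover have "?E
      = \<eta> * (T + 1) + 5 / 2 * (\<theta> / \<eta>) + ((\<Gamma> ^ 4 + 1) * \<delta> * T / \<eta> + \<delta> * G0 / (2 * \<eta>))"
      by (simp add: field_simps)
    ultimately show "?E \<le> \<epsilon>"
      using a b c \<epsilon> by linarith
  qed
  finally have "(\<integral>\<^sup>+\<omega>. ennreal \<bar>U \<omega> + V \<omega> + d\<bar> \<partial>M) \<le> ennreal \<epsilon>" .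
  moreover have "\<forall>k<N. s k \<le> s (Suc k) \<and> s (Suc k) - s k \<le> \<epsilon>"
    using grid(2) mesh by (fastforce simp: \<delta>_def)
  ultimately show ?thesis
    unfolding eq[symmetric] using s by blast
qed

section \<open>Finite variation and realised covariation\<close>

text \<open>
  The realised covariation of two paths along a grid.
\<close>

definition bracket :: "nat \<Rightarrow> (nat \<Rightarrow> real) \<Rightarrow> (real \<Rightarrow> real) \<Rightarrow> (real \<Rightarrow> real) \<Rightarrow> real" where
  "bracket N s u v = (\<Sum>k<N. (u (s (Suc k)) - u (s k)) * (v (s (Suc k)) - v (s k)))"

lemma bracket_add_left: "bracket N s (\<lambda>t. u t + u' t) v = bracket N s u v + bracket N s u' v"
  by (simp add: bracket_def sum.distrib[symmetric] algebra_simps)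

lemma bracket_commute: "bracket N s u v = bracket N s v u"
  by (simp add: bracket_def mult.commute)

lemma bracket_add_right: "bracket N s u (\<lambda>t. v t + v' t) = bracket N s u v + bracket N s u v'"
  by (simp only: bracket_commute[of N s u] bracket_add_left)

definition grid_in :: "real \<Rightarrow> nat \<Rightarrow> (nat \<Rightarrow> real) \<Rightarrow> bool" where
  "grid_in T N s \<longleftrightarrow> 0 \<le> s 0 \<and> (\<forall>k<N. s k \<le> s (Suc k)) \<and> s N \<le> T"

lemma grid_inD:
  assumes "grid_in T N s" "k \<le> N"
  shows "s k \<in> {0..T}"
  using monotone_grid_bounds[of N s k] assms unfolding grid_in_def by auto

lemma bracket_cong:
  assumes "grid_in T N s" "\<And>t. t \<in> {0..T} \<Longrightarrow> u t = u' t" "\<And>t. t \<in> {0..T} \<Longrightarrow> v t = v' t"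
  shows "bracket N s u v = bracket N s u' v'"
  unfolding bracket_def using assms grid_inD[OF assms(1)] by (intro sum.cong refl) auto

definition finite_variation :: "real \<Rightarrow> (real \<Rightarrow> real) \<Rightarrow> bool" where
  "finite_variation T V \<longleftrightarrow>
     (\<exists>L. \<forall>N s. grid_in T N s \<longrightarrow> (\<Sum>k<N. \<bar>V (s (Suc k)) - V (s k)\<bar>) \<le> L)"

text \<open>
  The increment over a cell is at most the integral of \<open>norm f\<close> over it, and the cells are disjoint.
\<close>

lemma finite_variation_integral:
  fixes f :: "real \<Rightarrow> real^'m"
  assumes f: "set_integrable lborel {0..T} f"
  shows "finite_variation T (\<lambda>t. a + (LINT s:{0..t}|lborel. f s) $ i)"
  unfolding finite_variation_def
proof (intro exI allI impI)
  fix N s assume g: "grid_in T N s"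
  let ?V = "\<lambda>t. a + (LINT s:{0..t}|lborel. f s) $ i"
  have sub: "set_integrable lborel A f" if "A \<subseteq> {0..T}" "A \<in> sets borel" for A
    using set_integrable_subset[OF f, of A] that by simp
  have nsub: "set_integrable lborel A (\<lambda>s. norm (f s))" if "A \<subseteq> {0..T}" "A \<in> sets borel" for A
    using set_integrable_norm[OF sub[OF that]] .
  have b: "s k \<in> {0..T}" if "k \<le> N" for k by (rule grid_inD[OF g that])
  have mono: "\<And>k. k < N \<Longrightarrow> s k \<le> s (Suc k)" using g by (simp add: grid_in_def)
  have inc: "\<bar>?V (s (Suc k)) - ?V (s k)\<bar>
      \<le> (LINT u:{s k<..s (Suc k)}|lborel. norm (f u))" if k: "k < N" for k
  proof -
    have sk: "0 \<le> s k" "s k \<le> s (Suc k)" "s (Suc k) \<le> T"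
      using b[of k] b[of "Suc k"] mono[OF k] k by auto
    have "{0..s (Suc k)} = {0..s k} \<union> {s k<..s (Suc k)}" using sk by auto
    then have "(LINT s:{0..s (Suc k)}|lborel. f s)
        = (LINT s:{0..s k}|lborel. f s) + (LINT s:{s k<..s (Suc k)}|lborel. f s)"
      using sk by (simp only:) (intro set_integral_Un sub; auto)
    then have "\<bar>?V (s (Suc k)) - ?V (s k)\<bar>
        = \<bar>(LINT s:{s k<..s (Suc k)}|lborel. f s) $ i\<bar>" by simp
    also have "\<dots> \<le> norm (LINT s:{s k<..s (Suc k)}|lborel. f s)"
      by (rule component_le_norm_cart)
    also have "\<dots> \<le> (LINT u:{s k<..s (Suc k)}|lborel. norm (f u))"
      using sk by (intro set_integral_norm_bound sub) auto
    finally show ?thesis .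
  qed
  have "(\<Sum>k<N. LINT u:{s k<..s (Suc k)}|lborel. norm (f u))
      = (LINT u|lborel. (\<Sum>k<N. indicator {s k<..s (Suc k)} u *\<^sub>R norm (f u)))"
    unfolding set_lebesgue_integral_def
  proof (rule Bochner_Integration.integral_sum[symmetric])
    fix k assume "k \<in> {..<N}"
    then have "{s k<..s (Suc k)} \<subseteq> {0..T}" using b[of k] b[of "Suc k"] by auto
    from nsub[OF this] show "integrable lborel (\<lambda>u. indicator {s k<..s (Suc k)} u *\<^sub>R norm (f u))"
      by (simp add: set_integrable_def)
  qed
  also have "\<dots> = (LINT u:{s 0<..s N}|lborel. norm (f u))"
    by (simp add: set_lebesgue_integral_def sum_distrib_right[symmetric]
        sum_indicator_grid[of N s, OF mono])
  also have "\<dots> \<le> (LINT u:{0..T}|lborel. norm (f u))"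
    unfolding set_lebesgue_integral_def
  proof (rule integral_mono)
    have "{s 0<..s N} \<subseteq> {0..T}" using b[of 0] b[of N] by auto
    from nsub[OF this] show "integrable lborel (\<lambda>u. indicator {s 0<..s N} u *\<^sub>R norm (f u))"
      by (simp add: set_integrable_def)
    show "integrable lborel (\<lambda>u. indicator {0..T} u *\<^sub>R norm (f u))"
      using nsub[OF order_refl] by (simp add: set_integrable_def)
    show "indicator {s 0<..s N} u *\<^sub>R norm (f u) \<le> indicator {0..T} u *\<^sub>R norm (f u)" for u
      using b[of 0] b[of N] by (auto split: split_indicator)
  qed
  finally show "(\<Sum>k<N. \<bar>?V (s (Suc k)) - ?V (s k)\<bar>)
      \<le> (LINT u:{0..T}|lborel. norm (f u))"
    using sum_mono[of "{..<N}", OF inc] by force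
qed

text \<open>
  The sum is at most the variation of \<open>V\<close> times the largest increment of \<open>y\<close> over a cell, which tends to 0
  because \<open>y\<close> is uniformly continuous.
\<close>

lemma bracket_finite_variation_tendsto_0:
  assumes V: "finite_variation T V" and y: "continuous_on {0..T} y"
    and g: "\<And>m. grid_in T (N m) (s m)"
    and mesh: "\<And>m k. k < N m \<Longrightarrow> s m (Suc k) - s m k \<le> \<epsilon> m" "\<epsilon> \<longlonglongrightarrow> (0::real)"
  shows "(\<lambda>m. bracket (N m) (s m) V y) \<longlonglongrightarrow> 0"
proof (rule LIMSEQ_I)
  fix e :: real assume e: "0 < e"
  obtain L0 where L0: "\<And>N s. grid_in T N s \<Longrightarrow> (\<Sum>k<N. \<bar>V (s (Suc k)) - V (s k)\<bar>) \<le> L0"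
    using V by (auto simp: finite_variation_def)
  define L where "L = \<bar>L0\<bar> + 1"
  have L: "0 < L" "\<And>N s. grid_in T N s \<Longrightarrow> (\<Sum>k<N. \<bar>V (s (Suc k)) - V (s k)\<bar>) < L"
    using L0 unfolding L_def by (simp, meson abs_ge_self less_add_one order_le_less_trans order_trans)
  have "uniformly_continuous_on {0..T} y" using y by (intro compact_uniformly_continuous) auto
  then obtain d where d: "0 < d"
    "\<And>a b. a \<in> {0..T} \<Longrightarrow> b \<in> {0..T} \<Longrightarrow> dist b a < d \<Longrightarrow> dist (y b) (y a) < e / L"
    unfolding uniformly_continuous_on_def using e L(1) by (metis divide_pos_pos)
  obtain m0 where m0: "\<And>m. m \<ge> m0 \<Longrightarrow> \<bar>\<epsilon> m\<bar> < d"
    using LIMSEQ_D[OF mesh(2) d(1)] by auto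
  have "norm (bracket (N m) (s m) V y - 0) < e" if m: "m \<ge> m0" for m
  proof -
    have "\<bar>bracket (N m) (s m) V y\<bar>
        \<le> (\<Sum>k<N m. \<bar>V (s m (Suc k)) - V (s m k)\<bar> * \<bar>y (s m (Suc k)) - y (s m k)\<bar>)"
      unfolding bracket_def abs_mult[symmetric] by (rule sum_abs)
    also have "\<dots> \<le> (\<Sum>k<N m. \<bar>V (s m (Suc k)) - V (s m k)\<bar> * (e / L))"
    proof (intro sum_mono mult_left_mono)
      fix k assume "k \<in> {..<N m}"
      then have k: "k < N m" by simp
      have "s m k \<le> s m (Suc k)" using g[of m] k by (simp add: grid_in_def)
      moreover have "s m (Suc k) - s m k < d" using mesh(1)[OF k] m0[OF m] by linarith
      ultimately have "dist (y (s m (Suc k))) (y (s m k)) < e / L"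
        using grid_inD[OF g] k by (intro d(2)) (auto simp: dist_real_def)
      then show "\<bar>y (s m (Suc k)) - y (s m k)\<bar> \<le> e / L" by (simp add: dist_real_def)
    qed simp
    also have "\<dots> = (\<Sum>k<N m. \<bar>V (s m (Suc k)) - V (s m k)\<bar>) * (e / L)"
      by (rule sum_distrib_right[symmetric])
    also have "\<dots> < L * (e / L)"
      using L(2)[OF g] e L(1) by (intro mult_strict_right_mono) auto
    also have "\<dots> = e" using L(1) by simp
    finally show ?thesis by simp
  qed
  then show "\<exists>no. \<forall>m\<ge>no. norm (bracket (N m) (s m) V y - 0) < e" by blast
qed

text \<open>
  The measures whose densities are the positive and the negative part of \<open>f\<close> agree on all half-lines,
  hence are equal, and so are their densities.
\<close>

lemma AE_zero_of_zero_integrals: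
  fixes f :: "real \<Rightarrow> real"
  assumes f: "set_integrable lborel {0<..T} f"
    and zero: "\<And>t. 0 < t \<Longrightarrow> t \<le> T \<Longrightarrow> (LINT u:{0<..t}|lborel. f u) = 0"
  shows "AE u in lborel. u \<in> {0<..T} \<longrightarrow> f u = 0"
proof -
  define h where "h u = indicator {0<..T} u *\<^sub>R f u" for u
  have hi: "integrable lborel h" using f by (simp add: h_def[abs_def] set_integrable_def)
  then have [measurable]: "h \<in> borel_measurable borel" using borel_measurable_integrable[OF hi] by simp
  have tail: "(LINT u:{x<..}|lborel. h u) = 0" for x
  proof -
    have int: "set_integrable lborel A f" if "A \<subseteq> {0<..T}" "A \<in> sets borel" for A
      using set_integrable_subset[OF f, of A] that by simp
    have eq: "(LINT u:{x<..}|lborel. h u) = (LINT u:{x<..} \<inter> {0<..T}|lborel. f u)"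
      unfolding set_lebesgue_integral_def h_def
      by (intro Bochner_Integration.integral_cong refl) (simp split: split_indicator)
    show ?thesis
    proof (cases "T \<le> x \<or> T \<le> 0")
      case True
      then have "{x<..} \<inter> {0<..T} = {}" by auto
      then show ?thesis unfolding eq by (simp add: set_lebesgue_integral_def)
    next
      case False
      define z where "z = max 0 x"
      have z: "0 \<le> z" "z < T" "{x<..} \<inter> {0<..T} = {z<..T}" using False by (auto simp: z_def)
      have U: "{0<..T} = {0<..z} \<union> {z<..T}" using z(1,2) by auto
      have "{0<..z} \<inter> {z<..T} = {}" "{0<..z} \<subseteq> {0<..T}" "{z<..T} \<subseteq> {0<..T}" using z(1,2) by auto
      then have "(LINT u:{0<..T}|lborel. f u) = (LINT u:{0<..z}|lborel. f u) + (LINT u:{z<..T}|lborel. f u)"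
        by (subst U, intro set_integral_Un int) simp_all
      moreover have "(LINT u:{0<..z}|lborel. f u) = 0" 
      proof (cases "z = 0")
        case True
        then show ?thesis by (simp add: set_lebesgue_integral_def)
      next
        case False
        then show ?thesis using zero[of z] z by simp
      qed
      moreover have "(LINT u:{0<..T}|lborel. f u) = 0" using zero[of T] z by simp
      ultimately show ?thesis unfolding eq z(3) by simp
    qed
  qed
  let ?P = "density lborel (\<lambda>u. ennreal (max 0 (h u)))" and ?N = "density lborel (\<lambda>u. ennreal (max 0 (- h u)))"
  have ip: "integrable lborel (\<lambda>u. max 0 (h u))" "integrable lborel (\<lambda>u. max 0 (- h u))" using hi by auto
  have ipx: "integrable lborel (\<lambda>u. indicator {x<..} u *\<^sub>R max 0 (h u))"
    "integrable lborel (\<lambda>u. indicator {x<..} u *\<^sub>R max 0 (- h u))" for x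
    using ip by (intro integrable_mult_indicator; simp)+
  have em: "emeasure ?P {x<..} = ennreal (LINT u:{x<..}|lborel. max 0 (h u))"
    "emeasure ?N {x<..} = ennreal (LINT u:{x<..}|lborel. max 0 (- h u))" for x
  proof -
    have "emeasure ?P {x<..} = (\<integral>\<^sup>+u. ennreal (indicator {x<..} u *\<^sub>R max 0 (h u)) \<partial>lborel)"
      by (subst emeasure_density) (auto intro!: nn_integral_cong split: split_indicator)
    then show "emeasure ?P {x<..} = ennreal (LINT u:{x<..}|lborel. max 0 (h u))"
      using nn_integral_eq_integral[OF ipx(1)[of x]] by (simp add: set_lebesgue_integral_def)
    have "emeasure ?N {x<..} = (\<integral>\<^sup>+u. ennreal (indicator {x<..} u *\<^sub>R max 0 (- h u)) \<partial>lborel)"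
      by (subst emeasure_density) (auto intro!: nn_integral_cong split: split_indicator)
    then show "emeasure ?N {x<..} = ennreal (LINT u:{x<..}|lborel. max 0 (- h u))"
      using nn_integral_eq_integral[OF ipx(2)[of x]] by (simp add: set_lebesgue_integral_def)
  qed
  have diff: "(LINT u:{x<..}|lborel. max 0 (h u)) - (LINT u:{x<..}|lborel. max 0 (- h u)) = 0" for x
  proof -
    have "(LINT u:{x<..}|lborel. max 0 (h u)) - (LINT u:{x<..}|lborel. max 0 (- h u))
        = (LINT u:{x<..}|lborel. h u)"
      unfolding set_lebesgue_integral_def
      by (subst Bochner_Integration.integral_diff[OF ipx, symmetric])
        (auto intro!: Bochner_Integration.integral_cong split: split_indicator)
    then show ?thesis by (simp add: tail)
  qed
  have "?P = ?N"
  proof (rule measure_eqI_lessThan)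
    show "emeasure ?P {x<..} < \<infinity>" for x unfolding em by simp
    show "emeasure ?P {x<..} = emeasure ?N {x<..}" for x unfolding em using diff[of x] by simp
  qed simp_all
  then have "AE u in lborel. ennreal (max 0 (h u)) = ennreal (max 0 (- h u))"
    by (subst (asm) sigma_finite_measure.density_unique_iff[OF sigma_finite_lborel]) auto
  then show ?thesis
  proof eventually_elim
    case (elim u)
    then have "h u = 0" by (auto simp: max_def split: if_splits)
    then show ?case by (auto simp: h_def)
  qed
qed

section \<open>Singularity of the joint law\<close>

text \<open>
  Errors of size \<open>(1 / 2) ^ m\<close> in the mean are summable, so convergence holds almost surely and not
  merely in probability.
\<close>

lemma bracket_sequence:
  fixes B :: "'w \<Rightarrow> real \<Rightarrow> real^'d" and W :: "'w \<Rightarrow> real \<Rightarrow> real^'n"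
  assumes M: "prob_space M" and B: "std_brownian_motion T M B" and W: "std_brownian_motion T M W"
    and ind: "indep_elements M (path_space T) B (path_space T) W"
    and I: "wiener_integral T M g0 B I" and J: "wiener_integral T M g1 W J"
    and t: "0 < t" "t \<le> T"
  obtains N s where "\<And>m. grid_in T (N m) (s m)"
    "\<And>m k. k < N m \<Longrightarrow> s m (Suc k) - s m k \<le> (1 / 2) ^ m"
    "AE \<omega> in M. (\<lambda>m. bracket (N m) (s m) (\<lambda>t. I \<omega> t + J \<omega> t) (\<lambda>t. W \<omega> t $ j))
      \<longlonglongrightarrow> (LINT u:{0<..t}|lborel. g1 u $ j)"
proof -
  let ?c = "LINT u:{0<..t}|lborel. g1 u $ j"
  define R where "R m N s \<longleftrightarrow> s 0 = 0 \<and> s N = t \<and>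
      (\<forall>k<N. s k \<le> s (Suc k) \<and> s (Suc k) - s k \<le> (1 / 2) ^ m) \<and>
      (\<integral>\<^sup>+\<omega>. ennreal \<bar>bracket N s (\<lambda>t. I \<omega> t + J \<omega> t) (\<lambda>t. W \<omega> t $ j) - ?c\<bar> \<partial>M) \<le> ennreal ((1 / 2) ^ m)"
    for m :: nat and N s
  have "\<exists>N s. R m N s" for m
    unfolding R_def bracket_def by (rule bracket_approximation[OF M B W ind I J t]) simp
  then obtain N s where R: "\<And>m. R m (N m) (s m)" by metis
  let ?b = "\<lambda>m \<omega>. bracket (N m) (s m) (\<lambda>t. I \<omega> t + J \<omega> t) (\<lambda>t. W \<omega> t $ j)"
  have ends: "\<And>m. s m 0 = 0" "\<And>m. s m (N m) = t"
    and steps: "\<And>m k. k < N m \<Longrightarrow> s m k \<le> s m (Suc k)" "\<And>m k. k < N m \<Longrightarrow> s m (Suc k) - s m k \<le> (1 / 2) ^ m"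
    and small: "\<And>m. (\<integral>\<^sup>+\<omega>. ennreal \<bar>?b m \<omega> - ?c\<bar> \<partial>M)
      \<le> ennreal ((1 / 2) ^ m)"
    using R unfolding R_def by blast+
  have g: "grid_in T (N m) (s m)" for m
    unfolding grid_in_def using ends steps(1) t by auto
  have Wj: "(\<lambda>\<omega>. W \<omega> u $ j) \<in> borel_measurable M" if "u \<in> {0..T}" for u
    unfolding cart_eq_inner_axis
    by (intro borel_measurable_inner borel_measurable_const brownian_motion_measurable[OF W that])
  have IJ: "(\<lambda>\<omega>. I \<omega> u + J \<omega> u) \<in> borel_measurable M" if "u \<in> {0..T}" for u
    by (intro borel_measurable_add wiener_integral_measurable[OF I that] wiener_integral_measurable[OF J that])
  have "(\<lambda>\<omega>. ?b m \<omega>) \<in> borel_measurable M" for m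
    unfolding bracket_def
    by (intro borel_measurable_sum borel_measurable_times borel_measurable_diff Wj IJ grid_inD[OF g]) auto
  then have "AE \<omega> in M. (\<lambda>m. ?b m \<omega> - ?c) \<longlonglongrightarrow> 0"
    by (intro AE_tendsto_0_of_small_integrals small borel_measurable_diff borel_measurable_const)
  then have "AE \<omega> in M. (\<lambda>m. ?b m \<omega>) \<longlonglongrightarrow> ?c"
    by eventually_elim (simp add: LIM_zero_iff)
  with g steps(2) show ?thesis by (rule that)
qed

text \<open>
  For a fixed path \<open>y\<close> the realised covariation is a finite combination of values of the Gaussian process
  \<open>I + J\<close>, with weights given by the increments of \<open>y\<close>, so the anticoncentration bound holds with the same
  constant for every grid.
\<close>

lemma bracket_with_fixed_path_avoids:
  fixes B :: "'w \<Rightarrow> real \<Rightarrow> real^'d" and W :: "'w \<Rightarrow> real \<Rightarrow> real^'n"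
  assumes M: "prob_space M" and B: "std_brownian_motion T M B" and W: "std_brownian_motion T M W"
    and ind: "indep_elements M (path_space T) B (path_space T) W"
    and I: "wiener_integral T M g0 B I" and J: "wiener_integral T M g1 W J" and T: "0 \<le> T"
    and g: "\<And>m. grid_in T (N m) (s m)" and c: "c \<noteq> 0"
  shows "AE \<omega> in M. \<not> (\<lambda>m. bracket (N m) (s m) (\<lambda>t. I \<omega> t + J \<omega> t) y) \<longlonglongrightarrow> c"
proof (rule AE_not_tendsto_of_small_ball[OF M, where \<rho> = "\<bar>c\<bar> / 4" and L = "8 / \<bar>c\<bar>"])
  define K where "K m = {..<N m} \<times> (UNIV :: bool set)" for m
  define \<tau> where "\<tau> m = (\<lambda>(k, e). s m (if e then Suc k else k))" for m
  define \<beta> where "\<beta> m = (\<lambda>(k, e). (if e then 1 else - 1) * (y (s m (Suc k)) - y (s m k)))" for m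
  \<comment> \<open>Each increment contributes its two endpoints, distinguished by a boolean.\<close>
  have eq: "bracket (N m) (s m) (\<lambda>t. I \<omega> t + J \<omega> t) y
      = (\<Sum>p\<in>K m. \<beta> m p * (I \<omega> (\<tau> m p) + J \<omega> (\<tau> m p)))" for m \<omega>
    unfolding bracket_def K_def \<beta>_def \<tau>_def
    unfolding sum.cartesian_product' UNIV_bool
    by (intro sum.cong refl) (simp add: left_diff_distrib right_diff_distrib add_diff_eq)
  have \<tau>: "\<tau> m p \<in> {0..T}" if "p \<in> K m" for m p
    using that grid_inD[OF g[of m]] by (auto simp: K_def \<tau>_def)
  have IJ: "(\<lambda>\<omega>. I \<omega> u + J \<omega> u) \<in> borel_measurable M" if "u \<in> {0..T}" for u
    by (intro borel_measurable_add wiener_integral_measurable[OF I that] wiener_integral_measurable[OF J that])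
  show "(\<lambda>\<omega>. bracket (N m) (s m) (\<lambda>t. I \<omega> t + J \<omega> t) y) \<in> borel_measurable M" for m
    unfolding eq by (intro borel_measurable_sum borel_measurable_times borel_measurable_const IJ \<tau>)
  show "measure M {\<omega>\<in>space M. \<bar>bracket (N m) (s m) (\<lambda>t. I \<omega> t + J \<omega> t) y - c\<bar> \<le> e} \<le> 8 / \<bar>c\<bar> * e"
    if "0 < e" "e \<le> \<bar>c\<bar> / 4" for m e
  proof -
    have "finite (K m)" by (simp add: K_def)
    from gaussian_integral_anticoncentration[where \<tau> = "\<tau> m" and \<beta> = "\<beta> m", OF M B W ind I J T this \<tau> that(1)]
    show ?thesis unfolding eq using that(2) by simp
  qed
qed (use c in auto)

lemma matrix_entry_with_nonzero_integral:
  fixes \<sigma> :: "real \<Rightarrow> real^'n^'d"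
  assumes int: "\<And>i. set_integrable lborel {0<..T} (\<lambda>s. \<sigma> s $ i)"
    and nz: "\<not> (AE t in lborel. t \<in> {0..T} \<longrightarrow> \<sigma> t = 0)"
  shows "\<exists>i j t. 0 < t \<and> t \<le> T \<and> (LINT u:{0<..t}|lborel. \<sigma> u $ i $ j) \<noteq> 0"
proof (rule ccontr)
  assume "\<not> (\<exists>i j t. 0 < t \<and> t \<le> T \<and> (LINT u:{0<..t}|lborel. \<sigma> u $ i $ j) \<noteq> 0)"
  then have zero: "(LINT u:{0<..t}|lborel. \<sigma> u $ i $ j) = 0" if "0 < t" "t \<le> T" for i j t
    using that by blast
  have ij: "AE t in lborel. t \<in> {0<..T} \<longrightarrow> \<sigma> t $ i $ j = 0" for i j
  proof (rule AE_zero_of_zero_integrals)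
    have "integrable lborel (\<lambda>s. (indicator {0<..T} s *\<^sub>R (\<sigma> s $ i)) \<bullet> axis j 1)"
      using int[of i] unfolding set_integrable_def by (rule integrable_inner_left[rotated])
    then show "set_integrable lborel {0<..T} (\<lambda>s. \<sigma> s $ i $ j)"
      by (simp add: set_integrable_def inner_axis)
  qed (rule zero)
  have "AE t in lborel. \<forall>i\<in>UNIV. \<forall>j\<in>UNIV. t \<in> {0<..T} \<longrightarrow> \<sigma> t $ i $ j = 0"
    using ij by (intro AE_finite_allI) auto
  moreover have "AE t in lborel. t \<noteq> (0::real)" by (rule AE_lborel_singleton)
  ultimately have "AE t in lborel. t \<in> {0..T} \<longrightarrow> \<sigma> t = 0"
    by eventually_elim (auto simp: vec_eq_iff)
  with nz show False by simp
qed

theorem theorem5p4: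
  fixes T :: real
    and \<mu> :: "(real^'d) measure"
    and b :: "real \<Rightarrow> real^'d \<Rightarrow> real^'d"
    and \<sigma>0 :: "real \<Rightarrow> real^'d^'d"
    and \<sigma>1 :: "real \<Rightarrow> real^'n^'d"
    and h :: "real^'d \<Rightarrow> real^'n"
    and M :: "'w measure"
    and X0 :: "'w \<Rightarrow> real^'d"
    and B X :: "'w \<Rightarrow> real \<Rightarrow> real^'d"
    and W Y :: "'w \<Rightarrow> real \<Rightarrow> real^'n"
  assumes T_pos: "T > 0"
    and b_measurable: "(\<lambda>(t, x). b t x) \<in> borel_measurable (restrict_space borel {0..T} \<Otimes>\<^sub>M borel)"
    and \<sigma>0_measurable: "\<sigma>0 \<in> borel_measurable (restrict_space borel {0..T})"
    and \<sigma>1_measurable: "\<sigma>1 \<in> borel_measurable (restrict_space borel {0..T})"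
    and h_measurable: "h \<in> borel_measurable borel"
    and b_linear: "\<And>t. t \<in> {0..T} \<Longrightarrow> linear (b t)"
    and \<sigma>1_nonzero: "\<not> (AE t in lborel. t \<in> {0..T} \<longrightarrow> \<sigma>1 t = 0)"
    and solution: "system_solution T \<mu> b \<sigma>0 \<sigma>1 h M X0 B W X Y"
    and uniqueness: "unique_in_law T \<mu> b \<sigma>0 \<sigma>1 h"
    and strong: "\<exists>X'. strong_signal_solution T b \<sigma>0 \<sigma>1 M X0 B W X'"
    and energy: "(\<integral>\<^sup>+\<omega>. (\<integral>\<^sup>+s\<in>{0..T}. ennreal ((norm (h (X \<omega> s)))\<^sup>2) \<partial>lborel) \<partial>M) < \<infinity>"
  shows "\<not> (\<exists>\<nu> :: (real \<Rightarrow> real^'n) measure.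
            sets \<nu> = sets (path_space T) \<and> sigma_finite_measure \<nu> \<and>
            absolutely_continuous (law_X T M X \<Otimes>\<^sub>M \<nu>) (law_XY T M X Y))"
proof
  assume "\<exists>\<nu> :: (real \<Rightarrow> real^'n) measure.
            sets \<nu> = sets (path_space T) \<and> sigma_finite_measure \<nu> \<and>
            absolutely_continuous (law_X T M X \<Otimes>\<^sub>M \<nu>) (law_XY T M X Y)"
  then obtain \<nu> :: "(real \<Rightarrow> real^'n) measure" where \<nu>: "sets \<nu> = sets (path_space T)" "sigma_finite_measure \<nu>"
    and ac: "absolutely_continuous (law_X T M X \<Otimes>\<^sub>M \<nu>) (law_XY T M X Y)"
    by blast
  have M: "prob_space M" and B: "std_brownian_motion T M B" and W: "std_brownian_motion T M W"
    and ind: "indep_elements M (path_space T) B (path_space T) W"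
    using solution by (auto simp: system_solution_def system_inputs_def)
  interpret prob_space M by fact
  have Xc: "continuous_process T M X" and bX: "AE \<omega> in M. set_integrable lborel {0..T} (\<lambda>s. b s (X \<omega> s))"
    and Yc: "continuous_process T M Y" and hX: "AE \<omega> in M. set_integrable lborel {0..T} (\<lambda>s. h (X \<omega> s))"
    and Yeq: "AE \<omega> in M. \<forall>t\<in>{0..T}. Y \<omega> t = (LINT s:{0..t}|lborel. h (X \<omega> s)) + W \<omega> t"
    using solution by (auto simp: system_solution_def signal_equation_def observation_equation_def)
  obtain I J where I: "has_stochastic_integral T M \<sigma>0 B I" and J: "has_stochastic_integral T M \<sigma>1 W J"
    and Xeq: "AE \<omega> in M. \<forall>t\<in>{0..T}. X \<omega> t = X0 \<omega> + (LINT s:{0..t}|lborel. b s (X \<omega> s)) + I \<omega> t + J \<omega> t"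
    using solution by (auto simp: system_solution_def signal_equation_def)
  have Ic: "continuous_process T M I" and Jc: "continuous_process T M J"
    using I J by (auto simp: has_stochastic_integral_def)
  note Iw = stochastic_integral_component[OF I \<sigma>0_measurable]
  note Jw = stochastic_integral_component[OF J \<sigma>1_measurable]

  have "set_integrable lborel {0<..T} (\<lambda>s. \<sigma>1 s $ i)" for i
  proof -
    let ?g = "\<lambda>s. indicator {0..T} s *\<^sub>R (\<sigma>1 s $ i)"
    have [measurable]: "?g \<in> borel_measurable borel" using Jw[of i] by (simp add: wiener_integral_def)
    have fin: "(\<integral>\<^sup>+s\<in>{0<..T}. ennreal ((norm (?g s))\<^sup>2) \<partial>lborel) < \<infinity>"
      using T_pos by (intro wiener_integrand_square_integrable[OF M W Jw]) simp
    have "integrable lborel (\<lambda>s. indicator {0<..T} s *\<^sub>R ?g s)"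
    proof (rule integrableI_bounded)
      have "(\<integral>\<^sup>+s. ennreal (norm (indicator {0<..T} s *\<^sub>R ?g s)) \<partial>lborel)
          \<le> (\<integral>\<^sup>+s. indicator {0<..T} s + ennreal ((norm (?g s))\<^sup>2) * indicator {0<..T} s \<partial>lborel)"
      proof (rule nn_integral_mono)
        fix s
        have "norm (?g s) \<le> 1 + (norm (?g s))\<^sup>2"
          using abs_le_of_square[of 1 "norm (?g s)"] zero_le_power2[of "norm (?g s)"] unfolding abs_norm_cancel by linarith
        then have "ennreal (norm (?g s)) \<le> 1 + ennreal ((norm (?g s))\<^sup>2)"
          by (metis ennreal_1 ennreal_leI ennreal_plus zero_le_one zero_le_power2)
        then show "ennreal (norm (indicator {0<..T} s *\<^sub>R ?g s))
            \<le> indicator {0<..T} s + ennreal ((norm (?g s))\<^sup>2) * indicator {0<..T} s"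
          by (cases "s \<in> {0<..T}") simp_all
      qed
      also have "\<dots> = (\<integral>\<^sup>+s. indicator {0<..T} s \<partial>lborel)
          + (\<integral>\<^sup>+s\<in>{0<..T}. ennreal ((norm (?g s))\<^sup>2) \<partial>lborel)"
        by (rule nn_integral_add) measurable
      also have "\<dots> < \<infinity>"
        using fin T_pos by simp
      finally show "(\<integral>\<^sup>+s. ennreal (norm (indicator {0<..T} s *\<^sub>R ?g s)) \<partial>lborel) < \<infinity>" .
    qed measurable
    moreover have "indicator {0<..T} s *\<^sub>R ?g s = indicator {0<..T} s *\<^sub>R (\<sigma>1 s $ i)" for s
      by (auto split: split_indicator)
    ultimately show ?thesis unfolding set_integrable_def by (simp only:)
  qed
  then obtain i j t where t: "0 < t" "t \<le> T" and nz: "(LINT u:{0<..t}|lborel. \<sigma>1 u $ i $ j) \<noteq> 0"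
    using matrix_entry_with_nonzero_integral[OF _ \<sigma>1_nonzero] by blast
  define c where "c = (LINT u:{0<..t}|lborel. (indicator {0..T} u *\<^sub>R (\<sigma>1 u $ i)) $ j)"
  have "c = (LINT u:{0<..t}|lborel. \<sigma>1 u $ i $ j)"
    unfolding c_def set_lebesgue_integral_def using t
    by (intro Bochner_Integration.integral_cong refl) (auto split: split_indicator)
  with nz have c: "c \<noteq> 0" by simp
  obtain N s where g: "\<And>m. grid_in T (N m) (s m)"
    and mesh: "\<And>m k. k < N m \<Longrightarrow> s m (Suc k) - s m k \<le> (1 / 2) ^ m"
    and lim: "AE \<omega> in M. (\<lambda>m. bracket (N m) (s m) (\<lambda>t. I \<omega> t $ i + J \<omega> t $ i) (\<lambda>t. W \<omega> t $ j)) \<longlonglongrightarrow> c"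
    unfolding c_def using bracket_sequence[OF M B W ind Iw Jw t] by blast
  have mesh0: "(\<lambda>m. (1 / 2 :: real) ^ m) \<longlonglongrightarrow> 0" by (intro LIMSEQ_power_zero) simp
  note fv0 = bracket_finite_variation_tendsto_0[OF _ _ g mesh mesh0]
  define Q where "Q m x y = bracket (N m) (s m) (\<lambda>t. x t $ i) (\<lambda>t. y t $ j)"
    for m and x :: "real \<Rightarrow> real^'d" and y :: "real \<Rightarrow> real^'n"
  note comp = continuous_on_component

  \<comment> \<open>The drift has finite variation, so against a continuous path only the Gaussian part of the
    signal counts. The null set does not depend on the path: the same fact serves for the random
    path \<open>Y\<close> and for a fixed one.\<close>
  have split: "AE \<omega> in M. \<forall>y. continuous_on {0..T} (\<lambda>t. y t $ j) \<longrightarrow>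
      (\<lambda>m. Q m (X \<omega>) y - bracket (N m) (s m) (\<lambda>t. I \<omega> t $ i + J \<omega> t $ i) (\<lambda>t. y t $ j)) \<longlonglongrightarrow> 0"
    using bX Xeq
  proof eventually_elim
    case (elim \<omega>)
    let ?V = "\<lambda>t. X0 \<omega> $ i + (LINT s:{0..t}|lborel. b s (X \<omega> s)) $ i"
    have V: "finite_variation T ?V" by (rule finite_variation_integral[OF elim(1)])
    have "Q m (X \<omega>) y - bracket (N m) (s m) (\<lambda>t. I \<omega> t $ i + J \<omega> t $ i) (\<lambda>t. y t $ j)
        = bracket (N m) (s m) ?V (\<lambda>t. y t $ j)" for m y
    proof -
      have "Q m (X \<omega>) y = bracket (N m) (s m) (\<lambda>t. ?V t + (I \<omega> t $ i + J \<omega> t $ i)) (\<lambda>t. y t $ j)"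
        unfolding Q_def using elim(2) by (intro bracket_cong[OF g]) (simp_all add: add_ac)
      then show ?thesis by (simp only: bracket_add_left add_diff_cancel_right')
    qed
    then show ?case using fv0[OF V] by simp
  qed

  have joint: "AE \<omega> in M. (\<lambda>m. Q m (X \<omega>) (Y \<omega>)) \<longlonglongrightarrow> c"
    using split lim hX Yeq AE_space
  proof eventually_elim
    case (elim \<omega>)
    let ?Z = "\<lambda>t. I \<omega> t $ i + J \<omega> t $ i"
    let ?H = "\<lambda>t. 0 + (LINT s:{0..t}|lborel. h (X \<omega> s)) $ j"
    have H: "finite_variation T ?H" by (rule finite_variation_integral[OF elim(3)])
    \<comment> \<open>Here the roles are exchanged: the finite variation sits in the second factor, and the
    continuity of \<open>Z\<close> makes its contribution vanish.\<close>
    have Z: "continuous_on {0..T} ?Z"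
      by (intro continuous_on_add comp continuous_process_continuous_on[OF Ic elim(5)]
          continuous_process_continuous_on[OF Jc elim(5)])
    have "bracket (N m) (s m) ?Z (\<lambda>t. Y \<omega> t $ j)
        = bracket (N m) (s m) ?H ?Z + bracket (N m) (s m) ?Z (\<lambda>t. W \<omega> t $ j)" for m
    proof -
      have "bracket (N m) (s m) ?Z (\<lambda>t. Y \<omega> t $ j) = bracket (N m) (s m) ?Z (\<lambda>t. ?H t + W \<omega> t $ j)"
        using elim(4) by (intro bracket_cong[OF g]) simp_all
      also have "\<dots> = bracket (N m) (s m) ?Z ?H + bracket (N m) (s m) ?Z (\<lambda>t. W \<omega> t $ j)"
        by (rule bracket_add_right)
      also have "bracket (N m) (s m) ?Z ?H = bracket (N m) (s m) ?H ?Z"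
        by (rule bracket_commute)
      finally show ?thesis .
    qed
    moreover have "(\<lambda>m. bracket (N m) (s m) ?H ?Z + bracket (N m) (s m) ?Z (\<lambda>t. W \<omega> t $ j)) \<longlonglongrightarrow> 0 + c"
      by (intro tendsto_add fv0[OF H Z] elim(2))
    ultimately have "(\<lambda>m. bracket (N m) (s m) ?Z (\<lambda>t. Y \<omega> t $ j)) \<longlonglongrightarrow> c" by simp
    moreover have "(\<lambda>m. Q m (X \<omega>) (Y \<omega>) - bracket (N m) (s m) ?Z (\<lambda>t. Y \<omega> t $ j)) \<longlonglongrightarrow> 0"
      using elim(1) comp[OF continuous_process_continuous_on[OF Yc elim(5)]] by blast
    ultimately show ?case using tendsto_add[of _ 0 sequentially _ c] by force
  qed

  have fixed: "AE \<omega> in M. \<not> (\<lambda>m. Q m (X \<omega>) y) \<longlonglongrightarrow> c" if y: "y \<in> space (path_space T)" for y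
    using split bracket_with_fixed_path_avoids[where N = N and s = s and y = "\<lambda>t. y t $ j",
        OF M B W ind Iw[of i] Jw[of i] less_imp_le[OF T_pos] g c]
  proof eventually_elim
    case (elim \<omega>)
    have "continuous_on {0..T} (\<lambda>t. y t $ j)" using y by (intro comp) (simp add: space_path_space)
    with elim(1) have "(\<lambda>m. Q m (X \<omega>) y - bracket (N m) (s m) (\<lambda>t. I \<omega> t $ i + J \<omega> t $ i) (\<lambda>t. y t $ j)) \<longlonglongrightarrow> 0"
      by blast
    with elim(2) show ?case using tendsto_diff[of "\<lambda>m. Q m (X \<omega>) y" c] by force
  qed

  let ?P = "path_space T \<Otimes>\<^sub>M path_space T :: ((real \<Rightarrow> real^'d) \<times> (real \<Rightarrow> real^'n)) measure"
  \<comment> \<open>The set that separates the joint law from the product measure.\<close>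
  define A where "A = {p \<in> space ?P. (\<lambda>m. Q m (fst p) (snd p)) \<longlonglongrightarrow> c}"
  have "(\<lambda>p. Q m (fst p) (snd p)) \<in> borel_measurable ?P" for m
  proof -
    note ev = measurable_compose[OF measurable_fst measurable_path_component]
      measurable_compose[OF measurable_snd measurable_path_component]
    show ?thesis
      unfolding Q_def bracket_def
      by (intro borel_measurable_sum borel_measurable_times borel_measurable_diff ev grid_inD[OF g]) auto
  qed
  then have A: "A \<in> sets ?P" unfolding A_def by measurable

  interpret PX: prob_space "law_X T M X"
    unfolding law_X_def by (rule prob_space_distr[OF Xc])
  interpret \<nu>: sigma_finite_measure \<nu> by fact
  interpret pair_sigma_finite "law_X T M X" \<nu> ..
  have sets_prod: "sets (law_X T M X \<Otimes>\<^sub>M \<nu>) = sets ?P"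
    by (intro sets_pair_measure_cong) (auto simp: law_X_def \<nu>)
  have "emeasure (law_X T M X \<Otimes>\<^sub>M \<nu>) A = (\<integral>\<^sup>+y. emeasure (law_X T M X) ((\<lambda>x. (x, y)) -` A) \<partial>\<nu>)"
    by (rule emeasure_pair_measure_alt2) (simp add: sets_prod A)
  also have "\<dots> = (\<integral>\<^sup>+y. 0 \<partial>\<nu>)"
  proof (rule nn_integral_cong)
    fix y assume "y \<in> space \<nu>"
    then have y: "y \<in> space (path_space T)" using sets_eq_imp_space_eq[OF \<nu>(1)] by simp
    have Ay: "(\<lambda>x. (x, y)) -` A \<in> sets (path_space T)"
    proof -
      have "(\<lambda>x. (x, y)) -` A \<inter> space (path_space T) \<in> sets (path_space T)"
        by (rule measurable_sets[OF _ A]) (use y in measurable)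
      moreover have "(\<lambda>x. (x, y)) -` A \<subseteq> space (path_space T)"
        by (auto simp: A_def space_pair_measure)
      ultimately show ?thesis by (simp add: Int_absorb2)
    qed
    have "emeasure (law_X T M X) ((\<lambda>x. (x, y)) -` A) = emeasure M (X -` ((\<lambda>x. (x, y)) -` A) \<inter> space M)"
      unfolding law_X_def by (rule emeasure_distr[OF Xc Ay])
    also have "\<dots> = 0"
    proof -
      have "X -` ((\<lambda>x. (x, y)) -` A) \<inter> space M = {\<omega>\<in>space M. (X \<omega>, y) \<in> A}" by auto
      moreover have "AE \<omega> in M. (X \<omega>, y) \<notin> A"
        using fixed[OF y] by eventually_elim (auto simp: A_def)
      ultimately show ?thesis by (simp add: emeasure_eq_0_AE)
    qed
    finally show "emeasure (law_X T M X) ((\<lambda>x. (x, y)) -` A) = 0" .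
  qed
  finally have "A \<in> null_sets (law_X T M X \<Otimes>\<^sub>M \<nu>)"
    using A sets_prod by (auto simp: null_sets_def)
  then have "A \<in> null_sets (law_XY T M X Y)" using ac by (auto simp: absolutely_continuous_def)
  then have "emeasure M ((\<lambda>\<omega>. (X \<omega>, Y \<omega>)) -` A \<inter> space M) = 0"
    using emeasure_distr[OF measurable_Pair[OF Xc Yc] A] by (simp add: law_XY_def null_sets_def)
  moreover have "emeasure M ((\<lambda>\<omega>. (X \<omega>, Y \<omega>)) -` A \<inter> space M) = 1"
  proof (rule emeasure_eq_1_AE)
    show "(\<lambda>\<omega>. (X \<omega>, Y \<omega>)) -` A \<inter> space M \<in> sets M"
      by (rule measurable_sets[OF measurable_Pair[OF Xc Yc] A])
    show "AE \<omega> in M. \<omega> \<in> (\<lambda>\<omega>. (X \<omega>, Y \<omega>)) -` A \<inter> space M"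
      using joint AE_space
    proof eventually_elim
      case (elim \<omega>)
      then show ?case
        using measurable_space[OF Xc elim(2)] measurable_space[OF Yc elim(2)]
        by (auto simp: A_def space_pair_measure)
    qed
  qed
  ultimately show False by simp
qed

end
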